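(* Let $0<p_1,p_2,q_1,q_2<\infty$, $p_2<p_1$, $q_1\le p_2<q_2$. Let $v_1,v_2\in\mathcal W(0,\infty)$, $u_1\in{}^{\mathbf c}\Omega_{q_1}$ and $u_2\in\Omega_{q_2}$. Put $v(x)=v_1(x)^{-1}v_2(x)$, $V(x)=\|v\|_{p_1\to p_2,(0,x)}$ and $\mathcal V(t,x)=\frac{V(t)}{V(t)+V(x)}$ for $t,x>0$. Assume that $V$ is admissible and that $$\varphi_1(x):=\operatorname*{ess\,sup}_{t\in(0,\infty)}V(t)\,\mathcal V(x,t)\,\|u_1\|_{q_1,(0,t)}^{-1}\in Q_{V^{\frac1{p_1\to p_2}}}.$$ (i) If $p_1\le q_2$, then $$\|\mathrm I\|_{\mathrm{Cop}_{p_1,q_1}(u_1,v_1)\to\mathrm{Ces}_{p_2,q_2}(u_2,v_2)}\approx\sup_{x\in(0,\infty)}\varphi_1(x)\sup_{t\in(0,\infty)}\mathcal V(t,x)\,\|u_2\|_{q_2,(t,\infty)}.$$ (ii) If $q_2<p_1$, then $$\|\mathrm I\|_{\mathrm{Cop}_{p_1,q_1}(u_1,v_1)\to\mathrm{Ces}_{p_2,q_2}(u_2,v_2)}\approx\sup_{x\in(0,\infty)}\varphi_1(x)\bigg(\int_0^\infty\mathcal V(t,x)^{p_1\to q_2}\,d\Big(-\|u_2\|_{q_2,(t,\infty)}^{p_1\to q_2}\Big)\bigg)^{\frac1{p_1\to q_2}}.$$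
   Context: $\mathfrak M^+(0,\infty)$ is the set of non-negative measurable functions on $(0,\infty)$; $\mathcal W(0,\infty)$ is the set of weights (measurable functions, positive and finite a.e. on $(0,\infty)$). For $0<p\le\infty$ and measurable $A\subseteq(0,\infty)$, $\|f\|_{p,A}=(\int_A|f|^p\,dx)^{1/p}$ if $p<\infty$, $\|f\|_{\infty,A}=\operatorname{ess\,sup}_A|f|$, and $\|f\|_{p,w,A}=\|fw\|_{p,A}$. Conventions: $0/0=0$, $0\cdot(\pm\infty)=0$, $1/(\pm\infty)=0$. For $u\in\mathfrak M^+(0,\infty)$, $v\in\mathcal W(0,\infty)$ and $0<p,q\le\infty$, $\mathrm{Ces}_{p,q}(u,v)$ and $\mathrm{Cop}_{p,q}(u,v)$ are the sets of $f\in\mathfrak M^+(0,\infty)$ with finite $\|f\|_{\mathrm{Ces}_{p,q}(u,v)}=\big\|\,\|f\|_{p,v,(0,\cdot)}\big\|_{q,u,(0,\infty)}$, respectively $\|f\|_{\mathrm{Cop}_{p,q}(u,v)}=\big\|\,\|f\|_{p,v,(\cdot,\infty)}\big\|_{q,u,(0,\infty)}$. $\Omega_q$ is the set of $u\in\mathfrak M^+(0,\infty)$ with $0<\|u\|_{q,(t,\infty)}<\infty$ for all $t>0$; ${}^{\mathbf c}\Omega_q$ is the set of $u\in\mathfrak M^+(0,\infty)$ with $0<\|u\|_{q,(0,t)}<\infty$ for all $t>0$. $\|\mathrm I\|_{X\to Y}$ is the best constant of the embedding $X\hookrightarrow Y$: the least $c\in[0,\infty]$ with $\|f\|_Y\le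 c\|f\|_X$ for all $f\in X$. For $0<p,q\le\infty$, $p\to q$ denotes the number given by $\frac1{p\to q}=\frac1q-\frac1p$ if $q<p$, and $p\to q=\infty$ if $q\ge p$. A function $U$ is admissible if it is continuous and strictly increasing on $[0,\infty)$ with $U(0)=0$ and $\lim_{t\to\infty}U(t)=\infty$ (here $V(0)$ means $\lim_{x\to0+}V(x)$). For admissible $U$, a function $\varphi$ is $U$-quasiconcave if $\varphi$ is equivalent (up to multiplicative constants) to an increasing function on $(0,\infty)$ and $\varphi/U$ is equivalent to a decreasing function on $(0,\infty)$; it is non-degenerate if $\lim_{t\to0+}\varphi(t)=\lim_{t\to\infty}\frac1{\varphi(t)}=\lim_{t\to\infty}\frac{\varphi(t)}{U(t)}=\lim_{t\to0+}\frac{U(t)}{\varphi(t)}=0$. $Q_U$ is the family of non-degenerate $U$-quasiconcave functions. For non-decreasing $h$ on $(0,\infty)$, $\int f\,dh$ is the Lebesgue–Stieltjes integral. $A\approx B$ means $c^{-1}B\le A\le cB$ with a constant $c>0$ depending only on $p_1,p_2,q_1,q_2$. *)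

theory Defs
  imports "HOL-Probability.Essential_Supremum"
begin

text \<open>Functions on $(0,\infty)$ are functions of type \<open>real \<Rightarrow> ennreal\<close> of which only the values at
  positive arguments matter.  The arithmetic of \<^typ>\<open>ennreal\<close> agrees with the conventions
  $0/0 = 0$, $0\cdot\infty = 0$, $1/\infty = 0$.\<close>

text \<open>Powers with exponent \<open>0 < a < \<infinity>\<close>; other exponents do not occur below.\<close>

definition epow :: "ennreal \<Rightarrow> ennreal \<Rightarrow> ennreal" where
  "epow x a = (if x = \<infinity> then \<infinity> else ennreal (enn2real x powr enn2real a))"

definition Lnorm :: "ennreal \<Rightarrow> real set \<Rightarrow> (real \<Rightarrow> ennreal) \<Rightarrow> ennreal" where
  "Lnorm p A f =
     (if p = \<infinity> then esssup (lebesgue_on A) f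
      else epow (\<integral>\<^sup>+ x. epow (f x) p \<partial>lebesgue_on A) (inverse p))"

definition wLnorm :: "ennreal \<Rightarrow> (real \<Rightarrow> ennreal) \<Rightarrow> real set \<Rightarrow> (real \<Rightarrow> ennreal) \<Rightarrow> ennreal" where
  "wLnorm p w A f = Lnorm p A (\<lambda>x. f x * w x)"

definition Mplus :: "(real \<Rightarrow> ennreal) set" where
  "Mplus = borel_measurable (lebesgue_on {0<..})"

definition weights :: "(real \<Rightarrow> ennreal) set" where
  "weights = {w \<in> Mplus. AE x in lebesgue_on {0<..}. 0 < w x \<and> w x < \<infinity>}"

definition Omega :: "ennreal \<Rightarrow> (real \<Rightarrow> ennreal) set" where
  "Omega q = {u \<in> Mplus. \<forall>t>0. 0 < Lnorm q {t<..} u \<and> Lnorm q {t<..} u < \<infinity>}"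

definition cOmega :: "ennreal \<Rightarrow> (real \<Rightarrow> ennreal) set" where
  "cOmega q = {u \<in> Mplus. \<forall>t>0. 0 < Lnorm q {0<..<t} u \<and> Lnorm q {0<..<t} u < \<infinity>}"

definition Ces_norm ::
  "ennreal \<Rightarrow> ennreal \<Rightarrow> (real \<Rightarrow> ennreal) \<Rightarrow> (real \<Rightarrow> ennreal) \<Rightarrow> (real \<Rightarrow> ennreal) \<Rightarrow> ennreal" where
  "Ces_norm p q u v f = wLnorm q u {0<..} (\<lambda>t. wLnorm p v {0<..<t} f)"

definition Cop_norm ::
  "ennreal \<Rightarrow> ennreal \<Rightarrow> (real \<Rightarrow> ennreal) \<Rightarrow> (real \<Rightarrow> ennreal) \<Rightarrow> (real \<Rightarrow> ennreal) \<Rightarrow> ennreal" where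
  "Cop_norm p q u v f = wLnorm q u {0<..} (\<lambda>t. wLnorm p v {t<..} f)"

text \<open>A function space is given by its (extended-valued) norm \<open>N\<close> as the set of all
  non-negative measurable functions with finite norm.\<close>

definition space_of :: "((real \<Rightarrow> ennreal) \<Rightarrow> ennreal) \<Rightarrow> (real \<Rightarrow> ennreal) set" where
  "space_of N = {f \<in> Mplus. N f < \<infinity>}"

abbreviation Ces ::
  "ennreal \<Rightarrow> ennreal \<Rightarrow> (real \<Rightarrow> ennreal) \<Rightarrow> (real \<Rightarrow> ennreal) \<Rightarrow> (real \<Rightarrow> ennreal) set" where
  "Ces p q u v \<equiv> space_of (Ces_norm p q u v)"

abbreviation Cop ::
  "ennreal \<Rightarrow> ennreal \<Rightarrow> (real \<Rightarrow> ennreal) \<Rightarrow> (real \<Rightarrow> ennreal) \<Rightarrow> (real \<Rightarrow> ennreal) set" where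
  "Cop p q u v \<equiv> space_of (Cop_norm p q u v)"

definition embedding_const ::
  "((real \<Rightarrow> ennreal) \<Rightarrow> ennreal) \<Rightarrow> ((real \<Rightarrow> ennreal) \<Rightarrow> ennreal) \<Rightarrow> ennreal" where
  "embedding_const NX NY = Inf {c. \<forall>f\<in>space_of NX. NY f \<le> c * NX f}"

definition arrow_exp :: "ennreal \<Rightarrow> ennreal \<Rightarrow> ennreal" (infix "\<leadsto>" 60) where
  "p \<leadsto> q = (if q < p then inverse (inverse q - inverse p) else \<infinity>)"

definition approx_const :: "real \<Rightarrow> ennreal \<Rightarrow> ennreal \<Rightarrow> bool" where
  "approx_const c A B \<longleftrightarrow> ennreal (inverse c) * B \<le> A \<and> A \<le> ennreal c * B"

definition equiv_fun :: "(real \<Rightarrow> ennreal) \<Rightarrow> (real \<Rightarrow> ennreal) \<Rightarrow> bool" where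
  "equiv_fun f g \<longleftrightarrow> (\<exists>c>0. \<forall>t>0. approx_const c (f t) (g t))"

text \<open>The value at \<open>0\<close> is replaced by the limit from the right.\<close>

definition ext_zero :: "(real \<Rightarrow> ennreal) \<Rightarrow> real \<Rightarrow> ennreal" where
  "ext_zero U x = (if x = 0 then Lim (at_right 0) U else U x)"

text \<open>Finiteness of \<open>U\<close> on $[0,\infty)$ is a consequence of strict monotonicity.\<close>

definition admissible :: "(real \<Rightarrow> ennreal) \<Rightarrow> bool" where
  "admissible U \<longleftrightarrow> continuous_on {0..} U \<and> strict_mono_on {0..} U \<and> U 0 = 0 \<and>
     (U \<longlongrightarrow> \<infinity>) at_top"

definition quasiconcave :: "(real \<Rightarrow> ennreal) \<Rightarrow> (real \<Rightarrow> ennreal) \<Rightarrow> bool" where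
  "quasiconcave U \<phi> \<longleftrightarrow>
     (\<exists>g. mono_on {0<..} g \<and> equiv_fun \<phi> g) \<and>
     (\<exists>g. antimono_on {0<..} g \<and> equiv_fun (\<lambda>t. \<phi> t / U t) g)"

definition nondegenerate :: "(real \<Rightarrow> ennreal) \<Rightarrow> (real \<Rightarrow> ennreal) \<Rightarrow> bool" where
  "nondegenerate U \<phi> \<longleftrightarrow>
     (\<phi> \<longlongrightarrow> 0) (at_right 0) \<and> ((\<lambda>t. 1 / \<phi> t) \<longlongrightarrow> 0) at_top \<and>
     ((\<lambda>t. \<phi> t / U t) \<longlongrightarrow> 0) at_top \<and> ((\<lambda>t. U t / \<phi> t) \<longlongrightarrow> 0) (at_right 0)"

definition Q :: "(real \<Rightarrow> ennreal) \<Rightarrow> (real \<Rightarrow> ennreal) set" where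
  "Q U = {\<phi>. quasiconcave U \<phi> \<and> nondegenerate U \<phi>}"

text \<open>The Lebesgue--Stieltjes measure on $(0,\infty)$ of a non-decreasing \<open>h\<close>, characterised by
  $\mu((a,b]) = h(b+) - h(a+)$.  The library's \<^const>\<open>interval_measure\<close> needs a function on the whole
  line; here \<open>h\<close> may be unbounded below at \<open>0\<close>.\<close>

definition stieltjes_measure :: "(real \<Rightarrow> real) \<Rightarrow> real measure" where
  "stieltjes_measure h =
     extend_measure {0<..} {(a, b). 0 < a \<and> a \<le> b} (\<lambda>(a, b). {a<..b})
       (\<lambda>(a, b). ennreal (Lim (at_right b) h - Lim (at_right a) h))"

lemma emeasure_stieltjes_measure_Ioc:
  assumes "mono_on {0<..} h" "\<And>t. 0 < t \<Longrightarrow> continuous (at_right t) h" "0 < a" "a \<le> b"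
  shows "emeasure (stieltjes_measure h) {a<..b} = ennreal (h b - h a)"
proof -
  define N where "N = distr (interval_measure (\<lambda>s. h (exp s))) borel exp"
  have lim: "Lim (at_right t) h = h t" if "0 < t" for t
    using assms(2)[OF that] by (intro tendsto_Lim) (auto simp: continuous_within)
  have mono: "h (exp x) \<le> h (exp y)" if "x \<le> y" for x y
    by (rule mono_onD[OF assms(1)]) (use that in auto)
  have rc: "continuous (at_right s) (\<lambda>s. h (exp s))" for s
  proof -
    have "filterlim exp (at_right (exp s)) (at_right s)"
      unfolding filterlim_at
      by (auto simp: eventually_at_filter intro!: tendsto_exp)
    moreover have "(h \<longlongrightarrow> h (exp s)) (at_right (exp s))"
      using assms(2)[of "exp s"] by (simp add: continuous_within)
    ultimately show ?thesis
      unfolding continuous_within by (rule filterlim_compose[rotated])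
  qed
  have N: "emeasure N {i<..j} = ennreal (Lim (at_right j) h - Lim (at_right i) h)"
    if "0 < i \<and> i \<le> j" for i j
  proof -
    have "exp -` {i<..j} = {ln i<..ln j}"
    proof (intro set_eqI)
      fix x
      have "i < exp x \<longleftrightarrow> ln i < x" "exp x \<le> j \<longleftrightarrow> x \<le> ln j"
        using that ln_less_cancel_iff[of i "exp x"] ln_le_cancel_iff[of "exp x" j] by auto
      then show "x \<in> exp -` {i<..j} \<longleftrightarrow> x \<in> {ln i<..ln j}"
        by simp
    qed
    then show ?thesis
      using that emeasure_interval_measure_Ioc[OF _ mono rc, of "ln i" "ln j"]
      by (simp add: N_def emeasure_distr lim)
  qed
  have sets: "sets (stieltjes_measure h) \<subseteq> sets N"
  proof -
    have "A \<in> sets borel"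
      if "A \<in> sigma_sets {0<..} ((\<lambda>(a, b). {a<..b}) ` {(a, b). 0 < a \<and> a \<le> b})" for A :: "real set"
      using that by induction auto
    then show ?thesis
      by (subst stieltjes_measure_def, subst sets_extend_measure) (auto simp: N_def)
  qed
  have "emeasure (stieltjes_measure h) {a<..b} = ennreal (Lim (at_right b) h - Lim (at_right a) h)"
  proof (rule emeasure_extend_measure_Pair[OF stieltjes_measure_def N])
    show "positive (sets (stieltjes_measure h)) (emeasure N)"
      by (simp add: positive_def)
    show "countably_additive (sets (stieltjes_measure h)) (emeasure N)"
      using sets by (auto simp: countably_additive_def intro!: suminf_emeasure)
  qed (use assms in auto)
  then show ?thesis
    using assms by (simp add: lim)
qed

end

theory Submission
  imports Defs
begin

text \<open>Dividing by the weights and raising everything to the power \<open>p2\<close>, the embedding becomes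
  \<open>(\<integral> F^q d\<beta>)^(1/q) \<le> C (\<integral> P^(s/p) d\<alpha>)^(1/s)\<close> with \<open>F x = \<integral>\<^bsub>(0,x)\<^esub> g d\<omega>\<close>, \<open>P x = \<integral>\<^bsub>(x,\<infinity>)\<^esub> g^p d\<omega>\<close>,
  where \<open>p = p1/p2 > 1\<close>, \<open>q = q2/p2 > 1\<close>, \<open>s = q1/p2 \<le> 1\<close> and \<open>\<omega>\<close>, \<open>\<alpha>\<close>, \<open>\<beta>\<close> have the densities
  \<open>v^(p1 \<rightarrow> p2)\<close>, \<open>u1^q1\<close>, \<open>u2^q2\<close>.  As \<open>s \<le> 1\<close>, cutting \<open>g\<close> along the dyadic level sets of \<open>P\<close> reduces
  this to the Hardy inequality for \<open>g\<close> supported in \<open>(0,t)\<close>, with the constant \<open>C \<alpha>(0,t)^(1/s)\<close>.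
  Cutting once more, along the dyadic levels of the tail \<open>\<beta>(x,\<infinity>)\<close>, turns the Hardy inequality into
  the boundedness of a multiplication operator from \<open>l^p\<close> to \<open>l^q\<close>, whose norm is the supremum of the
  multiplier if \<open>p \<le> q\<close> and its \<open>l^r\<close> norm with \<open>1/r = 1/q - 1/p\<close> if \<open>q < p\<close>.  Undoing the
  discretization gives a profile \<open>\<Phi> t\<close>, a norm of \<open>y \<mapsto> V (min y t)\<close>, and the best constant is equivalent to
  the supremum of \<open>\<Phi> t / \<parallel>u1\<parallel>\<^bsub>q1,(0,t)\<^esub>\<close>.  Finally \<open>V(t) V(x) / (V(t) + V(x))\<close> is equivalent to \<open>V (min t x)\<close>, and
  \<open>\<Phi>\<close> increases while \<open>\<Phi>/V\<close> decreases, which identifies this supremum with the one of the theorem.\<close>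

section \<open>Powers, Hoelder and Minkowski inequalities\<close>

text \<open>Cutting at \<open>t\<close> loses nothing in order of magnitude: if \<open>g\<close> is
  supported in (0,t), then P is at most the integral of g^p on (0,t) and vanishes beyond, so the
  right-hand side is at most the L^p norm of \<open>g\<close> times \<alpha>(0,t)^(1/s). Conversely
  the bands of P are summable in the exponent 1/s >= 1. The partition is taken from the tail of
  \<beta>, not from V, because one partition then serves two measures: \<beta> itself and, for q <
  p, the Stieltjes measure of a power of its tail. Both give the levels geometrically decreasing
  mass. The obstacle is the left end. The tail may stay bounded near 0, so low levels can be empty
  and their masses have only upper bounds; exact masses are available above a level that is
  attained. Lower estimates therefore pair level k with the \<omega>-mass of the levels up to k - 1:
  if that mass is zero there is nothing to prove, and otherwise a point of lower level exists. Every
  constant is a geometric series, a band width or the price of this shift by one, hence depends on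
  the exponents alone.\<close>

definition powe :: "ennreal \<Rightarrow> real \<Rightarrow> ennreal" (infixr "powe" 80) where
  "x powe a = epow x (ennreal a)"

lemma powe_top [simp]: "top powe a = top"
  by (simp add: powe_def epow_def)

lemma powe_ennreal: "0 \<le> r \<Longrightarrow> 0 \<le> a \<Longrightarrow> ennreal r powe a = ennreal (r powr a)"
  by (simp add: powe_def epow_def)

lemma powe_0 [simp]: "0 powe a = 0"
  by (simp add: powe_def epow_def)

lemma powe_one_base [simp]: "1 powe a = 1"
  by (simp add: powe_def epow_def)

lemma powe_1 [simp]: "x powe 1 = x"
  by (cases x) (auto simp: powe_ennreal)

lemma powe_eq_0_iff [simp]: "0 < a \<Longrightarrow> x powe a = 0 \<longleftrightarrow> x = 0"
  by (cases x) (auto simp: powe_ennreal)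

lemma powe_eq_top_iff [simp]: "0 < a \<Longrightarrow> x powe a = top \<longleftrightarrow> x = top"
  by (cases x) (auto simp: powe_ennreal)

lemma powe_less_top_iff [simp]: "0 < a \<Longrightarrow> x powe a < top \<longleftrightarrow> x < top"
  by (simp add: less_top[symmetric])

lemma powe_pos_iff [simp]: "0 < a \<Longrightarrow> 0 < x powe a \<longleftrightarrow> 0 < x"
  by (simp add: zero_less_iff_neq_zero)

text \<open>The convention 0 * top = 0 is compatible with powers: when one factor is 0 and the other
  infinite, both sides vanish.\<close>

lemma powe_mult: "0 < a \<Longrightarrow> (x * y) powe a = x powe a * y powe a"
proof (cases x; cases y)
  fix r s assume "0 < a" "x = ennreal r" "0 \<le> r" "y = ennreal s" "0 \<le> s"
  then show ?thesis
    by (simp add: powe_ennreal ennreal_mult[symmetric] powr_mult)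
qed (auto simp: ennreal_mult_top ennreal_top_mult ennreal_mult_eq_top_iff powe_ennreal ennreal_eq_0_iff)

lemma powe_powe: "0 < a \<Longrightarrow> 0 < b \<Longrightarrow> (x powe a) powe b = x powe (a * b)"
  by (cases x) (auto simp: powe_ennreal powr_powr)

lemma powe_cancel: "0 < a \<Longrightarrow> (x powe a) powe (1 / a) = x" "0 < a \<Longrightarrow> (x powe (1 / a)) powe a = x"
  by (simp_all add: powe_powe)

lemma powe_add: "0 < a \<Longrightarrow> 0 < b \<Longrightarrow> x powe (a + b) = x powe a * x powe b"
  by (cases x) (auto simp: powe_ennreal powr_add ennreal_mult)

lemma powe_mono: "0 < a \<Longrightarrow> x \<le> y \<Longrightarrow> x powe a \<le> y powe a"
  by (cases x; cases y) (auto simp: powe_ennreal powr_mono2 top_unique intro!: ennreal_leI)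

lemma powe_le_iff: "0 < a \<Longrightarrow> x powe a \<le> y powe a \<longleftrightarrow> x \<le> y"
  using powe_mono[of a x y] powe_mono[of "1/a" "x powe a" "y powe a"] by (auto simp: powe_cancel)

lemma powe_le_powe_iff: "0 < a \<Longrightarrow> x powe a \<le> y \<longleftrightarrow> x \<le> y powe (1 / a)"
  by (metis powe_le_iff powe_cancel(2))

lemma le_powe_iff: "0 < a \<Longrightarrow> x \<le> y powe a \<longleftrightarrow> x powe (1 / a) \<le> y"
  by (metis powe_le_iff powe_cancel(2))

lemma inverse_powe: "0 < a \<Longrightarrow> inverse (x powe a) = inverse x powe a"
proof (cases x)
  case (real r)
  assume "0 < a"
  then show ?thesis
    using real by (cases "r = 0") (auto simp: powe_ennreal inverse_ennreal powr_minus inverse_powr powr_ge_zero)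
qed simp

lemma measurable_powe [measurable (raw)]:
  assumes [measurable]: "f \<in> borel_measurable M"
  shows "(\<lambda>x. f x powe a) \<in> borel_measurable M"
  unfolding powe_def epow_def by measurable

definition lnorm :: "'a measure \<Rightarrow> real \<Rightarrow> ('a \<Rightarrow> ennreal) \<Rightarrow> ennreal" where
  "lnorm M p f = (\<integral>\<^sup>+x. f x powe p \<partial>M) powe (1 / p)"

lemma lnorm_powe: "0 < p \<Longrightarrow> lnorm M p f powe p = (\<integral>\<^sup>+x. f x powe p \<partial>M)"
  by (simp add: lnorm_def powe_cancel)

lemma lnorm_mono: "0 < p \<Longrightarrow> (\<And>x. x \<in> space M \<Longrightarrow> f x \<le> g x) \<Longrightarrow> lnorm M p f \<le> lnorm M p g"
  unfolding lnorm_def by (intro powe_mono nn_integral_mono) auto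

lemma lnorm_cmult:
  "0 < p \<Longrightarrow> f \<in> borel_measurable M \<Longrightarrow> lnorm M p (\<lambda>x. c * f x) = c * lnorm M p f"
  by (simp add: lnorm_def powe_mult nn_integral_cmult powe_cancel)

lemma young_ennreal:
  fixes x y :: ennreal
  assumes "p > 1" "q > 1" "1/p + 1/q = 1"
  shows "x * y \<le> ennreal (1/p) * x powe p + ennreal (1/q) * y powe q"
proof (cases x; cases y)
  fix r s assume *: "x = ennreal r" "0 \<le> r" "y = ennreal s" "0 \<le> s"
  have "r * s \<le> 1/p * (r powr p) + 1/q * (s powr q)"
    using Youngs_inequality[OF assms *(2,4)] by simp
  then show ?thesis
    using * assms by (simp add: powe_ennreal ennreal_mult[symmetric] ennreal_plus[symmetric] del: ennreal_plus)
qed (use assms in \<open>auto simp: ennreal_mult_top ennreal_top_mult ennreal_mult_eq_top_iff\<close>)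

text \<open>Young's inequality is integrated after both factors are normalized to norm one.
  Normalization divides by the norms, so norms equal to 0 or infinity are treated
  separately.\<close>

lemma holder_ennreal:
  assumes pq: "p > 1" "q > 1" "1/p + 1/q = 1"
    and [measurable]: "f \<in> borel_measurable M" "g \<in> borel_measurable M"
  shows "(\<integral>\<^sup>+x. f x * g x \<partial>M) \<le> lnorm M p f * lnorm M q g"
proof -
  define a where "a = lnorm M p f"
  define b where "b = lnorm M q g"
  have a: "(\<integral>\<^sup>+x. f x powe p \<partial>M) = a powe p" and b: "(\<integral>\<^sup>+x. g x powe q \<partial>M) = b powe q"
    using pq by (auto simp: a_def b_def lnorm_powe)
  consider "a = 0 \<or> b = 0" | "a \<noteq> 0" "b \<noteq> 0" "a = top \<or> b = top" | "a \<noteq> 0" "b \<noteq> 0" "a \<noteq> top" "b \<noteq> top"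
    by blast
  then have "(\<integral>\<^sup>+x. f x * g x \<partial>M) \<le> a * b"
  proof cases
    case 1
    then have "AE x in M. f x * g x = 0"
    proof
      assume "a = 0"
      then have "AE x in M. f x powe p = 0" using a by (subst nn_integral_0_iff_AE[symmetric]) auto
      then show ?thesis using pq by auto
    next
      assume "b = 0"
      then have "AE x in M. g x powe q = 0" using b by (subst nn_integral_0_iff_AE[symmetric]) auto
      then show ?thesis using pq by auto
    qed
    then have "(\<integral>\<^sup>+x. f x * g x \<partial>M) = 0"
      by (subst nn_integral_0_iff_AE) auto
    then show ?thesis by simp
  next
    case 2
    then show ?thesis by (auto simp: ennreal_mult_top ennreal_top_mult)
  next
    case 3
    have ca: "inverse a * a = 1" "inverse b * b = 1"
      using 3 by (auto simp: ennreal_inverse_mult less_top divide_ennreal_def[symmetric] mult.commute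
          intro!: ennreal_divide_self)
    have inva: "(\<integral>\<^sup>+x. (inverse a * f x) powe p \<partial>M) = 1" "(\<integral>\<^sup>+x. (inverse b * g x) powe q \<partial>M) = 1"
      using pq powe_mult[of p "inverse a" a] powe_mult[of q "inverse b" b]
      by (simp_all add: powe_mult nn_integral_cmult a b ca)
    have "(\<integral>\<^sup>+x. (inverse a * f x) * (inverse b * g x) \<partial>M)
      \<le> (\<integral>\<^sup>+x. ennreal (1/p) * (inverse a * f x) powe p + ennreal (1/q) * (inverse b * g x) powe q \<partial>M)"
      by (intro nn_integral_mono young_ennreal pq)
    also have "\<dots> = ennreal (1/p) + ennreal (1/q)"
      using inva by (simp add: nn_integral_add nn_integral_cmult)
    also have "\<dots> = 1"
      using pq by (simp add: ennreal_plus[symmetric] del: ennreal_plus)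
    finally have "(a * b) * (\<integral>\<^sup>+x. (inverse a * f x) * (inverse b * g x) \<partial>M) \<le> (a * b) * 1"
      by (rule mult_left_mono) simp
    also have "(a * b) * (\<integral>\<^sup>+x. (inverse a * f x) * (inverse b * g x) \<partial>M)
        = (\<integral>\<^sup>+x. (inverse a * a) * (inverse b * b) * (f x * g x) \<partial>M)"
      by (subst nn_integral_cmult[symmetric]) (auto simp: mult_ac)
    finally show ?thesis by (simp add: ca)
  qed
  then show ?thesis by (simp add: a_def b_def)
qed

section \<open>Norms of sequences and countable sums\<close>

abbreviation sqnorm :: "real \<Rightarrow> ('a \<Rightarrow> ennreal) \<Rightarrow> ennreal" where
  "sqnorm \<equiv> lnorm (count_space UNIV)"

lemma sqnorm_ge_point: "0 < p \<Longrightarrow> x i \<le> sqnorm p x"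
  unfolding lnorm_def by (subst le_powe_iff) (auto intro!: nn_integral_ge_point)

text \<open>The usual argument divides by the norm of the sum and so needs its finiteness
  beforehand. Here only the norms \<open>N j\<close> of the summands are divided by: Hoelder in
  \<open>j\<close> is applied to x_jk = N_j^(1/q') * y_jk.\<close>

lemma minkowski_sum:
  fixes x :: "'j::countable \<Rightarrow> 'k::countable \<Rightarrow> ennreal"
  assumes q: "q > 1"
  shows "sqnorm q (\<lambda>k. \<integral>\<^sup>+j. x j k \<partial>count_space UNIV) \<le> (\<integral>\<^sup>+j. sqnorm q (x j) \<partial>count_space UNIV)"
proof -
  define N where "N j = sqnorm q (x j)" for j
  define S where "S = (\<integral>\<^sup>+j. N j \<partial>count_space UNIV)"
  define q' where "q' = q / (q - 1)"
  have q': "q' > 1" "1/q' + 1/q = 1" "q / q' = q - 1"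
    using q by (auto simp: q'_def field_simps)
  have "sqnorm q (\<lambda>k. \<integral>\<^sup>+j. x j k \<partial>count_space UNIV) \<le> S"
  proof (cases "S = top")
    case False
    have NS: "N j \<le> S" for j unfolding S_def by (intro nn_integral_ge_point) simp
    have Nf: "N j \<noteq> top" for j using NS[of j] False by (auto simp: top_unique)
    \<comment> \<open>With this weight Hoelder produces S^(q/q') = S^(q-1), and summing y_jk^q over
      k gives N_j^(1-q) * N_j^q = N_j, whose sum is again S.\<close>
    define y where "y j k = x j k * inverse (N j powe (1/q'))" for j k
    have xy: "x j k = N j powe (1/q') * y j k" for j k
    proof (cases "N j = 0")
      case True
      then have "x j k = 0"
        using sqnorm_ge_point[of q "x j" k] q by (auto simp: N_def)
      then show ?thesis by (simp add: y_def)
    next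
      case nz: False
      then have "N j powe (1/q') * inverse (N j powe (1/q')) = 1"
        using Nf[of j] q'
        by (simp add: divide_ennreal_def[symmetric] ennreal_divide_self less_top[symmetric])
      then show ?thesis by (simp add: y_def mult_ac)
    qed
    have 1: "(\<integral>\<^sup>+j. x j k \<partial>count_space UNIV) powe q
        \<le> S powe (q - 1) * (\<integral>\<^sup>+j. y j k powe q \<partial>count_space UNIV)" for k
    proof -
      have "(\<integral>\<^sup>+j. x j k \<partial>count_space UNIV) \<le> sqnorm q' (\<lambda>j. N j powe (1/q')) * sqnorm q (\<lambda>j. y j k)"
        unfolding xy by (rule holder_ennreal) (use q q' in auto)
      also have "sqnorm q' (\<lambda>j. N j powe (1/q')) = S powe (1/q')"
        using q' by (simp add: lnorm_def powe_cancel S_def)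
      finally have "(\<integral>\<^sup>+j. x j k \<partial>count_space UNIV) powe q \<le> (S powe (1/q') * sqnorm q (\<lambda>j. y j k)) powe q"
        using q by (intro powe_mono) auto
      also have "\<dots> = S powe (q - 1) * (\<integral>\<^sup>+j. y j k powe q \<partial>count_space UNIV)"
        using q q' by (simp add: powe_mult lnorm_powe powe_powe)
      finally show ?thesis .
    qed
    have 2: "(\<integral>\<^sup>+k. y j k powe q \<partial>count_space UNIV) \<le> N j" for j
    proof (cases "N j = 0")
      case True
      then have "x j k = 0" for k
        using sqnorm_ge_point[of q "x j" k] q by (auto simp: N_def)
      then show ?thesis by (simp add: y_def)
    next
      case nz: False
      have y: "y j k powe q = inverse (N j powe (q - 1)) * x j k powe q" for k
        using q q' by (simp add: y_def powe_mult inverse_powe powe_powe) (simp add: mult.commute)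
      have "(\<integral>\<^sup>+k. y j k powe q \<partial>count_space UNIV)
          = inverse (N j powe (q - 1)) * (\<integral>\<^sup>+k. x j k powe q \<partial>count_space UNIV)"
        unfolding y by (rule nn_integral_cmult) simp
      also have "(\<integral>\<^sup>+k. x j k powe q \<partial>count_space UNIV) = N j powe q"
        using q by (simp add: N_def lnorm_powe)
      also have "N j powe q = N j powe (q - 1) * N j"
        using powe_add[of "q - 1" 1 "N j"] q by simp
      also have "inverse (N j powe (q - 1)) * (N j powe (q - 1) * N j) = N j"
      proof -
        have "N j powe (q - 1) * inverse (N j powe (q - 1)) = 1"
          using Nf[of j] nz q
          by (simp add: divide_ennreal_def[symmetric] ennreal_divide_self less_top[symmetric])
        then show ?thesis by (metis mult.assoc mult.commute mult.right_neutral)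
      qed
      finally show ?thesis by simp
    qed
    have "(\<integral>\<^sup>+k. (\<integral>\<^sup>+j. x j k \<partial>count_space UNIV) powe q \<partial>count_space UNIV)
       \<le> (\<integral>\<^sup>+k. S powe (q - 1) * (\<integral>\<^sup>+j. y j k powe q \<partial>count_space UNIV) \<partial>count_space UNIV)"
      by (intro nn_integral_mono 1)
    also have "\<dots> = S powe (q - 1) * (\<integral>\<^sup>+j. \<integral>\<^sup>+k. y j k powe q \<partial>count_space UNIV \<partial>count_space UNIV)"
      by (simp add: nn_integral_cmult) (subst nn_integral_count_space_nn_integral, auto)
    also have "\<dots> \<le> S powe (q - 1) * S"
      unfolding S_def[symmetric] by (intro mult_left_mono order_trans[OF nn_integral_mono[OF 2]]) (auto simp: S_def)
    also have "\<dots> = S powe q" using powe_add[of "q - 1" 1 S] q by simp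
    finally show ?thesis
      unfolding lnorm_def using q by (subst powe_le_powe_iff) auto
  qed simp
  then show ?thesis by (simp add: S_def N_def)
qed

text \<open>Every term is at most the sum S, so x_k^e <= S^(e-1) * x_k.\<close>

lemma sum_powe_le:
  assumes "e \<ge> 1"
  shows "(\<integral>\<^sup>+k. x k powe e \<partial>count_space UNIV) \<le> (\<integral>\<^sup>+k. x k \<partial>count_space UNIV) powe e"
proof (cases "e = 1")
  case False
  then have e: "e > 1" using assms by simp
  let ?S = "\<integral>\<^sup>+k. x k \<partial>count_space UNIV"
  have sp: "z powe e = z powe (e - 1) * z" for z
    using powe_add[of "e - 1" 1 z] e by simp
  have "(\<integral>\<^sup>+k. x k powe e \<partial>count_space UNIV) \<le> (\<integral>\<^sup>+k. ?S powe (e - 1) * x k \<partial>count_space UNIV)"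
    using e by (intro nn_integral_mono, subst sp) (intro mult_right_mono powe_mono nn_integral_ge_point, auto)
  also have "\<dots> = ?S powe (e - 1) * ?S" by (rule nn_integral_cmult) simp
  also have "\<dots> = ?S powe e" by (rule sp[symmetric])
  finally show ?thesis .
qed simp

section \<open>Dyadic sums\<close>

definition two_pow :: "real \<Rightarrow> ennreal" where
  "two_pow c = ennreal (2 powr c)"

lemma two_pow_pos [simp]: "0 < two_pow c" "two_pow c \<noteq> 0" "two_pow c < top" "two_pow c \<noteq> top"
  by (auto simp: two_pow_def ennreal_eq_0_iff not_le)

lemma two_pow_add: "two_pow (a + b) = two_pow a * two_pow b"
  by (simp add: two_pow_def powr_add ennreal_mult)

lemma two_pow_powe: "0 < b \<Longrightarrow> two_pow a powe b = two_pow (a * b)"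
  by (simp add: two_pow_def powe_ennreal powr_powr)

lemma two_pow_bracket:
  assumes "0 < y" "y < top"
  shows "\<exists>j::int. two_pow (real_of_int j) < y \<and> y \<le> two_pow (real_of_int (j + 1))"
proof -
  obtain r where r: "y = ennreal r" "0 < r"
    using assms by (cases y) auto
  \<comment> \<open>Rounding up and subtracting 1 makes the lower bound strict and the upper one
    weak, as in the bands of P used later.\<close>
  define j where "j = \<lceil>log 2 r\<rceil> - 1"
  have "real_of_int j < log 2 r" "log 2 r \<le> real_of_int (j + 1)"
    unfolding j_def by linarith+
  then have "2 powr real_of_int j < r" "r \<le> 2 powr real_of_int (j + 1)"
    using r by (simp_all add: less_log_iff log_le_iff del: of_int_add)
  then have "two_pow (real_of_int j) < y \<and> y \<le> two_pow (real_of_int (j + 1))"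
    using r by (simp add: two_pow_def ennreal_less_iff ennreal_leI)
  then show ?thesis by blast
qed

lemma sum_int_atMost:
  fixes y :: "int \<Rightarrow> ennreal"
  shows "(\<integral>\<^sup>+j. y j * indicator {..k} j \<partial>count_space UNIV) = (\<integral>\<^sup>+i. y (k - int i) \<partial>count_space UNIV)"
proof -
  have "bij_betw (\<lambda>i. k - int i) UNIV {..k}"
    by (rule bij_betwI[where g = "\<lambda>j. nat (k - j)"]) auto
  from nn_integral_bij_count_space[OF this, of y] show ?thesis
    by (simp add: nn_integral_count_space_indicator)
qed

text \<open>The geometric series with value 1 / (1 - 2^(-\<sigma>)), kept as a sum because it arises
  by summing over shifts of the level.\<close>

definition geo :: "real \<Rightarrow> ennreal" where
  "geo \<sigma> = (\<integral>\<^sup>+i. two_pow (- \<sigma> * real i) \<partial>count_space UNIV)"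

lemma geo_finite:
  assumes "\<sigma> > 0"
  shows "geo \<sigma> < top"
proof -
  have eq: "two_pow (- \<sigma> * real i) = ennreal ((2 powr - \<sigma>) ^ i)" for i
    by (simp add: two_pow_def powr_power mult.commute)
  have "2 powr - \<sigma> < 2 powr 0"
    using assms by (intro powr_less_mono) auto
  then have "summable (\<lambda>i. (2 powr - \<sigma>) ^ i)"
    by (intro summable_geometric) auto
  then show ?thesis
    unfolding geo_def eq nn_integral_count_space_nat
    by (subst suminf_ennreal2) auto
qed

lemma dyadic_level_sum:
  assumes "\<sigma> > 0"
  shows "(\<integral>\<^sup>+j. (if two_pow (real_of_int j) < x then two_pow (\<sigma> * real_of_int j) else 0) \<partial>count_space UNIV)
    \<le> geo \<sigma> * x powe \<sigma>"
    (is "?L \<le> _")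
proof (cases x)
  case (real r)
  show ?thesis
  proof (cases "r = 0")
    case False
    \<comment> \<open>The largest index with 2^n <= r. Terms beyond it vanish, and the others form a
      geometric series with leading term 2^(\<sigma> n) <= r^\<sigma>.\<close>
    define n where "n = \<lfloor>log 2 r\<rfloor>"
    have r: "0 < r" using real False by simp
    have n: "real_of_int n \<le> log 2 r" by (simp add: n_def)
    then have nr: "2 powr real_of_int n \<le> r" using r by (simp add: le_log_iff)
    have "?L \<le> (\<integral>\<^sup>+j. two_pow (\<sigma> * real_of_int j) * indicator {..n} j \<partial>count_space UNIV)"
    proof (intro nn_integral_mono)
      fix j :: int
      have "j \<le> n" if "two_pow (real_of_int j) < x"
      proof -
        have "2 powr real_of_int j < r" using that real by (simp add: two_pow_def ennreal_less_iff)
        then have "real_of_int j < log 2 r" using r by (simp add: less_log_iff)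
        then show ?thesis unfolding n_def by linarith
      qed
      then show "(if two_pow (real_of_int j) < x then two_pow (\<sigma> * real_of_int j) else 0)
          \<le> two_pow (\<sigma> * real_of_int j) * indicator {..n} j" by auto
    qed
    also have "\<dots> = (\<integral>\<^sup>+i. two_pow (\<sigma> * real_of_int n) * two_pow (- \<sigma> * real i) \<partial>count_space UNIV)"
      unfolding sum_int_atMost two_pow_add[symmetric] by (simp add: right_diff_distrib)
    also have "\<dots> = geo \<sigma> * two_pow (\<sigma> * real_of_int n)"
      unfolding geo_def by (subst nn_integral_cmult) (auto simp: mult.commute)
    also have "two_pow (\<sigma> * real_of_int n) = ennreal (2 powr real_of_int n) powe \<sigma>"
      using assms by (simp add: two_pow_def powe_ennreal powr_powr mult.commute)
    also have "geo \<sigma> * \<dots> \<le> geo \<sigma> * x powe \<sigma>"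
      unfolding real using assms nr by (intro mult_left_mono powe_mono ennreal_leI) auto
    finally show ?thesis .
  qed (use real in simp)
next
  case top
  \<comment> \<open>Since 0 * top = 0, the right-hand side is infinite only once
    \<open>geo \<sigma>\<close> is known to be nonzero.\<close>
  have "two_pow (- \<sigma> * real (0::nat)) \<le> geo \<sigma>"
    unfolding geo_def by (rule nn_integral_ge_point) simp
  then have "geo \<sigma> \<noteq> 0" using two_pow_pos(1) by (metis leD)
  then show ?thesis by (simp add: top ennreal_mult_top)
qed

section \<open>Measures on the half-line\<close>

lemma incseq_approx_below:
  fixes a :: real
  assumes "0 < a"
  shows "\<exists>X::nat \<Rightarrow> real. (\<forall>n. 0 < X n \<and> X n < a) \<and> incseq X \<and> X \<longlonglongrightarrow> a"
proof -
  define e where "e n = inverse (real (Suc (Suc n)))" for n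
  have e: "0 < e n" "e n < 1" "e n * a < 1 * a" for n
  proof -
    show "0 < e n" by (simp add: e_def)
    show e1: "e n < 1" unfolding e_def by (rule inverse_less_1_iff[THEN iffD2]) simp
    show "e n * a < 1 * a" by (rule mult_strict_right_mono[OF e1 assms])
  qed
  have "decseq e" unfolding e_def decseq_def by (auto intro!: le_imp_inverse_le)
  then have "incseq (\<lambda>n. a - e n * a)"
    using assms by (auto simp: decseq_def incseq_def intro!: mult_right_mono)
  moreover have "e \<longlonglongrightarrow> 0"
    unfolding e_def by (rule LIMSEQ_Suc[OF LIMSEQ_inverse_real_of_nat])
  then have "(\<lambda>n. a - e n * a) \<longlonglongrightarrow> a - 0 * a"
    by (intro tendsto_diff tendsto_mult tendsto_const)
  ultimately show ?thesis
    using e assms by (intro exI[of _ "\<lambda>n. a - e n * a"]) auto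
qed

lemma decseq_approx_above:
  fixes a :: real
  shows "\<exists>X::nat \<Rightarrow> real. (\<forall>n. a < X n) \<and> decseq X \<and> X \<longlonglongrightarrow> a"
proof -
  have "decseq (\<lambda>n. a + inverse (real (Suc n)))"
    unfolding decseq_def by (auto intro!: le_imp_inverse_le)
  then show ?thesis
    using LIMSEQ_inverse_real_of_nat_add[of a]
    by (intro exI[of _ "\<lambda>n. a + inverse (real (Suc n))"]) simp
qed

section \<open>Final segments and atomless measures on the half-line\<close>

definition upset :: "real set \<Rightarrow> bool" where
  "upset D \<longleftrightarrow> D \<subseteq> {0<..} \<and> (\<forall>x\<in>D. \<forall>y\<ge>x. y \<in> D)"

text \<open>A nonempty final segment is determined by its infimum and by whether the infimum belongs
  to it.\<close>

lemma upset_cases: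
  assumes "upset D"
  obtains "D = {}" | a where "0 \<le> a" "D = {a<..}" | a where "0 < a" "D = {a..}"
proof (cases "D = {}")
  case False
  define a where "a = Inf D"
  have D: "\<And>x. x \<in> D \<Longrightarrow> 0 < x" "\<And>x y. x \<in> D \<Longrightarrow> x \<le> y \<Longrightarrow> y \<in> D"
    using assms by (auto simp: upset_def)
  have bdd: "bdd_below D" using D(1) by (intro bdd_belowI[of _ 0]) (auto intro: less_imp_le)
  have a0: "0 \<le> a" unfolding a_def using False D(1) by (intro cInf_greatest) (auto intro: less_imp_le)
  have sub: "D \<subseteq> {a..}" unfolding a_def using bdd by (auto intro: cInf_lower)
  have sup: "{a<..} \<subseteq> D"
  proof
    fix y assume "y \<in> {a<..}"
    then obtain x where "x \<in> D" "x < y" unfolding a_def using cInf_less_iff[OF False bdd] by auto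
    then show "y \<in> D" using D(2)[of x y] by simp
  qed
  show thesis
  proof (cases "a \<in> D")
    case True
    then have "D = {a..}" using sub D(2) by auto
    then show thesis using D(1)[OF True] that(3) by blast
  next
    case False
    then have "D = {a<..}" using sub sup by (auto simp: less_le)
    then show thesis using a0 that(2) by blast
  qed
qed (use that in auto)

text \<open>The common ground of Lebesgue densities and of the Stieltjes measure, whose
  \<sigma>-algebras are introduced differently. Measurable rays suffice because all sets cut out
  below are final segments, their complements or differences; in particular monotone functions are
  measurable. Null points make the tail continuous.\<close>

locale half_line_measure =
  fixes m :: "real measure"
  assumes space_eq [simp]: "space m = {0<..}"
    and sets_Ioi [measurable]: "0 \<le> x \<Longrightarrow> {x<..} \<in> sets m"
    and null_singleton: "0 < x \<Longrightarrow> emeasure m {x} = 0"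
begin

lemma sets_Ici [measurable]:
  assumes "0 < x" shows "{x..} \<in> sets m"
proof -
  obtain X :: "nat \<Rightarrow> real" where X: "\<forall>n. 0 < X n \<and> X n < x" "incseq X" "X \<longlonglongrightarrow> x"
    using incseq_approx_below[OF assms] by blast
  have "{x..} = (\<Inter>n. {X n<..})"
  proof (intro set_eqI iffI)
    fix y assume "y \<in> (\<Inter>n. {X n<..})"
    then have "\<And>n. X n \<le> y" by (auto intro: less_imp_le)
    then show "y \<in> {x..}" using X(3) by (auto intro: LIMSEQ_le_const2)
  next
    fix y assume "y \<in> {x..}"
    then show "y \<in> (\<Inter>n. {X n<..})" using X(1) by (auto intro: less_le_trans)
  qed
  moreover have "{X n<..} \<in> sets m" for n
    using X(1) by (intro sets_Ioi) (auto intro: less_imp_le)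
  then have "(\<Inter>n. {X n<..}) \<in> sets m"
    by (intro sets.countable_INT) auto
  ultimately show ?thesis by metis
qed

lemma sets_singleton [measurable]: "0 < x \<Longrightarrow> {x} \<in> sets m"
proof -
  assume "0 < x"
  moreover have "{x} = {x..} - {x<..}" by auto
  ultimately show ?thesis by (metis sets_Ici sets_Ioi sets.Diff less_imp_le)
qed

lemma sets_Ioo [measurable]: "{0<..<x} \<in> sets m"
proof (cases "0 < x")
  case True
  then have "{0<..<x} = {0<..} - {x..}" by auto
  then show ?thesis using True by (metis sets_Ici sets_Ioi sets.Diff order_refl)
qed simp

lemma sets_upset: "upset D \<Longrightarrow> D \<in> sets m"
  by (cases rule: upset_cases) (auto intro: sets_Ioi sets_Ici)

lemma borel_measurable_mono:
  fixes f :: "real \<Rightarrow> ennreal"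
  assumes "\<And>x y. 0 < x \<Longrightarrow> x \<le> y \<Longrightarrow> f x \<le> f y"
  shows "f \<in> borel_measurable m"
proof (rule borel_measurableI_greater)
  fix c
  have "upset {x \<in> space m. c < f x}"
    unfolding upset_def using assms by (auto intro: less_le_trans)
  then show "{x \<in> space m. c < f x} \<in> sets m" by (rule sets_upset)
qed

lemma borel_measurable_antimono:
  fixes f :: "real \<Rightarrow> ennreal"
  assumes "\<And>x y. 0 < x \<Longrightarrow> x \<le> y \<Longrightarrow> f y \<le> f x"
  shows "f \<in> borel_measurable m"
proof (rule borel_measurableI_less)
  fix c
  have "upset {x \<in> space m. f x < c}"
    unfolding upset_def using assms by (auto intro: le_less_trans less_le_trans)
  then show "{x \<in> space m. f x < c} \<in> sets m" by (rule sets_upset)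
qed

lemma half_line_measure_density:
  assumes [measurable]: "f \<in> borel_measurable m"
  shows "half_line_measure (density m f)"
proof
  fix x :: real assume x: "0 < x"
  then have "{x} \<in> null_sets m" by (auto intro: sets_singleton null_singleton)
  moreover have "emeasure (density m f) {x} = (\<integral>\<^sup>+y. f y * indicator {x} y \<partial>m)"
    using x sets_singleton by (intro emeasure_density) auto
  ultimately show "emeasure (density m f) {x} = 0"
    by (simp add: nn_integral_null_set)
qed (auto intro: sets_Ioi)

lemma tendsto_emeasure_Ioi_above:
  assumes X: "0 \<le> a" "\<And>n. a < X n" "decseq X" "X \<longlonglongrightarrow> a"
  shows "(\<lambda>n. emeasure m {X n<..}) \<longlonglongrightarrow> emeasure m {a<..}"
proof -
  have "(\<lambda>n. emeasure m {X n<..}) \<longlonglongrightarrow> emeasure m (\<Union>n. {X n<..})"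
  proof (rule Lim_emeasure_incseq)
    have "0 \<le> X n" for n using X(1) X(2)[of n] by simp
    then show "range (\<lambda>n. {X n<..}) \<subseteq> sets m" using sets_Ioi by blast
    show "incseq (\<lambda>n. {X n<..})" using X(3) by (auto simp: incseq_def decseq_def intro: le_less_trans)
  qed
  also have "(\<Union>n. {X n<..}) = {a<..}"
  proof (intro set_eqI iffI)
    fix y assume "y \<in> {a<..}"
    then have "eventually (\<lambda>n. X n < y) sequentially" using X(4) by (auto intro: order_tendstoD)
    then show "y \<in> (\<Union>n. {X n<..})" by (auto simp: eventually_sequentially)
  next
    fix y assume "y \<in> (\<Union>n. {X n<..})"
    then obtain n where "X n < y" by auto
    then show "y \<in> {a<..}" using X(2)[of n] by simp
  qed
  finally show ?thesis .
qed

lemma emeasure_Ici: "0 < a \<Longrightarrow> emeasure m {a..} = emeasure m {a<..}"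
proof -
  assume a: "0 < a"
  have eq: "{a..} = {a<..} \<union> {a}" by auto
  have "{a<..} \<in> sets m" "{a} \<in> null_sets m"
    using a by (auto intro: sets_Ioi sets_singleton null_singleton)
  then show ?thesis unfolding eq by (rule emeasure_Un_null_set)
qed

lemma tendsto_emeasure_Ioi_below:
  assumes X: "\<And>n. 0 < X n" "\<And>n. X n < a" "incseq X" "X \<longlonglongrightarrow> a"
    and fin: "\<And>x. 0 < x \<Longrightarrow> emeasure m {x<..} < top"
  shows "(\<lambda>n. emeasure m {X n<..}) \<longlonglongrightarrow> emeasure m {a<..}"
proof -
  have "(\<lambda>n. emeasure m {X n<..}) \<longlonglongrightarrow> emeasure m (\<Inter>n. {X n<..})"
  proof (rule Lim_emeasure_decseq)
    have "0 \<le> X n" for n using X(1)[of n] by simp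
    then show "range (\<lambda>n. {X n<..}) \<subseteq> sets m" using sets_Ioi by blast
    show "decseq (\<lambda>n. {X n<..})" using X(3) by (auto simp: incseq_def decseq_def intro: le_less_trans)
    show "\<And>i. emeasure m {X i<..} \<noteq> \<infinity>" using fin X(1) by (metis infinity_ennreal_def less_irrefl)
  qed
  also have "(\<Inter>n. {X n<..}) = {a..}"
  proof (intro set_eqI iffI)
    fix y assume "y \<in> (\<Inter>n. {X n<..})"
    then have "\<And>n. X n \<le> y" by (auto intro: less_imp_le)
    then show "y \<in> {a..}" using X(4) by (auto intro: LIMSEQ_le_const2)
  next
    fix y assume "y \<in> {a..}"
    then have "X n < y" for n using X(2)[of n] by simp
    then show "y \<in> (\<Inter>n. {X n<..})" by blast
  qed
  also have "emeasure m {a..} = emeasure m {a<..}"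
    using X(1,2)[of 0] by (intro emeasure_Ici) simp
  finally show ?thesis .
qed

lemma tendsto_emeasure_Ioi_at_top:
  assumes a: "0 < a" and fin: "\<And>x. 0 < x \<Longrightarrow> emeasure m {x<..} < top"
  shows "(\<lambda>n. emeasure m {a + real n<..}) \<longlonglongrightarrow> 0"
proof -
  have pos: "0 < a + real n" for n using a by simp
  have "(\<lambda>n. emeasure m {a + real n<..}) \<longlonglongrightarrow> emeasure m (\<Inter>n. {a + real n<..})"
  proof (rule Lim_emeasure_decseq)
    show "range (\<lambda>n. {a + real n<..}) \<subseteq> sets m"
      using pos sets_Ioi less_imp_le by blast
    show "decseq (\<lambda>n. {a + real n<..})" by (auto simp: decseq_def)
    show "\<And>n. emeasure m {a + real n<..} \<noteq> \<infinity>" using fin[OF pos] by (metis infinity_ennreal_def less_irrefl)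
  qed
  also have "(\<Inter>n. {a + real n<..}) = {}"
  proof (intro set_eqI iffI)
    fix y assume y: "y \<in> (\<Inter>n. {a + real n<..})"
    obtain n where "y - a < real n" using reals_Archimedean2 by blast
    moreover have "a + real n < y" using y by blast
    ultimately show "y \<in> {}" by simp
  qed simp
  finally show ?thesis by simp
qed

lemma emeasure_Ioi_le:
  assumes "0 \<le> a" "\<And>x. a < x \<Longrightarrow> emeasure m {x<..} \<le> c"
  shows "emeasure m {a<..} \<le> c"
proof -
  obtain X :: "nat \<Rightarrow> real" where X: "\<forall>n. a < X n" "decseq X" "X \<longlonglongrightarrow> a"
    using decseq_approx_above by blast
  then have "(\<lambda>n. emeasure m {X n<..}) \<longlonglongrightarrow> emeasure m {a<..}"
    using assms(1) by (intro tendsto_emeasure_Ioi_above) auto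
  then show ?thesis by (rule LIMSEQ_le_const2) (use assms(2) X(1) in auto)
qed

text \<open>Tails at points of \<open>D\<close> exhaust \<open>D\<close> up to a null set, whether
  or not the infimum of \<open>D\<close> is attained.\<close>

lemma upset_le:
  assumes "upset D" "\<And>x. x \<in> D \<Longrightarrow> emeasure m {x<..} \<le> c"
  shows "emeasure m D \<le> c"
  using assms(1)
proof (cases rule: upset_cases)
  case (2 a)
  then show ?thesis using emeasure_Ioi_le[of a c] assms(2) by auto
next
  case (3 a)
  then show ?thesis using emeasure_Ici[of a] assms(2) by auto
qed simp

text \<open>Points outside \<open>D\<close> approach its left end from below, and the finite tails
  converge there. The point \<open>x0\<close> rules out that \<open>D\<close> is the whole
  half-line, where no such point exists. If \<open>D\<close> is empty, the tails tend to 0 and force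
  c = 0.\<close>

lemma upset_ge:
  assumes "upset D" "0 < x0" "x0 \<notin> D" "\<And>x. 0 < x \<Longrightarrow> x \<notin> D \<Longrightarrow> c \<le> emeasure m {x<..}"
    and fin: "\<And>x. 0 < x \<Longrightarrow> emeasure m {x<..} < top"
  shows "c \<le> emeasure m D"
  using assms(1)
proof (cases rule: upset_cases)
  case 1
  have "c \<le> 0"
    by (rule LIMSEQ_le_const[OF tendsto_emeasure_Ioi_at_top[OF assms(2) fin]])
      (use assms in \<open>auto simp: 1 add_pos_nonneg\<close>)
  then show ?thesis using 1 by simp
next
  case (2 a)
  then have "0 < a" using assms(2,3) by auto
  then show ?thesis using 2 assms(4)[of a] by auto
next
  case (3 a)
  obtain X :: "nat \<Rightarrow> real" where X: "\<forall>n. 0 < X n \<and> X n < a" "incseq X" "X \<longlonglongrightarrow> a"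
    using incseq_approx_below[OF 3(1)] by blast
  then have "(\<lambda>n. emeasure m {X n<..}) \<longlonglongrightarrow> emeasure m {a<..}"
    using fin by (intro tendsto_emeasure_Ioi_below) auto
  then have "(\<lambda>n. emeasure m {X n<..}) \<longlonglongrightarrow> emeasure m D"
    using emeasure_Ici[OF 3(1)] 3(2) by simp
  then show ?thesis
    by (rule LIMSEQ_le_const) (use assms(4) X(1) 3 in \<open>metis atLeast_iff not_le\<close>)
qed

text \<open>The complement is a final segment, so \<open>D\<close> is empty, (0,a), (0,a] or the
  whole half-line. Intervals (0,x) exhaust the open shapes, and the endpoint of (0,a] is
  null.\<close>

lemma downset_le:
  assumes D: "D \<subseteq> {0<..}" "\<And>x y. x \<in> D \<Longrightarrow> 0 < y \<Longrightarrow> y \<le> x \<Longrightarrow> y \<in> D"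
    and le: "\<And>x. x \<in> D \<Longrightarrow> emeasure m {0<..<x} \<le> c"
  shows "D \<in> sets m" "emeasure m D \<le> c"
proof -
  have "upset ({0<..} - D)"
    unfolding upset_def using D by force
  from sets_upset[OF this] have "space m - ({0<..} - D) \<in> sets m" by auto
  moreover have "space m - ({0<..} - D) = D" using D(1) by auto
  ultimately show sets: "D \<in> sets m" by simp
  show "emeasure m D \<le> c"
    using \<open>upset ({0<..} - D)\<close>
  proof (cases rule: upset_cases)
    case 1
    then have D': "D = {0<..}" using D(1) by auto
    have "(\<lambda>n. emeasure m {0<..<real n}) \<longlonglongrightarrow> emeasure m (\<Union>n. {0<..<real n})"
      by (rule Lim_emeasure_incseq) (auto simp: incseq_def)
    also have "(\<Union>n. {0<..<real n}) = D" using D' reals_Archimedean2 by auto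
    finally show ?thesis
    proof (rule LIMSEQ_le_const2)
      have "emeasure m {0<..<real n} \<le> c" if "n \<ge> 1" for n
        using that le[of "real n"] D' by auto
      then show "\<exists>N. \<forall>n\<ge>N. emeasure m {0<..<real n} \<le> c" by blast
    qed
  next
    case (2 a)
    show ?thesis
    proof (cases "a = 0")
      case True
      then have "D = {}" using 2 D(1) by auto
      then show ?thesis by simp
    next
      case False
      then have a: "0 < a" using 2 by simp
      have "a \<notin> {0<..} - D" using 2 by simp
      then have aD: "a \<in> D" using a by simp
      have "x \<le> a" if "x \<in> D" for x
        using that 2(2) by (metis DiffE greaterThan_iff not_le)
      then have "D = {0<..<a} \<union> {a}" using D aD by force
      moreover have "{a} \<in> null_sets m"
        using a by (auto intro: sets_singleton null_singleton)
      ultimately have "emeasure m D = emeasure m {0<..<a}"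
        using sets_Ioo by (metis emeasure_Un_null_set)
      then show ?thesis using le[OF aD] by simp
    qed
  next
    case (3 a)
    have "x \<in> D \<longleftrightarrow> 0 < x \<and> x < a" for x
    proof -
      have "x \<in> {0<..} - D \<longleftrightarrow> a \<le> x" unfolding 3(2) by simp
      then show ?thesis using D(1) 3(1) by force
    qed
    then have Da: "D = {0<..<a}" by (intro set_eqI) simp
    obtain X :: "nat \<Rightarrow> real" where X: "\<forall>n. 0 < X n \<and> X n < a" and Xi: "incseq X" and Xl: "X \<longlonglongrightarrow> a"
      using incseq_approx_below[OF 3(1)] by blast
    have "(\<lambda>n. emeasure m {0<..<X n}) \<longlonglongrightarrow> emeasure m (\<Union>n. {0<..<X n})"
    proof (rule Lim_emeasure_incseq)
      show "range (\<lambda>n. {0<..<X n}) \<subseteq> sets m" using sets_Ioo by blast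
      show "incseq (\<lambda>n. {0<..<X n})" using Xi by (force simp: incseq_def)
    qed
    also have "(\<Union>n. {0<..<X n}) = D"
    proof (intro set_eqI iffI)
      fix y assume y: "y \<in> D"
      then have "eventually (\<lambda>n. y < X n) sequentially" using Xl Da by (auto intro: order_tendstoD)
      then show "y \<in> (\<Union>n. {0<..<X n})" using y Da by (auto simp: eventually_sequentially)
    qed (use X Da in \<open>auto intro: less_trans\<close>)
    finally show ?thesis
      by (rule LIMSEQ_le_const2) (use le Da X in auto)
  qed
qed

end

section \<open>Discretization of the Hardy inequality\<close>

text \<open>\<open>level U x = k\<close> means \<open>2 powr (-k-1) < U x \<le> 2 powr -k\<close>; the level increases with \<open>x\<close>
  because \<open>U\<close> is a tail.\<close>

definition level :: "(real \<Rightarrow> real) \<Rightarrow> real \<Rightarrow> int" where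
  "level U x = \<lfloor>- log 2 (U x)\<rfloor>"

lemma le_level_iff: "0 < U x \<Longrightarrow> k \<le> level U x \<longleftrightarrow> U x \<le> 2 powr (- real_of_int k)"
proof -
  assume "0 < U x"
  then have "log 2 (U x) \<le> - real_of_int k \<longleftrightarrow> U x \<le> 2 powr (- real_of_int k)"
    by (subst log_le_iff) auto
  then show ?thesis by (simp add: level_def le_floor_iff) linarith
qed

text \<open>The exponent \<theta> is free so that different measures share the levels of one
  function \<open>U\<close>: \<beta> has \<theta> = 1, the Stieltjes measure of part (ii) has
  \<theta> = r/q.\<close>

locale dyadic_tail = half_line_measure m for m +
  fixes U :: "real \<Rightarrow> real" and \<theta> :: real
  assumes \<theta>: "0 < \<theta>"
    and U_pos: "0 < x \<Longrightarrow> 0 < U x"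
    and tail: "0 < x \<Longrightarrow> emeasure m {x<..} = ennreal (U x powr \<theta>)"
begin

lemma U_antimono: "0 < x \<Longrightarrow> x \<le> y \<Longrightarrow> U y \<le> U x"
proof -
  assume "0 < x" "x \<le> y"
  then have "emeasure m {y<..} \<le> emeasure m {x<..}"
    by (intro emeasure_mono sets_Ioi) auto
  with \<open>0 < x\<close> \<open>x \<le> y\<close> have "U y powr \<theta> \<le> U x powr \<theta>"
    by (simp add: tail)
  then show ?thesis
    using powr_less_mono2[OF \<theta>, of "U x" "U y"] U_pos[of x] \<open>0 < x\<close> by fastforce
qed

lemma level_mono: "0 < x \<Longrightarrow> x \<le> y \<Longrightarrow> level U x \<le> level U y"
  using U_antimono[of x y] U_pos[of x] U_pos[of y] by (auto simp: level_def intro!: floor_mono)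

lemma upset_level: "upset {x. 0 < x \<and> k \<le> level U x}"
  using level_mono by (force simp: upset_def)

lemma level_le_iff_tail: "0 < x \<Longrightarrow> k \<le> level U x \<longleftrightarrow> emeasure m {x<..} \<le> two_pow (- \<theta> * real_of_int k)"
proof -
  assume x: "0 < x"
  have "U x powr \<theta> \<le> (2 powr (- real_of_int k)) powr \<theta> \<longleftrightarrow> U x \<le> 2 powr (- real_of_int k)"
    using \<theta> U_pos[OF x] powr_less_mono2[OF \<theta>, of "2 powr (- real_of_int k)" "U x"]
      powr_mono2[of \<theta> "U x" "2 powr (- real_of_int k)"] by fastforce
  then show ?thesis
    using x by (simp add: le_level_iff U_pos tail two_pow_def powr_powr mult.commute)
qed

lemma emeasure_level_ge: "emeasure m {x. 0 < x \<and> k \<le> level U x} \<le> two_pow (- \<theta> * real_of_int k)"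
  by (rule upset_le[OF upset_level]) (use level_le_iff_tail in auto)

text \<open>The tail is at most 2^(-\<theta> k) inside the set, larger outside, and continuous, so
  it takes this value at the left end. Without a point of lower level the set would be the whole
  half-line, whose mass may be smaller.\<close>

lemma emeasure_level_ge_eq:
  assumes "0 < x0" "level U x0 < k"
  shows "emeasure m {x. 0 < x \<and> k \<le> level U x} = two_pow (- \<theta> * real_of_int k)"
proof (rule antisym[OF emeasure_level_ge])
  show "two_pow (- \<theta> * real_of_int k) \<le> emeasure m {x. 0 < x \<and> k \<le> level U x}"
  proof (rule upset_ge[OF upset_level assms(1)])
    fix x :: real assume "0 < x" "x \<notin> {x. 0 < x \<and> k \<le> level U x}"
    then show "two_pow (- \<theta> * real_of_int k) \<le> emeasure m {x<..}"
      using level_le_iff_tail[of x k] by auto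
  qed (use assms tail in auto)
qed

lemma level_eq_diff:
  "{x. 0 < x \<and> level U x = k} = {x. 0 < x \<and> k \<le> level U x} - {x. 0 < x \<and> k + 1 \<le> level U x}"
  by auto

lemma sets_level_eq: "{x. 0 < x \<and> level U x = k} \<in> sets m"
  unfolding level_eq_diff by (intro sets.Diff sets_upset upset_level)

lemma emeasure_level_eq_le: "emeasure m {x. 0 < x \<and> level U x = k} \<le> two_pow (- \<theta> * real_of_int k)"
  by (rule order_trans[OF emeasure_mono emeasure_level_ge]) (auto intro: sets_upset upset_level)

lemma emeasure_level_eq:
  assumes "0 < x0" "level U x0 < k"
  shows "emeasure m {x. 0 < x \<and> level U x = k} = ennreal (1 - 2 powr (- \<theta>)) * two_pow (- \<theta> * real_of_int k)"
proof -
  have "emeasure m {x. 0 < x \<and> level U x = k} = two_pow (- \<theta> * real_of_int k) - two_pow (- \<theta> * real_of_int (k + 1))"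
    unfolding level_eq_diff
    using assms emeasure_level_ge_eq[of x0 k] emeasure_level_ge_eq[of x0 "k + 1"]
    by (subst emeasure_Diff) (auto intro: sets_upset upset_level)
  also have "\<dots> = ennreal (2 powr (- \<theta> * real_of_int k) - 2 powr (- \<theta> * real_of_int (k + 1)))"
    by (simp add: two_pow_def ennreal_minus)
  also have "2 powr (- \<theta> * real_of_int (k + 1)) = 2 powr (- \<theta>) * 2 powr (- \<theta> * real_of_int k)"
    by (simp add: powr_add[symmetric] algebra_simps)
  also have "ennreal (2 powr (- \<theta> * real_of_int k) - 2 powr (- \<theta>) * 2 powr (- \<theta> * real_of_int k))
      = ennreal (1 - 2 powr (- \<theta>)) * two_pow (- \<theta> * real_of_int k)"
    using \<theta> powr_less_mono[of "-\<theta>" 0 2]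
    by (simp add: two_pow_def ennreal_mult[symmetric] left_diff_distrib)
  finally show ?thesis .
qed

lemma nn_integral_level:
  "(\<integral>\<^sup>+x. \<phi> (level U x) \<partial>m) = (\<integral>\<^sup>+k. \<phi> k * emeasure m {x. 0 < x \<and> level U x = k} \<partial>count_space UNIV)"
proof -
  have "(\<integral>\<^sup>+x. \<phi> (level U x) \<partial>m)
    = (\<integral>\<^sup>+x. (\<integral>\<^sup>+k. \<phi> k * indicator {x. 0 < x \<and> level U x = k} x \<partial>count_space UNIV) \<partial>m)"
  proof (rule nn_integral_cong)
    fix x assume "x \<in> space m"
    then have "(\<integral>\<^sup>+k. \<phi> k * indicator {x. 0 < x \<and> level U x = k} x \<partial>count_space UNIV)
        = (\<integral>\<^sup>+k. \<phi> k * indicator {level U x} k \<partial>count_space UNIV)"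
      by (intro nn_integral_cong) (auto split: split_indicator)
    then show "\<phi> (level U x) = (\<integral>\<^sup>+k. \<phi> k * indicator {x. 0 < x \<and> level U x = k} x \<partial>count_space UNIV)"
      by simp
  qed
  also have "\<dots> = (\<integral>\<^sup>+k. (\<integral>\<^sup>+x. \<phi> k * indicator {x. 0 < x \<and> level U x = k} x \<partial>m) \<partial>count_space UNIV)"
    using sets_level_eq by (intro nn_integral_count_space_nn_integral) auto
  also have "\<dots> = (\<integral>\<^sup>+k. \<phi> k * emeasure m {x. 0 < x \<and> level U x = k} \<partial>count_space UNIV)"
    using sets_level_eq by (intro nn_integral_cong nn_integral_cmult_indicator)
  finally show ?thesis .
qed

end

text \<open>\<open>A_pos\<close> makes P finite as soon as the right-hand side of the Hardy
  inequality is; \<open>W_finite\<close> permits division by powers of the \<omega>-mass in the test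
  functions.\<close>

locale hardy_discretization =
  om: half_line_measure \<omega> + al: half_line_measure \<alpha> + be: dyadic_tail \<beta> U 1
  for \<omega> \<alpha> \<beta> :: "real measure" and U :: "real \<Rightarrow> real" +
  fixes p q s :: real
  assumes p: "1 < p" and q: "1 < q" and s: "0 < s" "s \<le> 1"
    and W_finite: "0 < x \<Longrightarrow> emeasure \<omega> {0<..<x} < top"
    and A_pos: "0 < t \<Longrightarrow> 0 < emeasure \<alpha> {0<..<t}"
begin

definition W_level :: "real \<Rightarrow> int \<Rightarrow> ennreal" where
  "W_level t k = emeasure \<omega> ({x. 0 < x \<and> level U x \<le> k} \<inter> {0<..<t})"

text \<open>The second factor is the norm on L^p(\<omega>) of integration over the levels up to
  \<open>k\<close> within (0,t), since 1 - 1/p is the reciprocal of the conjugate exponent. The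
  first is the (1/q)-th power of 2^(-k), the order of the \<beta>-mass of level
  \<open>k\<close>.\<close>

definition mult_seq :: "real \<Rightarrow> int \<Rightarrow> ennreal" where
  "mult_seq t k = two_pow (- (1 / q) * real_of_int k) * W_level t k powe (1 - 1 / p)"

lemma sets_om_level: "{x. 0 < x \<and> level U x = k} \<in> sets \<omega>" "{x. 0 < x \<and> level U x \<le> k} \<in> sets \<omega>"
proof -
  show "{x. 0 < x \<and> level U x = k} \<in> sets \<omega>"
    unfolding be.level_eq_diff by (intro sets.Diff om.sets_upset be.upset_level)
  have "space \<omega> - {x. 0 < x \<and> k + 1 \<le> level U x} \<in> sets \<omega>"
    by (intro sets.compl_sets om.sets_upset be.upset_level)
  also have "space \<omega> - {x. 0 < x \<and> k + 1 \<le> level U x} = {x. 0 < x \<and> level U x \<le> k}" by auto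
  finally show "{x. 0 < x \<and> level U x \<le> k} \<in> sets \<omega>" .
qed

lemma sum_om_level:
  assumes [measurable]: "g \<in> borel_measurable \<omega>"
  shows "(\<integral>\<^sup>+y. g y * indicator {y. level U y \<le> n} y \<partial>\<omega>)
    = (\<integral>\<^sup>+j. (\<integral>\<^sup>+y. g y * indicator {y. 0 < y \<and> level U y = j} y \<partial>\<omega>) * indicator {..n} j \<partial>count_space UNIV)"
proof -
  note [measurable] = sets_om_level
  have "(\<integral>\<^sup>+y. g y * indicator {y. level U y \<le> n} y \<partial>\<omega>)
    = (\<integral>\<^sup>+y. (\<integral>\<^sup>+j. g y * indicator {y. 0 < y \<and> level U y = j} y * indicator {..n} j \<partial>count_space UNIV) \<partial>\<omega>)"
  proof (rule nn_integral_cong)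
    fix y assume "y \<in> space \<omega>"
    then have "(\<integral>\<^sup>+j. g y * indicator {y. 0 < y \<and> level U y = j} y * indicator {..n} j \<partial>count_space UNIV)
        = (\<integral>\<^sup>+j. (g y * indicator {y. level U y \<le> n} y) * indicator {level U y} j \<partial>count_space UNIV)"
      by (intro nn_integral_cong) (auto split: split_indicator)
    then show "g y * indicator {y. level U y \<le> n} y
        = (\<integral>\<^sup>+j. g y * indicator {y. 0 < y \<and> level U y = j} y * indicator {..n} j \<partial>count_space UNIV)"
      by simp
  qed
  also have "\<dots> = (\<integral>\<^sup>+j. (\<integral>\<^sup>+y. g y * indicator {y. 0 < y \<and> level U y = j} y * indicator {..n} j \<partial>\<omega>) \<partial>count_space UNIV)"
    by (intro nn_integral_count_space_nn_integral) auto
  also have "\<dots> = (\<integral>\<^sup>+j. (\<integral>\<^sup>+y. g y * indicator {y. 0 < y \<and> level U y = j} y \<partial>\<omega>) * indicator {..n} j \<partial>count_space UNIV)"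
    by (intro nn_integral_cong nn_integral_multc) auto
  finally show ?thesis .
qed

text \<open>A point left of \<open>x\<close> has level at most that of \<open>x\<close>, so the
  inner integral is bounded by a sum over the levels lying \<open>i\<close> steps lower, i >= 0.
  Minkowski separates the values of \<open>i\<close>; translating by \<open>i\<close> costs
  2^(-i/q), whence \<open>geo (1 / q)\<close>.\<close>

lemma hardy_le_level_sums:
  assumes g [measurable]: "g \<in> borel_measurable \<omega>"
  shows "lnorm \<beta> q (\<lambda>x. \<integral>\<^sup>+y. g y * indicator {0<..<x} y \<partial>\<omega>)
    \<le> geo (1 / q) * sqnorm q (\<lambda>k. two_pow (- (1 / q) * real_of_int k) *
          (\<integral>\<^sup>+y. g y * indicator {y. 0 < y \<and> level U y = k} y \<partial>\<omega>))"
proof -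
  define d where "d k = (\<integral>\<^sup>+y. g y * indicator {y. 0 < y \<and> level U y = k} y \<partial>\<omega>)" for k
  let ?t = "\<lambda>k. two_pow (- (1 / q) * real_of_int k)"
  have F: "(\<integral>\<^sup>+y. g y * indicator {0<..<x} y \<partial>\<omega>) \<le> (\<integral>\<^sup>+i. d (level U x - int i) \<partial>count_space UNIV)"
    if "0 < x" for x
  proof -
    have "(\<integral>\<^sup>+y. g y * indicator {0<..<x} y \<partial>\<omega>) \<le> (\<integral>\<^sup>+y. g y * indicator {y. level U y \<le> level U x} y \<partial>\<omega>)"
      using be.level_mono by (intro nn_integral_mono mult_left_mono) (auto split: split_indicator)
    also have "\<dots> = (\<integral>\<^sup>+j. d j * indicator {..level U x} j \<partial>count_space UNIV)"
      unfolding d_def by (rule sum_om_level[OF g])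
    also have "\<dots> = (\<integral>\<^sup>+i. d (level U x - int i) \<partial>count_space UNIV)"
      by (rule sum_int_atMost)
    finally show ?thesis .
  qed
  have shift: "sqnorm q (\<lambda>k. ?t k * d (k - int i)) = two_pow (- (1 / q) * real i) * sqnorm q (\<lambda>k. ?t k * d k)" for i
  proof -
    have bij: "bij_betw (\<lambda>k. k - int i) UNIV UNIV"
      by (rule bij_betwI[where g = "\<lambda>k. k + int i"]) auto
    have "?t k = two_pow (- (1 / q) * real i) * ?t (k - int i)" for k
      unfolding two_pow_add[symmetric] by (simp add: diff_divide_distrib)
    then have "sqnorm q (\<lambda>k. ?t k * d (k - int i))
        = sqnorm q (\<lambda>k. two_pow (- (1 / q) * real i) * (?t (k - int i) * d (k - int i)))"
      by (metis (no_types, lifting) mult.assoc)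
    also have "\<dots> = two_pow (- (1 / q) * real i) * sqnorm q (\<lambda>k. ?t (k - int i) * d (k - int i))"
      using q by (intro lnorm_cmult) auto
    also have "sqnorm q (\<lambda>k. ?t (k - int i) * d (k - int i)) = sqnorm q (\<lambda>k. ?t k * d k)"
      unfolding lnorm_def using nn_integral_bij_count_space[OF bij, of "\<lambda>k. (?t k * d k) powe q"] by simp
    finally show ?thesis .
  qed
  have "lnorm \<beta> q (\<lambda>x. \<integral>\<^sup>+y. g y * indicator {0<..<x} y \<partial>\<omega>)
      \<le> lnorm \<beta> q (\<lambda>x. \<integral>\<^sup>+i. d (level U x - int i) \<partial>count_space UNIV)"
    using q F by (intro lnorm_mono) auto
  also have "\<dots> = (\<integral>\<^sup>+k. (\<integral>\<^sup>+i. d (k - int i) \<partial>count_space UNIV) powe q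
      * emeasure \<beta> {x. 0 < x \<and> level U x = k} \<partial>count_space UNIV) powe (1 / q)"
    unfolding lnorm_def
    by (subst be.nn_integral_level[where \<phi> = "\<lambda>k. (\<integral>\<^sup>+i. d (k - int i) \<partial>count_space UNIV) powe q"]) simp
  also have "\<dots> \<le> sqnorm q (\<lambda>k. \<integral>\<^sup>+i. ?t k * d (k - int i) \<partial>count_space UNIV)"
    unfolding lnorm_def
  proof (intro powe_mono nn_integral_mono)
    fix k :: int
    have "(\<integral>\<^sup>+i. d (k - int i) \<partial>count_space UNIV) powe q * emeasure \<beta> {x. 0 < x \<and> level U x = k}
      \<le> (\<integral>\<^sup>+i. d (k - int i) \<partial>count_space UNIV) powe q * ?t k powe q"
      using be.emeasure_level_eq_le[of k] q by (intro mult_left_mono) (auto simp: two_pow_powe)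
    also have "\<dots> = (\<integral>\<^sup>+i. ?t k * d (k - int i) \<partial>count_space UNIV) powe q"
      using q by (subst nn_integral_cmult) (auto simp: powe_mult mult.commute)
    finally show "(\<integral>\<^sup>+i. d (k - int i) \<partial>count_space UNIV) powe q * emeasure \<beta> {x. 0 < x \<and> level U x = k}
      \<le> (\<integral>\<^sup>+i. ?t k * d (k - int i) \<partial>count_space UNIV) powe q" .
  qed (use q in simp)
  also have "\<dots> \<le> (\<integral>\<^sup>+i. sqnorm q (\<lambda>k. ?t k * d (k - int i)) \<partial>count_space UNIV)"
    by (rule minkowski_sum[OF q])
  also have "\<dots> = geo (1 / q) * sqnorm q (\<lambda>k. ?t k * d k)"
    unfolding shift geo_def by (rule nn_integral_multc) simp
  finally show ?thesis by (simp add: d_def)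
qed

lemma sum_om_level_le:
  assumes [measurable]: "h \<in> borel_measurable \<omega>"
  shows "(\<integral>\<^sup>+k. (\<integral>\<^sup>+y. h y * indicator {y. 0 < y \<and> level U y = k} y \<partial>\<omega>) \<partial>count_space UNIV) \<le> (\<integral>\<^sup>+y. h y \<partial>\<omega>)"
proof -
  note [measurable] = sets_om_level
  have "(\<integral>\<^sup>+k. (\<integral>\<^sup>+y. h y * indicator {y. 0 < y \<and> level U y = k} y \<partial>\<omega>) \<partial>count_space UNIV)
    = (\<integral>\<^sup>+y. (\<integral>\<^sup>+k. h y * indicator {y. 0 < y \<and> level U y = k} y \<partial>count_space UNIV) \<partial>\<omega>)"
    by (rule nn_integral_count_space_nn_integral[symmetric]) auto
  also have "\<dots> \<le> (\<integral>\<^sup>+y. (\<integral>\<^sup>+k. h y * indicator {level U y} k \<partial>count_space UNIV) \<partial>\<omega>)"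
    by (intro nn_integral_mono) (auto split: split_indicator)
  finally show ?thesis by simp
qed

text \<open>\<open>E\<close> may contain \<open>t\<close> although \<open>W_level\<close> stops
  before it: the pieces in \<open>hardy_upper\<close> are only known to lie in (0,t], and the point
  \<open>t\<close> is null.\<close>

lemma holder_level:
  assumes [measurable]: "g \<in> borel_measurable \<omega>" "E \<in> sets \<omega>"
    and E: "E \<subseteq> {y. 0 < y \<and> level U y \<le> k}" "E \<subseteq> {0<..t}" and t: "0 < t"
  shows "(\<integral>\<^sup>+y. g y * indicator E y \<partial>\<omega>)
    \<le> (\<integral>\<^sup>+y. g y powe p * indicator E y \<partial>\<omega>) powe (1 / p) * W_level t k powe (1 - 1 / p)"
proof -
  define p' where "p' = p / (p - 1)"
  have p': "p' > 1" "1 / p + 1 / p' = 1" "1 / p' = 1 - 1 / p"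
    using p by (auto simp: p'_def field_simps)
  note [measurable] = sets_om_level om.sets_Ioo
  have ind: "indicator E y powe r = (indicator E y :: ennreal)" for y r
    by (auto split: split_indicator)
  have "(\<integral>\<^sup>+y. g y * indicator E y \<partial>\<omega>) = (\<integral>\<^sup>+y. (g y * indicator E y) * indicator E y \<partial>\<omega>)"
    by (intro nn_integral_cong) (auto split: split_indicator)
  also have "\<dots> \<le> lnorm \<omega> p (\<lambda>y. g y * indicator E y) * lnorm \<omega> p' (indicator E)"
    by (rule holder_ennreal) (use p p' in auto)
  also have "lnorm \<omega> p (\<lambda>y. g y * indicator E y) = (\<integral>\<^sup>+y. g y powe p * indicator E y \<partial>\<omega>) powe (1 / p)"
    using p by (simp add: lnorm_def powe_mult ind)
  also have "lnorm \<omega> p' (indicator E) = emeasure \<omega> E powe (1 - 1 / p)"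
    by (simp add: lnorm_def ind p')
  also have "emeasure \<omega> E \<le> W_level t k"
  proof -
    have nt: "{t} \<in> null_sets \<omega>"
      using t by (auto intro: om.sets_singleton om.null_singleton)
    have "E \<subseteq> ({x. 0 < x \<and> level U x \<le> k} \<inter> {0<..<t}) \<union> {t}"
      using E by force
    then have "emeasure \<omega> E \<le> emeasure \<omega> (({x. 0 < x \<and> level U x \<le> k} \<inter> {0<..<t}) \<union> {t})"
      using nt by (intro emeasure_mono sets.Un) auto
    also have "\<dots> = W_level t k"
      unfolding W_level_def by (rule emeasure_Un_null_set) (use nt in auto)
    finally show ?thesis .
  qed
  finally show ?thesis
    using p by (simp add: mult_left_mono powe_mono)
qed

text \<open>Three losses: \<open>geo (1 / q)\<close> for passing to levels, 2^(1/p) for the width of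
  a dyadic band of P, and \<open>geo (s / p)\<close> for recovering the integral of P^(s/p) from the
  \<alpha>-masses of the sets {P > 2^j}.\<close>

definition upper_const :: ennreal where
  "upper_const = geo (1 / q) * two_pow (1 / p) * geo (s / p) powe (1 / s)"

text \<open>The hypothesis says that the multiplication operator of \<open>mult_seq t\<close> has norm at most
  \<open>K \<alpha>(0,t)^(1/s)\<close>.  The pieces of \<open>g\<close> on which \<open>P\<close> is about \<open>2 powr j\<close> live on \<open>T j = {P > 2 powr j}\<close>,
  an initial interval; their contributions are summed using \<open>s \<le> 1\<close>.\<close>

theorem hardy_upper:
  assumes g [measurable]: "g \<in> borel_measurable \<omega>"
    and K: "\<And>t a. 0 < t \<Longrightarrow> sqnorm q (\<lambda>k. mult_seq t k * a k) \<le> K * emeasure \<alpha> {0<..<t} powe (1 / s) * sqnorm p a"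
    and Z: "(\<integral>\<^sup>+x. (\<integral>\<^sup>+y. g y powe p * indicator {x<..} y \<partial>\<omega>) powe (s / p) \<partial>\<alpha>) < top"
  shows "lnorm \<beta> q (\<lambda>x. \<integral>\<^sup>+y. g y * indicator {0<..<x} y \<partial>\<omega>)
    \<le> upper_const * K * (\<integral>\<^sup>+x. (\<integral>\<^sup>+y. g y powe p * indicator {x<..} y \<partial>\<omega>) powe (s / p) \<partial>\<alpha>) powe (1 / s)"
proof -
  \<comment> \<open>P is the tail of this measure, so the continuity results for final segments
    apply to P.\<close>
  define \<eta> where "\<eta> = density \<omega> (\<lambda>y. g y powe p)"
  interpret eta: half_line_measure \<eta>
    unfolding \<eta>_def by (rule om.half_line_measure_density) measurable
  define P where "P x = (\<integral>\<^sup>+y. g y powe p * indicator {x<..} y \<partial>\<omega>)" for x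
  define Z where "Z = (\<integral>\<^sup>+x. P x powe (s / p) \<partial>\<alpha>)"
  have sp: "0 < s / p" using s p by simp
  have P_eta: "P x = emeasure \<eta> {x<..}" if "0 < x" for x
    unfolding P_def \<eta>_def using that om.sets_Ioi[of x]
    by (subst emeasure_density) auto
  have P_anti: "P y \<le> P x" if "x \<le> y" for x y
    unfolding P_def using that by (intro nn_integral_mono mult_left_mono) (auto split: split_indicator)
  have P_meas [measurable]: "P \<in> borel_measurable \<alpha>"
    by (rule al.borel_measurable_antimono) (rule P_anti)
  \<comment> \<open>An infinite value at \<open>x\<close> would persist on all of (0,x), a set of
    positive \<alpha>-measure, and make the integral of P^(s/p) infinite.\<close>
  have P_fin: "P x < top" if x: "0 < x" for x
  proof (rule ccontr)
    assume "\<not> P x < top"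
    then have top: "P x = top" using less_top by blast
    have "(\<integral>\<^sup>+y. top * indicator {0<..<x} y \<partial>\<alpha>) \<le> Z"
      unfolding Z_def
    proof (rule nn_integral_mono)
      fix y
      have "P y = top" if "y < x" using P_anti[of y x] that top by (simp add: top_unique)
      then show "top * indicator {0<..<x} y \<le> P y powe (s / p)"
        by (auto split: split_indicator)
    qed
    also have "(\<integral>\<^sup>+y. top * indicator {0<..<x} y \<partial>\<alpha>) = top"
      using A_pos[OF x] al.sets_Ioo by (subst nn_integral_cmult_indicator) (auto simp: ennreal_top_mult)
    finally show False using Z by (simp add: Z_def P_def[symmetric] top_unique)
  qed
  \<comment> \<open>Finite tails tend to 0 at infinity; a positive lower bound for them would be a
    lower bound for the mass of the empty set.\<close>
  have P_small: "\<exists>x>0. P x < c" if "0 < c" for c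
  proof (rule ccontr)
    assume "\<not> (\<exists>x>0. P x < c)"
    then have "c \<le> emeasure \<eta> {x<..}" if "0 < x" for x
      using that P_eta[OF that] by (metis not_less)
    moreover have "emeasure \<eta> {x<..} < top" if "0 < x" for x
      using P_fin[OF that] P_eta[OF that] by simp
    ultimately have "c \<le> emeasure \<eta> {}"
      by (intro eta.upset_ge[of "{}" 1]) (auto simp: upset_def)
    then show False using that by simp
  qed
  define D where "D j = {x. 0 < x \<and> two_pow (real_of_int j) < P x \<and> P x \<le> two_pow (real_of_int (j + 1))}" for j
  define T where "T j = {x. 0 < x \<and> two_pow (real_of_int j) < P x}" for j
  have up: "upset {x. 0 < x \<and> P x \<le> c}" for c
    unfolding upset_def by safe (use P_anti in \<open>force, meson order_trans\<close>)
  have D_diff: "D j = {x. 0 < x \<and> P x \<le> two_pow (real_of_int (j + 1))} - {x. 0 < x \<and> P x \<le> two_pow (real_of_int j)}" for j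
    by (auto simp: D_def)
  have D_om [measurable]: "D j \<in> sets \<omega>" for j
    unfolding D_diff by (intro sets.Diff om.sets_upset up)
  have T_al [measurable]: "T j \<in> sets \<alpha>" for j
  proof -
    have "space \<alpha> - {x. 0 < x \<and> P x \<le> two_pow (real_of_int j)} \<in> sets \<alpha>"
      by (intro sets.compl_sets al.sets_upset up)
    also have "space \<alpha> - {x. 0 < x \<and> P x \<le> two_pow (real_of_int j)} = T j" by (auto simp: T_def)
    finally show ?thesis .
  qed
  \<comment> \<open>The set {P <= c} is a final segment and P is the tail of \<eta> itself, so its
    mass is controlled by the value of P at its own points.\<close>
  have eta_low: "emeasure \<eta> {x. 0 < x \<and> P x \<le> c} \<le> c" for c
    by (rule eta.upset_le[OF up]) (simp add: P_eta[symmetric])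
  have eta_D: "(\<integral>\<^sup>+y. g y powe p * indicator (D j) y \<partial>\<omega>) \<le> two_pow (real_of_int (j + 1))" for j
  proof -
    have "(\<integral>\<^sup>+y. g y powe p * indicator (D j) y \<partial>\<omega>) = emeasure \<eta> (D j)"
      unfolding \<eta>_def by (subst emeasure_density) auto
    also have "\<dots> \<le> emeasure \<eta> {x. 0 < x \<and> P x \<le> two_pow (real_of_int (j + 1))}"
      by (rule emeasure_mono) (auto simp: D_def intro: eta.sets_upset up)
    also have "\<dots> \<le> two_pow (real_of_int (j + 1))" by (rule eta_low)
    finally show ?thesis .
  qed
  \<comment> \<open>Points with P = 0 lie in no band \<open>D j\<close>; the previous bound with c =
    0 shows that \<open>g\<close> vanishes almost everywhere there.\<close>
  have g_zero: "AE y in \<omega>. P y = 0 \<longrightarrow> g y = 0"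
  proof -
    have S [measurable]: "{x. 0 < x \<and> P x \<le> 0} \<in> sets \<omega>" by (intro om.sets_upset up)
    have "(\<integral>\<^sup>+y. g y powe p * indicator {x. 0 < x \<and> P x \<le> 0} y \<partial>\<omega>) = emeasure \<eta> {x. 0 < x \<and> P x \<le> 0}"
      unfolding \<eta>_def using S by (subst emeasure_density) auto
    also have "\<dots> = 0" using eta_low[of 0] by simp
    finally have "AE y in \<omega>. g y powe p * indicator {x. 0 < x \<and> P x \<le> 0} y = 0"
      by (rule iffD1[OF nn_integral_0_iff_AE, rotated]) measurable
    then show ?thesis
    proof (rule AE_mp, intro AE_I2 impI)
      fix y assume "y \<in> space \<omega>" "g y powe p * indicator {x. 0 < x \<and> P x \<le> 0} y = 0" "P y = 0"
      then have "g y powe p = 0" by simp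
      then show "g y = 0" using p by simp
    qed
  qed
  define L where "L k = {y. 0 < y \<and> level U y = k}" for k
  have [measurable]: "L k \<in> sets \<omega>" for k unfolding L_def by (rule sets_om_level)
  define d where "d j k = (\<integral>\<^sup>+y. g y * indicator (L k \<inter> D j) y \<partial>\<omega>)" for j k
  let ?t = "\<lambda>k. two_pow (- (1 / q) * real_of_int k)"
  have split: "(\<integral>\<^sup>+y. g y * indicator (L k) y \<partial>\<omega>) \<le> (\<integral>\<^sup>+j. d j k \<partial>count_space UNIV)" for k
  proof -
    have "(\<integral>\<^sup>+y. g y * indicator (L k) y \<partial>\<omega>)
      \<le> (\<integral>\<^sup>+y. (\<integral>\<^sup>+j. g y * indicator (L k \<inter> D j) y \<partial>count_space UNIV) \<partial>\<omega>)"
    proof (rule nn_integral_mono_AE, rule AE_mp[OF g_zero], rule AE_I2, rule impI)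
      fix y assume y: "y \<in> space \<omega>" "P y = 0 \<longrightarrow> g y = 0"
      show "g y * indicator (L k) y \<le> (\<integral>\<^sup>+j. g y * indicator (L k \<inter> D j) y \<partial>count_space UNIV)"
      proof (cases "P y = 0")
        case False
        then obtain j where "y \<in> D j"
          using two_pow_bracket[of "P y"] P_fin[of y] y by (auto simp: D_def zero_less_iff_neq_zero)
        then have "g y * indicator (L k) y = g y * indicator (L k \<inter> D j) y"
          by (auto split: split_indicator)
        also have "\<dots> \<le> (\<integral>\<^sup>+j. g y * indicator (L k \<inter> D j) y \<partial>count_space UNIV)"
          by (rule nn_integral_ge_point) simp
        finally show ?thesis .
      qed (use y in simp)
    qed
    also have "\<dots> = (\<integral>\<^sup>+j. d j k \<partial>count_space UNIV)"
      unfolding d_def by (intro nn_integral_count_space_nn_integral) auto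
    finally show ?thesis .
  qed
  have piece: "sqnorm q (\<lambda>k. ?t k * d j k)
      \<le> K * two_pow (1 / p) * (two_pow (s / p * real_of_int j) * emeasure \<alpha> (T j)) powe (1 / s)" for j
  proof (cases "D j = {}")
    case True
    then show ?thesis using q by (simp add: d_def lnorm_def)
  next
    case False
    \<comment> \<open>P decreases, so \<open>T j\<close> is an initial interval with (0,t) inside
      \<open>T j\<close> inside (0,t]. The first inclusion compares \<alpha>-masses, the second
      places \<open>D j\<close> in (0,t].\<close>
    define t where "t = Sup (T j)"
    have Tne: "T j \<noteq> {}" using False by (auto simp: D_def T_def)
    obtain b where b: "0 < b" "P b < two_pow (real_of_int j)" using P_small[of "two_pow (real_of_int j)"] by auto
    have bdd: "bdd_above (T j)"
    proof (rule bdd_aboveI)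
      fix x assume "x \<in> T j"
      then have "P b < P x" using b by (auto simp: T_def)
      then have "\<not> b \<le> x" using P_anti[of x b] P_anti[of b x] by (meson leD)
      then show "x \<le> b" by simp
    qed
    have T_le: "x \<le> t" if "x \<in> T j" for x
      unfolding t_def using bdd that by (intro cSup_upper) auto
    have t: "0 < t" using Tne T_le by (fastforce simp: T_def)
    have sub: "{0<..<t} \<subseteq> T j"
    proof
      fix x assume x: "x \<in> {0<..<t}"
      then obtain y where "y \<in> T j" "x < y" unfolding t_def using less_cSup_iff[OF Tne bdd] by auto
      then show "x \<in> T j" using x P_anti[of x y] by (auto simp: T_def)
    qed
    define a where "a k = (\<integral>\<^sup>+y. g y powe p * indicator (L k \<inter> D j) y \<partial>\<omega>) powe (1 / p)" for k
    have "sqnorm q (\<lambda>k. ?t k * d j k) \<le> sqnorm q (\<lambda>k. mult_seq t k * a k)"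
    proof (rule lnorm_mono)
      fix k
      have "D j \<subseteq> {0<..t}" using T_le by (auto simp: D_def T_def)
      then have "d j k \<le> a k * W_level t k powe (1 - 1 / p)"
        unfolding d_def a_def by (intro holder_level t g) (measurable, auto simp: L_def)
      then have "?t k * d j k \<le> ?t k * (a k * W_level t k powe (1 - 1 / p))"
        by (rule mult_left_mono) simp
      then show "?t k * d j k \<le> mult_seq t k * a k"
        by (simp add: mult_seq_def mult_ac)
    qed (use q in simp)
    also have "\<dots> \<le> K * emeasure \<alpha> {0<..<t} powe (1 / s) * sqnorm p a"
      by (rule K[OF t])
    also have "\<dots> \<le> K * emeasure \<alpha> (T j) powe (1 / s) * two_pow (1 / p * real_of_int (j + 1))"
    proof (intro mult_mono powe_mono mult_left_mono emeasure_mono sub)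
      have "(\<integral>\<^sup>+k. a k powe p \<partial>count_space UNIV)
          = (\<integral>\<^sup>+k. (\<integral>\<^sup>+y. (g y powe p * indicator (D j) y) * indicator {y. 0 < y \<and> level U y = k} y \<partial>\<omega>) \<partial>count_space UNIV)"
        unfolding a_def using p
        by (intro nn_integral_cong) (auto simp: powe_cancel L_def intro!: nn_integral_cong split: split_indicator)
      also have "\<dots> \<le> (\<integral>\<^sup>+y. g y powe p * indicator (D j) y \<partial>\<omega>)"
        by (rule sum_om_level_le) measurable
      also have "\<dots> \<le> two_pow (real_of_int (j + 1))" by (rule eta_D)
      finally have "sqnorm p a \<le> two_pow (real_of_int (j + 1)) powe (1 / p)"
        unfolding lnorm_def using p by (intro powe_mono) auto
      then show "sqnorm p a \<le> two_pow (1 / p * real_of_int (j + 1))"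
        using p by (subst (asm) two_pow_powe) (auto simp: mult.commute)
    qed (use s in auto)
    \<comment> \<open>Everything that depends on \<open>j\<close> is collected under the power 1/s,
      so that the sum over \<open>j\<close> can be moved inside that power.\<close>
    also have "two_pow (1 / p * real_of_int (j + 1)) = two_pow (1 / p) * two_pow (s / p * real_of_int j) powe (1 / s)"
      using s p by (simp add: two_pow_powe two_pow_add[symmetric] field_simps)
    also have "K * emeasure \<alpha> (T j) powe (1 / s) * \<dots>
        = K * two_pow (1 / p) * (two_pow (s / p * real_of_int j) * emeasure \<alpha> (T j)) powe (1 / s)"
      using s by (simp add: powe_mult mult_ac)
    finally show ?thesis .
  qed
  have levels: "(\<integral>\<^sup>+j. two_pow (s / p * real_of_int j) * emeasure \<alpha> (T j) \<partial>count_space UNIV) \<le> geo (s / p) * Z"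
  proof -
    have "(\<integral>\<^sup>+j. two_pow (s / p * real_of_int j) * emeasure \<alpha> (T j) \<partial>count_space UNIV)
      = (\<integral>\<^sup>+j. (\<integral>\<^sup>+x. two_pow (s / p * real_of_int j) * indicator (T j) x \<partial>\<alpha>) \<partial>count_space UNIV)"
      by (intro nn_integral_cong nn_integral_cmult_indicator[symmetric]) simp
    also have "\<dots> = (\<integral>\<^sup>+x. (\<integral>\<^sup>+j. two_pow (s / p * real_of_int j) * indicator (T j) x \<partial>count_space UNIV) \<partial>\<alpha>)"
      by (rule nn_integral_count_space_nn_integral[symmetric]) auto
    also have "\<dots> \<le> (\<integral>\<^sup>+x. geo (s / p) * P x powe (s / p) \<partial>\<alpha>)"
    proof (rule nn_integral_mono)
      fix x
      have "(\<integral>\<^sup>+j. two_pow (s / p * real_of_int j) * indicator (T j) x \<partial>count_space UNIV)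
        \<le> (\<integral>\<^sup>+j. (if two_pow (real_of_int j) < P x then two_pow (s / p * real_of_int j) else 0) \<partial>count_space UNIV)"
        by (intro nn_integral_mono) (auto simp: T_def split: split_indicator)
      also have "\<dots> \<le> geo (s / p) * P x powe (s / p)"
        by (rule dyadic_level_sum[OF sp])
      finally show "(\<integral>\<^sup>+j. two_pow (s / p * real_of_int j) * indicator (T j) x \<partial>count_space UNIV)
        \<le> geo (s / p) * P x powe (s / p)" .
    qed
    also have "\<dots> = geo (s / p) * Z"
      unfolding Z_def by (rule nn_integral_cmult) measurable
    finally show ?thesis .
  qed
  have "sqnorm q (\<lambda>k. ?t k * (\<integral>\<^sup>+y. g y * indicator (L k) y \<partial>\<omega>))
      \<le> sqnorm q (\<lambda>k. \<integral>\<^sup>+j. ?t k * d j k \<partial>count_space UNIV)"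
    using q split by (intro lnorm_mono) (auto simp: nn_integral_cmult intro!: mult_left_mono)
  also have "\<dots> \<le> (\<integral>\<^sup>+j. sqnorm q (\<lambda>k. ?t k * d j k) \<partial>count_space UNIV)"
    by (rule minkowski_sum[OF q])
  also have "\<dots> \<le> (\<integral>\<^sup>+j. K * two_pow (1 / p) * (two_pow (s / p * real_of_int j) * emeasure \<alpha> (T j)) powe (1 / s) \<partial>count_space UNIV)"
    by (intro nn_integral_mono piece)
  also have "\<dots> = K * two_pow (1 / p) * (\<integral>\<^sup>+j. (two_pow (s / p * real_of_int j) * emeasure \<alpha> (T j)) powe (1 / s) \<partial>count_space UNIV)"
    by (rule nn_integral_cmult) simp
  \<comment> \<open>Here s <= 1 enters: for an exponent 1/s >= 1 the sum of powers is at most the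
    power of the sum.\<close>
  also have "\<dots> \<le> K * two_pow (1 / p) * (geo (s / p) * Z) powe (1 / s)"
    using s levels by (intro mult_left_mono order_trans[OF sum_powe_le] powe_mono) auto
  finally have *: "sqnorm q (\<lambda>k. ?t k * (\<integral>\<^sup>+y. g y * indicator (L k) y \<partial>\<omega>)) \<le> K * two_pow (1 / p) * (geo (s / p) * Z) powe (1 / s)" .
  have "lnorm \<beta> q (\<lambda>x. \<integral>\<^sup>+y. g y * indicator {0<..<x} y \<partial>\<omega>)
    \<le> geo (1 / q) * sqnorm q (\<lambda>k. ?t k * (\<integral>\<^sup>+y. g y * indicator (L k) y \<partial>\<omega>))"
    unfolding L_def by (rule hardy_le_level_sums[OF g])
  also have "\<dots> \<le> geo (1 / q) * (K * two_pow (1 / p) * (geo (s / p) * Z) powe (1 / s))"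
    by (rule mult_left_mono[OF *]) simp
  also have "\<dots> = upper_const * K * Z powe (1 / s)"
    using s by (simp add: upper_const_def powe_mult mult_ac)
  finally show ?thesis by (simp add: Z_def P_def)
qed

lemma W_level_finite: "0 < t \<Longrightarrow> W_level t k < top"
  unfolding W_level_def using W_finite[of t] sets_om_level(2)[of k] om.sets_Ioo[of t]
  by (meson emeasure_mono inf_le2 le_less_trans)

text \<open>The test function is \<open>(\<Sum>k. c k ^ p * indicator {level \<le> k})^(1/p)\<close> on \<open>(0,t)\<close>: its \<open>p\<close>-th power
  integrates termwise, and on every level it dominates each single \<open>c k\<close>.\<close>

theorem hardy_lower:
  assumes t: "0 < t"
  shows "\<exists>g \<in> borel_measurable \<omega>.
    (\<integral>\<^sup>+x. (\<integral>\<^sup>+y. g y powe p * indicator {x<..} y \<partial>\<omega>) powe (s / p) \<partial>\<alpha>) powe (1 / s)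
      \<le> sqnorm p a * emeasure \<alpha> {0<..<t} powe (1 / s) \<and>
    two_pow (- 2 / q) * sqnorm q (\<lambda>k. mult_seq t k * a k)
      \<le> lnorm \<beta> q (\<lambda>x. \<integral>\<^sup>+y. g y * indicator {0<..<x} y \<partial>\<omega>)"
proof -
  define W where "W = W_level t"
  have W_fin: "W k < top" for k unfolding W_def by (rule W_level_finite[OF t])
  define E where "E k = {x. 0 < x \<and> level U x \<le> k} \<inter> {0<..<t}" for k
  have W_E: "W k = emeasure \<omega> (E k)" for k by (simp add: W_def W_level_def E_def)
  have E_meas [measurable]: "E k \<in> sets \<omega>" for k
    unfolding E_def by (intro sets.Int sets_om_level om.sets_Ioo)
  \<comment> \<open>Chosen so that c_k^p * W_k <= a_k^p while c_k * W_k >= a_k * W_k^(1 - 1/p). The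
    value 0 where W_k = 0 loses nothing, because \<open>mult_seq t k\<close> vanishes there.\<close>
  define c where "c k = (if W k = 0 then 0 else a k * inverse (W k powe (1 / p)))" for k
  define g where "g x = (\<integral>\<^sup>+k. c k powe p * indicator (E k) x \<partial>count_space UNIV) powe (1 / p)" for x
  have sup_meas [measurable]: "(\<lambda>x. \<integral>\<^sup>+k. c k powe p * indicator (E k) x \<partial>count_space UNIV) \<in> borel_measurable \<omega>"
  proof -
    have "(\<integral>\<^sup>+k. c k powe p * indicator (E k) x \<partial>count_space UNIV)
        = (\<Sum>i. c (int_decode i) powe p * indicator (E (int_decode i)) x)" for x
      using nn_integral_bij_count_space[OF bij_int_decode, of "\<lambda>k. c k powe p * indicator (E k) x"]
      by (simp add: nn_integral_count_space_nat)
    then show ?thesis by simp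
  qed
  have g_meas [measurable]: "g \<in> borel_measurable \<omega>"
    unfolding g_def by measurable
  have Wp: "W k powe (1 / p) * inverse (W k powe (1 / p)) = 1" if "W k \<noteq> 0" for k
    using that W_fin[of k] p by (auto simp: divide_ennreal_def[symmetric] intro!: ennreal_divide_self)
  have cW: "c k powe p * W k \<le> a k powe p" for k
  proof (cases "W k = 0")
    case False
    have "c k powe p * W k = (c k * W k powe (1 / p)) powe p"
      using p by (simp add: powe_mult powe_cancel)
    also have "c k * W k powe (1 / p) = a k"
      using False Wp[OF False] by (simp add: c_def mult.assoc mult.commute[of "inverse _"])
    finally show ?thesis by simp
  qed (simp add: c_def)
  have g_norm: "(\<integral>\<^sup>+y. g y powe p \<partial>\<omega>) \<le> sqnorm p a powe p"
  proof -
    have "(\<integral>\<^sup>+y. g y powe p \<partial>\<omega>) = (\<integral>\<^sup>+y. (\<integral>\<^sup>+k. c k powe p * indicator (E k) y \<partial>count_space UNIV) \<partial>\<omega>)"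
      unfolding g_def using p by (simp add: powe_cancel)
    also have "\<dots> = (\<integral>\<^sup>+k. (\<integral>\<^sup>+y. c k powe p * indicator (E k) y \<partial>\<omega>) \<partial>count_space UNIV)"
      by (rule nn_integral_count_space_nn_integral) auto
    also have "\<dots> = (\<integral>\<^sup>+k. c k powe p * W k \<partial>count_space UNIV)"
      unfolding W_E by (intro nn_integral_cong nn_integral_cmult_indicator) measurable
    also have "\<dots> \<le> (\<integral>\<^sup>+k. a k powe p \<partial>count_space UNIV)"
      by (intro nn_integral_mono cW)
    also have "\<dots> = sqnorm p a powe p" using p by (simp add: lnorm_powe)
    finally show ?thesis .
  qed
  have g_0: "g y = 0" if "t \<le> y" for y
    using that by (simp add: g_def E_def)
  have part1: "(\<integral>\<^sup>+x. (\<integral>\<^sup>+y. g y powe p * indicator {x<..} y \<partial>\<omega>) powe (s / p) \<partial>\<alpha>) powe (1 / s)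
      \<le> sqnorm p a * emeasure \<alpha> {0<..<t} powe (1 / s)"
  proof -
    have sp: "0 < s / p" using s p by simp
    have "(\<integral>\<^sup>+x. (\<integral>\<^sup>+y. g y powe p * indicator {x<..} y \<partial>\<omega>) powe (s / p) \<partial>\<alpha>)
      \<le> (\<integral>\<^sup>+x. sqnorm p a powe s * indicator {0<..<t} x \<partial>\<alpha>)"
    proof (rule nn_integral_mono)
      fix x assume x: "x \<in> space \<alpha>"
      show "(\<integral>\<^sup>+y. g y powe p * indicator {x<..} y \<partial>\<omega>) powe (s / p) \<le> sqnorm p a powe s * indicator {0<..<t} x"
      proof (cases "x < t")
        case True
        have "(\<integral>\<^sup>+y. g y powe p * indicator {x<..} y \<partial>\<omega>) \<le> (\<integral>\<^sup>+y. g y powe p \<partial>\<omega>)"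
          by (intro nn_integral_mono) (auto split: split_indicator)
        also note g_norm
        finally have "(\<integral>\<^sup>+y. g y powe p * indicator {x<..} y \<partial>\<omega>) powe (s / p) \<le> (sqnorm p a powe p) powe (s / p)"
          by (rule powe_mono[OF sp])
        also have "\<dots> = sqnorm p a powe s" using s p by (simp add: powe_powe)
        finally show ?thesis using True x by simp
      next
        case False
        then have "g y powe p * indicator {x<..} y = 0" for y
          using g_0[of y] by (auto split: split_indicator)
        then have "(\<integral>\<^sup>+y. g y powe p * indicator {x<..} y \<partial>\<omega>) = 0"
          by (subst nn_integral_cong[where v = "\<lambda>_. 0"]) (blast, simp)
        then show ?thesis by simp
      qed
    qed
    also have "\<dots> = sqnorm p a powe s * emeasure \<alpha> {0<..<t}"
      by (rule nn_integral_cmult_indicator) (rule al.sets_Ioo)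
    finally have "(\<integral>\<^sup>+x. (\<integral>\<^sup>+y. g y powe p * indicator {x<..} y \<partial>\<omega>) powe (s / p) \<partial>\<alpha>) powe (1 / s)
      \<le> (sqnorm p a powe s * emeasure \<alpha> {0<..<t}) powe (1 / s)"
      using s by (intro powe_mono) auto
    also have "\<dots> = sqnorm p a * emeasure \<alpha> {0<..<t} powe (1 / s)"
      using s by (simp add: powe_mult powe_cancel)
    finally show ?thesis .
  qed
  define e where "e k = a k * W k powe (1 - 1 / p)" for k
  have ce: "e k \<le> c k * W k" for k
  proof (cases "W k = 0")
    case False
    have "W k = W k powe (1 / p + (1 - 1 / p))" by simp
    also have "\<dots> = W k powe (1 / p) * W k powe (1 - 1 / p)"
      using p by (intro powe_add) auto
    finally have "c k * W k = c k * (W k powe (1 / p) * W k powe (1 - 1 / p))"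
      by (rule arg_cong)
    also have "\<dots> = c k * W k powe (1 / p) * W k powe (1 - 1 / p)"
      by (rule mult.assoc[symmetric])
    also have "c k * W k powe (1 / p) = a k"
      using False Wp[OF False] by (simp add: c_def mult.assoc mult.commute[of "inverse _"])
    finally show ?thesis by (simp add: e_def)
  qed (use p in \<open>simp add: e_def\<close>)
  \<comment> \<open>Points of level strictly below that of \<open>x\<close> lie left of
    \<open>x\<close>; for the level of \<open>x\<close> itself this fails, hence the index lowered
    by one.\<close>
  have F: "e (level U x - 1) \<le> (\<integral>\<^sup>+y. g y * indicator {0<..<x} y \<partial>\<omega>)" if x: "0 < x" for x
  proof -
    let ?k = "level U x - 1"
    have "e ?k \<le> (\<integral>\<^sup>+y. c ?k * indicator (E ?k) y \<partial>\<omega>)"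
      using ce[of ?k] unfolding W_E by (subst nn_integral_cmult_indicator) auto
    also have "\<dots> \<le> (\<integral>\<^sup>+y. g y * indicator {0<..<x} y \<partial>\<omega>)"
    proof (rule nn_integral_mono)
      fix y
      show "c ?k * indicator (E ?k) y \<le> g y * indicator {0<..<x} y"
      proof (cases "y \<in> E ?k")
        case True
        then have "\<not> x \<le> y" using be.level_mono[OF x, of y] by (auto simp: E_def)
        moreover have "c ?k \<le> g y"
        proof -
          have "c ?k powe p * indicator (E ?k) y \<le> (\<integral>\<^sup>+k. c k powe p * indicator (E k) y \<partial>count_space UNIV)"
            by (rule nn_integral_ge_point) simp
          then show ?thesis
            unfolding g_def using p True by (subst le_powe_iff) auto
        qed
        ultimately show ?thesis using True by (simp add: E_def)
      qed simp
    qed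
    finally show ?thesis .
  qed
  \<comment> \<open>Level \<open>k\<close> has mass 2^(-1) * 2^(-k) = 2^(-2) * 2^(-(k-1)): one
    factor 1/2 comes from subtracting consecutive tails, the other from the shifted index. A nonzero
    \<open>W (k - 1)\<close> supplies the point of lower level behind this value.\<close>
  have lev: "two_pow (- 2) * (two_pow (- real_of_int (k - 1)) * e (k - 1) powe q)
      \<le> e (k - 1) powe q * emeasure \<beta> {x. 0 < x \<and> level U x = k}" for k
  proof (cases "W (k - 1) = 0")
    case True
    then show ?thesis using p q by (simp add: e_def)
  next
    case False
    then have "E (k - 1) \<noteq> {}" unfolding W_E by auto
    then obtain x0 where "0 < x0" "level U x0 < k" by (auto simp: E_def)
    then have "emeasure \<beta> {x. 0 < x \<and> level U x = k} = ennreal (1 - 2 powr (- 1)) * two_pow (- 1 * real_of_int k)"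
      by (rule be.emeasure_level_eq)
    also have "ennreal (1 - 2 powr (- 1)) = two_pow (- 1)"
      unfolding two_pow_def by (rule arg_cong[where f = ennreal]) (simp add: powr_minus)
    also have "two_pow (- 1) * two_pow (- 1 * real_of_int k) = two_pow (- 2) * two_pow (- real_of_int (k - 1))"
      unfolding two_pow_add[symmetric] by simp
    finally have "emeasure \<beta> {x. 0 < x \<and> level U x = k} = two_pow (- 2) * two_pow (- real_of_int (k - 1))" .
    then show ?thesis by (simp add: mult_ac)
  qed
  have bij: "bij_betw (\<lambda>k. k - 1) (UNIV :: int set) UNIV"
    by (rule bij_betwI[where g = "\<lambda>k. k + 1"]) auto
  have "two_pow (- 2 / q) * sqnorm q (\<lambda>k. mult_seq t k * a k)
     = (\<integral>\<^sup>+k. two_pow (- 2) * (two_pow (- real_of_int k) * e k powe q) \<partial>count_space UNIV) powe (1 / q)"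
  proof -
    have "(mult_seq t k * a k) powe q = two_pow (- real_of_int k) * e k powe q" for k
      using q by (simp add: mult_seq_def e_def W_def powe_mult two_pow_powe mult_ac)
    then have "two_pow (- 2 / q) * sqnorm q (\<lambda>k. mult_seq t k * a k)
      = two_pow (- 2) powe (1 / q) * (\<integral>\<^sup>+k. two_pow (- real_of_int k) * e k powe q \<partial>count_space UNIV) powe (1 / q)"
      using q by (simp add: lnorm_def two_pow_powe)
    also have "\<dots> = (two_pow (- 2) * (\<integral>\<^sup>+k. two_pow (- real_of_int k) * e k powe q \<partial>count_space UNIV)) powe (1 / q)"
      using q by (simp add: powe_mult)
    finally show ?thesis by (simp add: nn_integral_cmult)
  qed
  also have "\<dots> = (\<integral>\<^sup>+k. two_pow (- 2) * (two_pow (- real_of_int (k - 1)) * e (k - 1) powe q) \<partial>count_space UNIV) powe (1 / q)"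
    using nn_integral_bij_count_space[OF bij, of "\<lambda>k. two_pow (- 2) * (two_pow (- real_of_int k) * e k powe q)"] by simp
  also have "\<dots> \<le> (\<integral>\<^sup>+k. e (k - 1) powe q * emeasure \<beta> {x. 0 < x \<and> level U x = k} \<partial>count_space UNIV) powe (1 / q)"
    using q by (intro powe_mono nn_integral_mono lev) auto
  also have "\<dots> = lnorm \<beta> q (\<lambda>x. e (level U x - 1))"
    unfolding lnorm_def using be.nn_integral_level[of "\<lambda>k. e (k - 1) powe q"] by simp
  also have "\<dots> \<le> lnorm \<beta> q (\<lambda>x. \<integral>\<^sup>+y. g y * indicator {0<..<x} y \<partial>\<omega>)"
    using q F by (intro lnorm_mono) auto
  finally have part2: "two_pow (- 2 / q) * sqnorm q (\<lambda>k. mult_seq t k * a k)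
      \<le> lnorm \<beta> q (\<lambda>x. \<integral>\<^sup>+y. g y * indicator {0<..<x} y \<partial>\<omega>)" .
  show ?thesis using g_meas part1 part2 by blast
qed

end

section \<open>Multipliers between sequence spaces\<close>

text \<open>For p <= q the inclusion of l^p in l^q has norm at most one.\<close>

lemma multiplier_le_sup:
  assumes pq: "1 < p" "p \<le> q"
  shows "sqnorm q (\<lambda>k. m k * a k) \<le> (SUP k. m k) * sqnorm p a"
proof -
  have "sqnorm q (\<lambda>k. m k * a k) \<le> sqnorm q (\<lambda>k. (SUP k. m k) * a k)"
    using pq by (intro lnorm_mono mult_right_mono SUP_upper) auto
  also have "\<dots> = (SUP k. m k) * sqnorm q a"
    using pq by (intro lnorm_cmult) auto
  also have "sqnorm q a \<le> sqnorm p a"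
  proof -
    have "(\<integral>\<^sup>+k. (a k powe p) powe (q / p) \<partial>count_space UNIV) \<le> (\<integral>\<^sup>+k. a k powe p \<partial>count_space UNIV) powe (q / p)"
      using pq by (intro sum_powe_le) (simp add: field_simps)
    then have "(\<integral>\<^sup>+k. a k powe q \<partial>count_space UNIV) powe (1 / q) \<le> ((\<integral>\<^sup>+k. a k powe p \<partial>count_space UNIV) powe (q / p)) powe (1 / q)"
      using pq by (intro powe_mono) (auto simp: powe_powe)
    then show ?thesis unfolding lnorm_def using pq by (simp add: powe_powe)
  qed
  finally show ?thesis by (simp add: mult_left_mono)
qed

text \<open>Hoelder for q-th powers, with the conjugate exponents p/q and r/q.\<close>

lemma multiplier_le_lnorm:
  assumes pq: "1 < q" "q < p" and r: "1 / r = 1 / q - 1 / p"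
  shows "sqnorm q (\<lambda>k. m k * a k) \<le> sqnorm r m * sqnorm p a"
proof -
  have r0: "0 < r"
  proof -
    have "0 < 1 / r" unfolding r using pq by (simp add: field_simps)
    then show ?thesis by simp
  qed
  have h: "p / q > 1" "r / q > 1" "1 / (p / q) + 1 / (r / q) = 1"
  proof -
    show "p / q > 1" using pq by simp
    have "1 / r < 1 / q" unfolding r using pq by simp
    then show "r / q > 1" using pq r0 by (simp add: field_simps)
    have "1 / (p / q) + 1 / (r / q) = q * (1 / p + 1 / r)" by (simp add: field_simps)
    also have "\<dots> = 1" unfolding r using pq by simp
    finally show "1 / (p / q) + 1 / (r / q) = 1" .
  qed
  have "(\<integral>\<^sup>+k. (m k * a k) powe q \<partial>count_space UNIV) = (\<integral>\<^sup>+k. a k powe q * m k powe q \<partial>count_space UNIV)"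
    using pq by (simp add: powe_mult mult.commute)
  also have "\<dots> \<le> sqnorm (p / q) (\<lambda>k. a k powe q) * sqnorm (r / q) (\<lambda>k. m k powe q)"
    by (rule holder_ennreal) (use h in auto)
  also have "\<dots> = (sqnorm r m * sqnorm p a) powe q"
    using pq r0 by (simp add: lnorm_def powe_powe powe_mult mult.commute)
  finally show ?thesis
    unfolding lnorm_def[of _ q] using pq by (subst powe_le_powe_iff) auto
qed

text \<open>Tested on unit vectors.\<close>

lemma sup_le_multiplier:
  fixes m :: "int \<Rightarrow> ennreal"
  assumes pq: "0 < p" "0 < q"
    and C: "\<And>a. sqnorm p a < top \<Longrightarrow> sqnorm q (\<lambda>k. m k * a k) \<le> C * sqnorm p a"
  shows "(SUP k. m k) \<le> C"
proof (rule SUP_least)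
  fix k :: int
  have ind: "indicator {k} j powe r = (indicator {k} j :: ennreal)" for j r
    by (auto split: split_indicator)
  have one: "sqnorm p (indicator {k}) = 1"
    unfolding lnorm_def ind by simp
  have "m k * indicator {k} k \<le> sqnorm q (\<lambda>j. m j * indicator {k} j)"
    by (rule sqnorm_ge_point[OF pq(2)])
  also have "\<dots> \<le> C * sqnorm p (indicator {k})"
    by (rule C) (simp add: one)
  finally show "m k \<le> C" by (simp add: one)
qed

text \<open>The test sequence m^(r/p) is extremal in Hoelder: since q + r*q/p = r, both sides become
  powers of the same sum. Restricting it to a finite set, with finite entries of \<open>m\<close>,
  keeps that sum finite so that it can be cancelled; an enumeration of the integers then removes the
  restriction.\<close>

lemma lnorm_le_multiplier:
  fixes m :: "int \<Rightarrow> ennreal"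
  assumes pq: "1 < q" "q < p" and r: "1 / r = 1 / q - 1 / p"
    and C: "\<And>a. sqnorm p a < top \<Longrightarrow> sqnorm q (\<lambda>k. m k * a k) \<le> C * sqnorm p a"
    and fin: "\<And>k. m k < top"
  shows "sqnorm r m \<le> C"
proof -
  have r0: "0 < r"
  proof -
    have "0 < 1 / r" unfolding r using pq by (simp add: field_simps)
    then show ?thesis by simp
  qed
  have rpq: "q + r * q / p = r"
    using pq r0 r by (simp add: field_simps)
  have part: "(\<integral>\<^sup>+k. m k powe r * indicator S k \<partial>count_space UNIV) \<le> C powe r" if S: "finite S" for S
  proof -
    define \<Sigma> where "\<Sigma> = (\<integral>\<^sup>+k. m k powe r * indicator S k \<partial>count_space UNIV)"
    define a where "a k = m k powe (r / p) * indicator S k" for k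
    have ind: "indicator S j powe e = (indicator S j :: ennreal)" for j and e :: real
      by (auto split: split_indicator)
    have a_norm: "sqnorm p a = \<Sigma> powe (1 / p)"
      unfolding lnorm_def a_def \<Sigma>_def using pq r0 by (simp add: powe_mult powe_powe ind)
    have mm: "(m k * a k) powe q = m k powe r * indicator S k" for k
    proof -
      have "(m k * a k) powe q = (m k powe q * m k powe (r * q / p)) * indicator S k"
        unfolding a_def using pq r0 by (simp add: powe_mult powe_powe ind mult_ac)
      also have "m k powe q * m k powe (r * q / p) = m k powe r"
        using pq r0 by (subst powe_add[symmetric]) (auto simp: rpq)
      finally show ?thesis .
    qed
    have "\<Sigma> = (\<Sum>k\<in>S. m k powe r)"
      unfolding \<Sigma>_def using S
      by (subst nn_integral_count_space'[of S]) (auto intro!: sum.cong)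
    also have "\<dots> < top"
      using fin r0 by (intro ennreal_sum_less_top[OF S, THEN iffD2]) simp
    finally have S_fin: "\<Sigma> < top" .
    have "\<Sigma> powe (1 / q) = sqnorm q (\<lambda>k. m k * a k)"
      unfolding lnorm_def mm \<Sigma>_def ..
    also have "\<dots> \<le> C * \<Sigma> powe (1 / p)"
      unfolding a_norm[symmetric] by (rule C) (use a_norm S_fin pq in simp)
    finally have le: "\<Sigma> powe (1 / q) \<le> C * \<Sigma> powe (1 / p)" .
    show ?thesis
    proof (cases "\<Sigma> = 0")
      case False
      have "1 / q = 1 / r + 1 / p" using r by simp
      then have "\<Sigma> powe (1 / q) = \<Sigma> powe (1 / r) * \<Sigma> powe (1 / p)"
        using pq r0 by (simp only: powe_add zero_less_divide_1_iff)
      with le have "\<Sigma> powe (1 / r) * \<Sigma> powe (1 / p) \<le> C * \<Sigma> powe (1 / p)" by simp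
      then have "\<Sigma> powe (1 / r) \<le> C"
        using False S_fin pq by (subst (asm) mult.commute, subst (asm) (2) mult.commute)
          (auto simp: ennreal_mult_le_mult_iff)
      then show ?thesis
        using r0 by (simp add: powe_le_powe_iff \<Sigma>_def)
    qed (simp add: \<Sigma>_def)
  qed
  have "(\<integral>\<^sup>+k. m k powe r \<partial>count_space UNIV) = (\<Sum>i. m (int_decode i) powe r)"
    using nn_integral_bij_count_space[OF bij_int_decode, of "\<lambda>k. m k powe r"]
    by (simp add: nn_integral_count_space_nat)
  also have "\<dots> = (SUP n. \<Sum>i<n. m (int_decode i) powe r)"
    by (rule suminf_eq_SUP)
  also have "\<dots> \<le> C powe r"
  proof (rule SUP_least)
    fix n
    have "(\<Sum>i<n. m (int_decode i) powe r) = (\<Sum>k\<in>int_decode ` {..<n}. m k powe r)"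
      by (subst sum.reindex) (auto intro: inj_on_subset[OF inj_int_decode])
    also have "\<dots> = (\<integral>\<^sup>+k. m k powe r * indicator (int_decode ` {..<n}) k \<partial>count_space UNIV)"
      by (subst nn_integral_count_space'[of "int_decode ` {..<n}"]) (auto intro!: sum.cong)
    also have "\<dots> \<le> C powe r" by (rule part) simp
    finally show "(\<Sum>i<n. m (int_decode i) powe r) \<le> C powe r" .
  qed
  finally show ?thesis
    unfolding lnorm_def using r0 by (subst powe_le_powe_iff) auto
qed

section \<open>Norms of the multiplier and continuous profiles\<close>

context hardy_discretization
begin

abbreviation W :: "real \<Rightarrow> ennreal" where
  "W x \<equiv> emeasure \<omega> {0<..<x}"

lemma W_le_W_level:
  assumes "0 < x" shows "W (min x t) \<le> W_level t (level U x)"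
  unfolding W_level_def using assms be.level_mono
  by (intro emeasure_mono sets.Int sets_om_level om.sets_Ioo) (auto intro: less_imp_le)

lemma W_level_le_W:
  assumes "0 < x" "k < level U x" shows "W_level t k \<le> W (min x t)"
  unfolding W_level_def
proof (intro emeasure_mono om.sets_Ioo subsetI)
  fix y assume "y \<in> {x. 0 < x \<and> level U x \<le> k} \<inter> {0<..<t}"
  then show "y \<in> {0<..<min x t}"
    using be.level_mono[of x y] assms by (cases "y < x") auto
qed

text \<open>The Muckenhoupt constant of the Hardy inequality for functions supported in (0,t);
  \<open>min\<close> accounts for the points beyond \<open>t\<close>, where the inner integral no
  longer grows.\<close>

definition sup_profile :: "real \<Rightarrow> ennreal" where
  "sup_profile t = (SUP x\<in>{0<..}. W (min x t) powe (1 - 1 / p) * ennreal (U x) powe (1 / q))"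

text \<open>At a point of level at most \<open>k\<close> the tail exceeds 2^(-k-1), which costs
  2^(1/q). There need not be a last such point, so the bound is proved at each of them and passed to
  their union by \<open>downset_le\<close>.\<close>

lemma mult_seq_le_sup_profile:
  assumes t: "0 < t" shows "(SUP k. mult_seq t k) \<le> two_pow (1 / q) * sup_profile t"
proof (rule SUP_least)
  fix k
  \<comment> \<open>The bound for W(x)^(1 - 1/p) at the points \<open>x\<close> of level at most
    \<open>k\<close>; it is turned into a bound for the measure itself because measures are what
    \<open>downset_le\<close> compares.\<close>
  define c where "c = two_pow (1 / q) * sup_profile t * two_pow (1 / q * real_of_int k)"
  have p': "0 < 1 - 1 / p" using p by simp
  have "W_level t k \<le> c powe (1 / (1 - 1 / p))"
    unfolding W_level_def
  proof (rule om.downset_le(2))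
    fix x assume x: "x \<in> {x. 0 < x \<and> level U x \<le> k} \<inter> {0<..<t}"
    then have x0: "0 < x" "x < t" "\<not> k + 1 \<le> level U x" by auto
    have "2 powr (- real_of_int (k + 1)) \<le> U x"
      using x0 be.U_pos[of x] by (subst (asm) le_level_iff) auto
    then have "two_pow (- real_of_int (k + 1)) powe (1 / q) \<le> ennreal (U x) powe (1 / q)"
      using q by (intro powe_mono) (auto simp: two_pow_def intro!: ennreal_leI)
    moreover have "two_pow (- c) powe (1 / q) = two_pow (- (1 / q) * c)" for c
      using q by (simp add: two_pow_powe)
    ultimately have u: "two_pow (- (1 / q) * real_of_int (k + 1)) \<le> ennreal (U x) powe (1 / q)"
      by (simp only:)
    have "W x powe (1 - 1 / p) = W x powe (1 - 1 / p) * two_pow (- (1 / q) * real_of_int (k + 1)) * two_pow (1 / q * real_of_int (k + 1))"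
      unfolding mult.assoc two_pow_add[symmetric] by (simp add: two_pow_def)
    also have "\<dots> \<le> W x powe (1 - 1 / p) * ennreal (U x) powe (1 / q) * two_pow (1 / q * real_of_int (k + 1))"
      by (intro mult_left_mono mult_right_mono u) auto
    also have "W x powe (1 - 1 / p) * ennreal (U x) powe (1 / q) \<le> sup_profile t"
      unfolding sup_profile_def using x0 by (intro SUP_upper2[of x]) auto
    also have "two_pow (1 / q * real_of_int (k + 1)) = two_pow (1 / q) * two_pow (1 / q * real_of_int k)"
      unfolding two_pow_add[symmetric] using q by (simp add: field_simps)
    also have "sup_profile t * (two_pow (1 / q) * two_pow (1 / q * real_of_int k)) = c"
      by (simp add: c_def mult_ac)
    finally have "W x powe (1 - 1 / p) \<le> c" by (simp add: mult_right_mono)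
    then show "W x \<le> c powe (1 / (1 - 1 / p))"
      using p' by (simp add: powe_le_powe_iff)
  next
    fix x y assume "x \<in> {x. 0 < x \<and> level U x \<le> k} \<inter> {0<..<t}" "0 < y" "y \<le> x"
    then show "y \<in> {x. 0 < x \<and> level U x \<le> k} \<inter> {0<..<t}"
      using be.level_mono[of y x] by auto
  qed auto
  then have "W_level t k powe (1 - 1 / p) \<le> c"
    using p' by (simp add: powe_le_powe_iff)
  then have "mult_seq t k \<le> two_pow (- (1 / q) * real_of_int k) * c"
    unfolding mult_seq_def by (rule mult_left_mono) simp
  also have "\<dots> = two_pow (1 / q) * sup_profile t * (two_pow (- (1 / q) * real_of_int k) * two_pow (1 / q * real_of_int k))"
    by (simp add: c_def mult_ac)
  also have "\<dots> = two_pow (1 / q) * sup_profile t"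
    unfolding two_pow_add[symmetric] by (simp add: two_pow_def)
  finally show "mult_seq t k \<le> two_pow (1 / q) * sup_profile t" .
qed

lemma sup_profile_le_mult_seq: "sup_profile t \<le> (SUP k. mult_seq t k)"
  unfolding sup_profile_def
proof (rule SUP_least)
  fix x :: real assume "x \<in> {0<..}"
  then have x: "0 < x" by simp
  have "U x \<le> 2 powr (- real_of_int (level U x))"
    using le_level_iff[of U x "level U x"] be.U_pos[OF x] by simp
  then have "ennreal (U x) powe (1 / q) \<le> two_pow (- real_of_int (level U x)) powe (1 / q)"
    using q by (intro powe_mono) (auto simp: two_pow_def intro!: ennreal_leI)
  also have "\<dots> = two_pow (- (1 / q) * real_of_int (level U x))"
    using q by (simp add: two_pow_powe mult.commute)
  finally have "W (min x t) powe (1 - 1 / p) * ennreal (U x) powe (1 / q) \<le> mult_seq t (level U x)"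
    unfolding mult_seq_def using p W_le_W_level[OF x]
    by (subst mult.commute) (intro mult_mono powe_mono, auto)
  then show "W (min x t) powe (1 - 1 / p) * ennreal (U x) powe (1 / q) \<le> (SUP k. mult_seq t k)"
    by (rule order_trans) (rule SUP_upper, simp)
qed

lemma W_level_nonempty: "W_level t k \<noteq> 0 \<Longrightarrow> \<exists>x>0. level U x \<le> k"
proof -
  assume "W_level t k \<noteq> 0"
  then have "{x. 0 < x \<and> level U x \<le> k} \<inter> {0<..<t} \<noteq> {}"
    unfolding W_level_def by (metis emeasure_empty)
  then show ?thesis by auto
qed

text \<open>The integral condition replacing Muckenhoupt's for q < p, where \<nu> stands for the
  Stieltjes measure of minus the tail to the power r/q.\<close>

definition int_profile :: "real measure \<Rightarrow> real \<Rightarrow> real \<Rightarrow> ennreal" where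
  "int_profile \<nu> r t = (\<integral>\<^sup>+x. W (min x t) powe (r * (1 - 1 / p)) \<partial>\<nu>) powe (1 / r)"

lemma lnorm_mult_seq:
  assumes r: "0 < r"
  shows "sqnorm r (mult_seq t) = (\<integral>\<^sup>+k. two_pow (- (r / q) * real_of_int k) * W_level t k powe (r * (1 - 1 / p)) \<partial>count_space UNIV) powe (1 / r)"
proof -
  have "mult_seq t k powe r = two_pow (- (r / q) * real_of_int k) * W_level t k powe (r * (1 - 1 / p))" for k
    unfolding mult_seq_def using r p by (simp add: powe_mult powe_powe two_pow_powe mult.commute)
  then show ?thesis by (simp add: lnorm_def)
qed

lemma int_profile_le_mult_seq:
  assumes nu: "dyadic_tail \<nu> U (r / q)" and r: "0 < r"
  shows "int_profile \<nu> r t \<le> sqnorm r (mult_seq t)"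
proof -
  interpret nu: dyadic_tail \<nu> U "r / q" by (rule nu)
  have a: "0 < r * (1 - 1 / p)" using r p by simp
  have "(\<integral>\<^sup>+x. W (min x t) powe (r * (1 - 1 / p)) \<partial>\<nu>) \<le> (\<integral>\<^sup>+x. W_level t (level U x) powe (r * (1 - 1 / p)) \<partial>\<nu>)"
    using a W_le_W_level by (intro nn_integral_mono powe_mono) auto
  also have "\<dots> = (\<integral>\<^sup>+k. W_level t k powe (r * (1 - 1 / p)) * emeasure \<nu> {x. 0 < x \<and> level U x = k} \<partial>count_space UNIV)"
    by (rule nu.nn_integral_level)
  also have "\<dots> \<le> (\<integral>\<^sup>+k. two_pow (- (r / q) * real_of_int k) * W_level t k powe (r * (1 - 1 / p)) \<partial>count_space UNIV)"
    by (subst mult.commute, intro nn_integral_mono mult_right_mono nu.emeasure_level_eq_le) simp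
  finally show ?thesis
    unfolding int_profile_def lnorm_mult_seq[OF r] using r by (intro powe_mono) auto
qed

text \<open>The ratio between the \<nu>-mass (1 - 2^(-r/q)) * 2^(-r k/q) of level \<open>k\<close>
  and the factor 2^(-r (k-1)/q) in the preceding term of the sequence.\<close>

definition int_const :: "real \<Rightarrow> real" where
  "int_const r = (1 - 2 powr (- (r / q))) * 2 powr (- (r / q))"

lemma int_const_pos: "0 < r \<Longrightarrow> 0 < int_const r"
  using q powr_less_mono[of "- (r / q)" 0 2] by (simp add: int_const_def)

lemma mult_seq_le_int_profile:
  assumes nu: "dyadic_tail \<nu> U (r / q)" and r: "0 < r"
  shows "sqnorm r (mult_seq t) \<le> ennreal (int_const r powr (- (1 / r))) * int_profile \<nu> r t"
proof -
  interpret nu: dyadic_tail \<nu> U "r / q" by (rule nu)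
  define b where "b = r * (1 - 1 / p)"
  have b: "0 < b" using r p by (simp add: b_def)
  let ?S = "\<integral>\<^sup>+k. two_pow (- (r / q) * real_of_int k) * W_level t k powe b \<partial>count_space UNIV"
  have bij: "bij_betw (\<lambda>k. k - 1) (UNIV :: int set) UNIV"
    by (rule bij_betwI[where g = "\<lambda>k. k + 1"]) auto
  \<comment> \<open>The shift by one is forced by \<open>W_level_le_W\<close>: at a point
    \<open>x\<close> of level \<open>k\<close>, only the mass of strictly lower levels is known to
    lie left of \<open>x\<close>.\<close>
  have term_le: "ennreal (int_const r) * (two_pow (- (r / q) * real_of_int (k - 1)) * W_level t (k - 1) powe b)
      \<le> W_level t (k - 1) powe b * emeasure \<nu> {x. 0 < x \<and> level U x = k}" for k
  proof (cases "W_level t (k - 1) = 0")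
    case True
    then show ?thesis using b by simp
  next
    case False
    then obtain x0 where "0 < x0" "level U x0 < k" using W_level_nonempty[of t "k - 1"] by auto
    then have "emeasure \<nu> {x. 0 < x \<and> level U x = k} = ennreal (1 - 2 powr (- (r / q))) * two_pow (- (r / q) * real_of_int k)"
      by (rule nu.emeasure_level_eq)
    also have "two_pow (- (r / q) * real_of_int k) = two_pow (- (r / q)) * two_pow (- (r / q) * real_of_int (k - 1))"
      unfolding two_pow_add[symmetric] by (rule arg_cong[where f = two_pow]) (use q in \<open>simp add: field_simps\<close>)
    also have "ennreal (1 - 2 powr (- (r / q))) * (two_pow (- (r / q)) * two_pow (- (r / q) * real_of_int (k - 1)))
        = ennreal (int_const r) * two_pow (- (r / q) * real_of_int (k - 1))"
      by (simp add: int_const_def two_pow_def ennreal_mult'' mult.assoc)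
    finally show ?thesis by (simp add: mult_ac)
  qed
  have "ennreal (int_const r) * ?S = (\<integral>\<^sup>+k. ennreal (int_const r) * (two_pow (- (r / q) * real_of_int k) * W_level t k powe b) \<partial>count_space UNIV)"
    by (rule nn_integral_cmult[symmetric]) simp
  also have "\<dots> = (\<integral>\<^sup>+k. ennreal (int_const r) * (two_pow (- (r / q) * real_of_int (k - 1)) * W_level t (k - 1) powe b) \<partial>count_space UNIV)"
    by (rule nn_integral_bij_count_space[OF bij, symmetric])
  also have "\<dots> \<le> (\<integral>\<^sup>+k. W_level t (k - 1) powe b * emeasure \<nu> {x. 0 < x \<and> level U x = k} \<partial>count_space UNIV)"
    by (intro nn_integral_mono term_le)
  also have "\<dots> = (\<integral>\<^sup>+x. W_level t (level U x - 1) powe b \<partial>\<nu>)"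
    by (rule nu.nn_integral_level[symmetric])
  also have "\<dots> \<le> (\<integral>\<^sup>+x. W (min x t) powe b \<partial>\<nu>)"
    using b by (intro nn_integral_mono powe_mono W_level_le_W) auto
  finally have le: "ennreal (int_const r) * ?S \<le> (\<integral>\<^sup>+x. W (min x t) powe b \<partial>\<nu>)" .
  have "?S = ennreal (inverse (int_const r)) * (ennreal (int_const r) * ?S)"
    using int_const_pos[OF r] by (simp add: mult.assoc[symmetric] ennreal_mult[symmetric])
  also have "\<dots> \<le> ennreal (inverse (int_const r)) * (\<integral>\<^sup>+x. W (min x t) powe b \<partial>\<nu>)"
    by (rule mult_left_mono[OF le]) simp
  finally have "?S powe (1 / r) \<le> (ennreal (inverse (int_const r)) * (\<integral>\<^sup>+x. W (min x t) powe b \<partial>\<nu>)) powe (1 / r)"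
    using r by (intro powe_mono) auto
  also have "\<dots> = ennreal (int_const r powr (- (1 / r))) * int_profile \<nu> r t"
    using r int_const_pos[OF r]
    by (simp add: powe_mult int_profile_def b_def powe_ennreal powr_minus inverse_powr)
  finally show ?thesis unfolding lnorm_mult_seq[OF r] b_def .
qed

end

section \<open>The fundamental function\<close>

lemma min_of_mono_pos:
  fixes f :: "real \<Rightarrow> ennreal"
  assumes "\<And>x y. 0 < x \<Longrightarrow> x \<le> y \<Longrightarrow> f x \<le> f y" "0 < x" "0 < y"
  shows "f (min x y) = min (f x) (f y)"
  using assms(1)[of x y] assms(1)[of y x] assms(2,3) by (cases "x \<le> y") (auto simp: min_def)

text \<open>The denominator lies between the larger of the two numbers and twice it.\<close>

lemma ennreal_parallel_sum:
  fixes a b :: ennreal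
  assumes "0 < a" "a < top" "0 < b" "b < top"
  shows "b * (a / (a + b)) \<le> min a b" "min a b \<le> 2 * (b * (a / (a + b)))"
proof -
  obtain r s where rs: "a = ennreal r" "0 < r" "b = ennreal s" "0 < s"
    using assms by (cases a; cases b) auto
  have eq: "b * (a / (a + b)) = ennreal (s * (r / (r + s)))"
    using rs by (simp add: ennreal_plus[symmetric] divide_ennreal ennreal_mult[symmetric] del: ennreal_plus)
  have "s * (r / (r + s)) \<le> min r s" "min r s \<le> 2 * (s * (r / (r + s)))"
    using rs by (auto simp: min_def field_simps)
  then show "b * (a / (a + b)) \<le> min a b" "min a b \<le> 2 * (b * (a / (a + b)))"
    unfolding eq using rs
    by (auto simp: min_def ennreal_leI ennreal_mult[symmetric] ennreal_numeral[symmetric] simp del: ennreal_numeral)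
qed

lemma ennreal_mult_le_cancel_left:
  fixes a b c :: ennreal
  assumes "0 < a" "a < top" "a * b \<le> a * c" shows "b \<le> c"
  using assms by (simp add: ennreal_mult_le_mult_iff)

lemma ennreal_le_mult_inverse:
  fixes a b c :: ennreal
  assumes "0 < a" "a < top" shows "b * inverse a \<le> c \<longleftrightarrow> b \<le> c * a"
proof -
  have "a * inverse a = 1"
    using assms by (auto simp: divide_ennreal_def[symmetric] intro!: ennreal_divide_self)
  then have "b = a * (b * inverse a)" by (metis mult.left_commute mult.right_neutral)
  then have "b \<le> c * a \<longleftrightarrow> a * (b * inverse a) \<le> a * c" by (simp add: mult.commute)
  also have "\<dots> \<longleftrightarrow> b * inverse a \<le> c"
    using assms by (intro ennreal_mult_le_mult_iff) auto
  finally show ?thesis by simp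
qed

text \<open>\<open>\<N>\<close> stands for the weighted supremum norm in part (i) and for the norm of \<open>L^(p1 \<rightarrow> q2)\<close> with respect
  to the Stieltjes measure in part (ii).\<close>

locale fundamental_function =
  fixes V N \<phi> :: "real \<Rightarrow> ennreal" and \<N> :: "(real \<Rightarrow> ennreal) \<Rightarrow> ennreal"
  assumes V_pos: "0 < x \<Longrightarrow> 0 < V x" and V_fin: "0 < x \<Longrightarrow> V x < top"
    and V_mono: "0 < x \<Longrightarrow> x \<le> y \<Longrightarrow> V x \<le> V y"
    and N_pos: "0 < x \<Longrightarrow> 0 < N x" and N_fin: "0 < x \<Longrightarrow> N x < top"
    and phi_ge: "0 < x \<Longrightarrow> 0 < t \<Longrightarrow> V (min x t) * inverse (N t) \<le> 4 * \<phi> x"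
    and phi_le: "0 < x \<Longrightarrow> \<phi> x \<le> (SUP t\<in>{0<..}. V (min x t) * inverse (N t))"
    and norm_mono: "(\<And>y. 0 < y \<Longrightarrow> f y \<le> g y) \<Longrightarrow> \<N> f \<le> \<N> g"
    and norm_cmult: "(\<And>x y. 0 < x \<Longrightarrow> x \<le> y \<Longrightarrow> f x \<le> f y) \<Longrightarrow> \<N> (\<lambda>y. c * f y) = c * \<N> f"
begin

definition quot :: "real \<Rightarrow> real \<Rightarrow> ennreal" where
  "quot t x = V t / (V t + V x)"

lemma V_min: "0 < x \<Longrightarrow> 0 < y \<Longrightarrow> V (min x y) = min (V x) (V y)"
  by (rule min_of_mono_pos) (rule V_mono)

lemma quot_bounds:
  assumes "0 < x" "0 < y"
  shows "V x * quot y x \<le> V (min y x)" "V (min y x) \<le> 2 * (V x * quot y x)"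
  unfolding quot_def V_min[OF assms(2,1)]
  by (rule ennreal_parallel_sum[OF V_pos[OF assms(2)] V_fin[OF assms(2)] V_pos[OF assms(1)] V_fin[OF assms(1)]])+

text \<open>\<open>norm_cmult\<close> is available for increasing functions only, since these are
  measurable for the Stieltjes measure; this makes it applicable to the quotient.\<close>

lemma quot_mono: "0 < x \<Longrightarrow> 0 < y \<Longrightarrow> y \<le> z \<Longrightarrow> quot y x \<le> quot z x"
proof -
  assume x: "0 < x" "0 < y" "y \<le> z"
  obtain a where a: "V x = ennreal a" "0 < a" using V_pos[of x] V_fin[of x] x by (cases "V x") auto
  obtain b where b: "V y = ennreal b" "0 < b" using V_pos[of y] V_fin[of y] x by (cases "V y") auto
  obtain c where c: "V z = ennreal c" "0 < c" using V_pos[of z] V_fin[of z] x by (cases "V z") auto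
  have "b \<le> c" using V_mono[of y z] x b c by simp
  then have "b / (b + a) \<le> c / (c + a)" using a b c by (simp add: field_simps)
  then show ?thesis
    using a b c by (simp add: quot_def ennreal_plus[symmetric] divide_ennreal ennreal_leI del: ennreal_plus)
qed

definition best :: ennreal where
  "best = (SUP x\<in>{0<..}. \<phi> x * \<N> (\<lambda>t. quot t x))"

lemma V_norm_quot:
  assumes x: "0 < x"
  shows "V x * \<N> (\<lambda>y. quot y x) \<le> \<N> (\<lambda>y. V (min y x))"
    and "\<N> (\<lambda>y. V (min y x)) \<le> 2 * (V x * \<N> (\<lambda>y. quot y x))"
proof -
  have "V x * \<N> (\<lambda>y. quot y x) = \<N> (\<lambda>y. V x * quot y x)"
    using quot_mono x by (intro norm_cmult[symmetric]) auto
  then show "V x * \<N> (\<lambda>y. quot y x) \<le> \<N> (\<lambda>y. V (min y x))"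
    using quot_bounds(1)[OF x] by (auto intro: norm_mono)
  have "\<N> (\<lambda>y. V (min y x)) \<le> \<N> (\<lambda>y. (2 * V x) * quot y x)"
    using quot_bounds(2)[OF x] by (intro norm_mono) (simp add: mult.assoc)
  also have "\<dots> = (2 * V x) * \<N> (\<lambda>y. quot y x)"
    using quot_mono x by (intro norm_cmult) auto
  finally show "\<N> (\<lambda>y. V (min y x)) \<le> 2 * (V x * \<N> (\<lambda>y. quot y x))"
    by (simp add: mult.assoc)
qed

text \<open>The supremum \<open>best\<close> is tested at the point \<open>t\<close> itself. The
  constant is 8 = 4 * 2, from \<open>phi_ge\<close> and from the comparison of the quotient with the
  minimum; \<open>V t\<close> is cancelled at the end.\<close>

lemma norm_le_best:
  assumes t: "0 < t" shows "\<N> (\<lambda>y. V (min y t)) \<le> 8 * best * N t"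
proof (rule ennreal_mult_le_cancel_left[OF V_pos[OF t] V_fin[OF t]])
  have le: "V t \<le> 4 * \<phi> t * N t"
    using phi_ge[OF t t] by (simp add: ennreal_le_mult_inverse[OF N_pos[OF t] N_fin[OF t]])
  have "V t * \<N> (\<lambda>y. V (min y t)) \<le> (4 * \<phi> t * N t) * (2 * (V t * \<N> (\<lambda>y. quot y t)))"
    by (intro mult_mono le V_norm_quot(2)[OF t]) auto
  also have "\<dots> = (4 * 2) * (V t * ((\<phi> t * \<N> (\<lambda>y. quot y t)) * N t))"
    by (simp only: mult_ac)
  also have "\<dots> \<le> (4 * 2) * (V t * (best * N t))"
    unfolding best_def using t by (intro mult_left_mono mult_right_mono SUP_upper) auto
  also have "\<dots> = V t * (8 * best * N t)"
    by (simp add: mult_ac)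
  finally show "V t * \<N> (\<lambda>y. V (min y t)) \<le> V t * (8 * best * N t)" .
qed

text \<open>After inserting the supremum that bounds \<open>\<phi> x\<close>, the profile at
  \<open>x\<close> has to be replaced by the profile at \<open>t\<close>. This is where the growth
  of the profile, and its decrease after division by \<open>V\<close>, are used.\<close>

lemma best_le:
  assumes c: "\<And>t. 0 < t \<Longrightarrow> \<N> (\<lambda>y. V (min y t)) \<le> c * N t"
  shows "best \<le> c"
  unfolding best_def
proof (rule SUP_least)
  fix x :: real assume "x \<in> {0<..}"
  then have x: "0 < x" by simp
  let ?q = "\<N> (\<lambda>y. quot y x)"
  have "\<phi> x * ?q \<le> (SUP t\<in>{0<..}. V (min x t) * inverse (N t)) * ?q"
    by (intro mult_right_mono phi_le x) simp
  also have "\<dots> = (SUP t\<in>{0<..}. V (min x t) * inverse (N t) * ?q)"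
    by (rule SUP_mult_right_ennreal)
  also have "\<dots> \<le> c"
  proof (rule SUP_least)
    fix t :: real assume "t \<in> {0<..}"
    then have t: "0 < t" by simp
    have "V x * (V (min x t) * ?q) = V (min x t) * (V x * ?q)" by (simp add: mult_ac)
    also have "\<dots> \<le> V (min x t) * \<N> (\<lambda>y. V (min y x))"
      by (intro mult_left_mono V_norm_quot(1) x) simp
    also have "\<dots> = \<N> (\<lambda>y. V (min x t) * V (min y x))"
      using x by (intro norm_cmult[symmetric] V_mono) auto
    also have "\<dots> \<le> \<N> (\<lambda>y. V x * V (min y t))"
    proof (rule norm_mono)
      fix y :: real assume y: "0 < y"
      \<comment> \<open>Pointwise in \<open>y\<close>: for x <= t this expresses that the profile
        increases, for t < x that its quotient by \<open>V\<close> decreases.\<close>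
      show "V (min x t) * V (min y x) \<le> V x * V (min y t)"
      proof (cases "x \<le> t")
        case True
        then show ?thesis using x y by (auto intro!: mult_left_mono V_mono simp: min_def)
      next
        case False
        then have "V t * V (min y x) \<le> V x * V (min y t)"
        proof (cases "y \<le> t")
          case True
          then show ?thesis using False x t by (auto intro!: mult_right_mono V_mono simp: min_def)
        next
          case yt: False
          then show ?thesis using False x t y
            by (subst mult.commute) (auto intro!: mult_right_mono V_mono simp: min_def)
        qed
        then show ?thesis using False by (simp add: min_def)
      qed
    qed
    also have "\<dots> = V x * \<N> (\<lambda>y. V (min y t))"
      using t by (intro norm_cmult V_mono) auto
    also have "\<dots> \<le> V x * (c * N t)" by (intro mult_left_mono c t) simp
    finally have "V (min x t) * ?q \<le> c * N t"
      by (rule ennreal_mult_le_cancel_left[OF V_pos[OF x] V_fin[OF x]])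
    then have "V (min x t) * ?q * inverse (N t) \<le> c"
      using ennreal_le_mult_inverse[OF N_pos[OF t] N_fin[OF t]] by blast
    then show "V (min x t) * inverse (N t) * ?q \<le> c" by (simp add: mult_ac)
  qed
  finally show "\<phi> x * ?q \<le> c" .
qed

end

context hardy_discretization
begin

text \<open>Finite \<alpha>(0,t) and a finite norm of \<open>a\<close> put the test function of
  \<open>hardy_lower\<close> into the class where the inequality is assumed; 2^(2/q) removes the
  loss of that construction.\<close>

lemma hardy_lower_multiplier:
  assumes C: "\<And>g. g \<in> borel_measurable \<omega> \<Longrightarrow>
      (\<integral>\<^sup>+x. (\<integral>\<^sup>+y. g y powe p * indicator {x<..} y \<partial>\<omega>) powe (s / p) \<partial>\<alpha>) < top \<Longrightarrow>
      lnorm \<beta> q (\<lambda>x. \<integral>\<^sup>+y. g y * indicator {0<..<x} y \<partial>\<omega>)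
        \<le> C * (\<integral>\<^sup>+x. (\<integral>\<^sup>+y. g y powe p * indicator {x<..} y \<partial>\<omega>) powe (s / p) \<partial>\<alpha>) powe (1 / s)"
    and t: "0 < t" "emeasure \<alpha> {0<..<t} < top" and a: "sqnorm p a < top"
  shows "sqnorm q (\<lambda>k. mult_seq t k * a k) \<le> (two_pow (2 / q) * C * emeasure \<alpha> {0<..<t} powe (1 / s)) * sqnorm p a"
proof -
  obtain g where g: "g \<in> borel_measurable \<omega>"
    and g1: "(\<integral>\<^sup>+x. (\<integral>\<^sup>+y. g y powe p * indicator {x<..} y \<partial>\<omega>) powe (s / p) \<partial>\<alpha>) powe (1 / s)
      \<le> sqnorm p a * emeasure \<alpha> {0<..<t} powe (1 / s)" (is "?Z powe _ \<le> _")
    and g2: "two_pow (- 2 / q) * sqnorm q (\<lambda>k. mult_seq t k * a k)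
      \<le> lnorm \<beta> q (\<lambda>x. \<integral>\<^sup>+y. g y * indicator {0<..<x} y \<partial>\<omega>)"
    using hardy_lower[OF t(1), of a] by blast
  have "?Z powe (1 / s) < top"
    using s t a by (intro le_less_trans[OF g1]) (auto simp: ennreal_mult_less_top)
  then have Z: "?Z < top" using s by simp
  have "sqnorm q (\<lambda>k. mult_seq t k * a k) = two_pow (2 / q) * (two_pow (- 2 / q) * sqnorm q (\<lambda>k. mult_seq t k * a k))"
    unfolding mult.assoc[symmetric] two_pow_add[symmetric] by (simp add: two_pow_def)
  also have "\<dots> \<le> two_pow (2 / q) * (C * ?Z powe (1 / s))"
    by (intro mult_left_mono order_trans[OF g2] C g Z) simp
  also have "\<dots> \<le> two_pow (2 / q) * (C * (sqnorm p a * emeasure \<alpha> {0<..<t} powe (1 / s)))"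
    by (intro mult_left_mono g1) auto
  finally show ?thesis by (simp add: mult_ac)
qed

lemma upper_const_finite: "upper_const < top"
  unfolding upper_const_def using p q s geo_finite[of "1/q"] geo_finite[of "s/p"]
  by (auto simp: ennreal_mult_less_top)

lemma mult_seq_finite: "0 < t \<Longrightarrow> mult_seq t k < top"
  unfolding mult_seq_def using p W_level_finite[of t k] by (auto simp: ennreal_mult_less_top)

end

section \<open>Lebesgue and Stieltjes measures as instances\<close>

lemma half_line_measure_lebesgue: "half_line_measure (lebesgue_on {0<..})"
proof
  show "space (lebesgue_on {0<..}) = {0<..}" by simp
  show "{x<..} \<in> sets (lebesgue_on {0<..})" if "0 \<le> x" for x :: real
  proof -
    have "{x<..} \<in> sets lebesgue" by simp
    then show ?thesis using that by (auto simp: sets_restrict_space_iff)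
  qed
  show "emeasure (lebesgue_on {0<..}) {x} = 0" if "0 < x" for x :: real
    using that by (subst emeasure_restrict_space) auto
qed

lemma SUP_powe:
  assumes "0 < a" shows "(SUP x\<in>A. f x) powe a = (SUP x\<in>A. f x powe a)"
proof (rule antisym)
  show "(SUP x\<in>A. f x) powe a \<le> (SUP x\<in>A. f x powe a)"
  proof -
    have "f x \<le> (SUP x\<in>A. f x powe a) powe (1 / a)" if "x \<in> A" for x
      unfolding powe_le_powe_iff[OF assms, symmetric] using that by (rule SUP_upper)
    then show ?thesis using assms by (simp add: powe_le_powe_iff SUP_least)
  qed
  show "(SUP x\<in>A. f x powe a) \<le> (SUP x\<in>A. f x) powe a"
    using assms by (intro SUP_least powe_mono SUP_upper)
qed

text \<open>Continuity of \<open>h\<close> is inherited from continuity of \<beta> along rays: from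
  the right it identifies the masses of half-open intervals, from the left it excludes atoms.
  \<open>h\<close> tends to 0 at infinity, so the tail at \<open>x\<close> is -h(x).\<close>

lemma dyadic_tail_stieltjes:
  fixes h U :: "real \<Rightarrow> real"
  assumes be: "dyadic_tail \<beta> U 1" and e: "0 < e"
    and h: "\<And>t. 0 < t \<Longrightarrow> h t = - (U t powr e)"
  shows "dyadic_tail (stieltjes_measure h) U e"
proof -
  interpret be: dyadic_tail \<beta> U 1 by (rule be)
  have U: "U x = enn2real (emeasure \<beta> {x<..})" if "0 < x" for x
    using be.tail[OF that] be.U_pos[OF that] by simp
  have U_lim: "(\<lambda>n. U (X n)) \<longlonglongrightarrow> U a" if "0 < a" "\<And>n. 0 < X n" "(\<lambda>n. emeasure \<beta> {X n<..}) \<longlonglongrightarrow> emeasure \<beta> {a<..}" for X a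
  proof -
    have "(\<lambda>n. enn2real (emeasure \<beta> {X n<..})) \<longlonglongrightarrow> enn2real (emeasure \<beta> {a<..})"
      using that(3) be.tail[OF that(1)] by (intro tendsto_enn2real) auto
    then show ?thesis using that(1,2) U by simp
  qed
  have right: "(U \<longlongrightarrow> U a) (at_right a)" if a: "0 < a" for a
  proof (rule tendsto_at_right_sequentially[of a "a + 1"])
    fix S :: "nat \<Rightarrow> real"
    assume S: "\<And>n. a < S n" "decseq S" "S \<longlonglongrightarrow> a"
    have S0: "0 < S n" for n using S(1)[of n] a by simp
    show "(\<lambda>n. U (S n)) \<longlonglongrightarrow> U a"
      using a by (intro U_lim S0 be.tendsto_emeasure_Ioi_above S) auto
  qed simp
  have mono: "mono_on {0<..} h"
  proof (rule mono_onI)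
    fix x y :: real assume "x \<in> {0<..}" "y \<in> {0<..}" "x \<le> y"
    then show "h x \<le> h y"
      using be.U_antimono[of x y] be.U_pos[of y] e by (simp add: h powr_mono2)
  qed
  have rc: "continuous (at_right t) h" if "0 < t" for t
  proof -
    have "U t \<noteq> 0" using be.U_pos[OF that] by simp
    then have "((\<lambda>t. - (U t powr e)) \<longlongrightarrow> - (U t powr e)) (at_right t)"
      by (intro tendsto_minus tendsto_powr right[OF that] tendsto_const)
    moreover have "eventually (\<lambda>x. h x = - (U x powr e)) (at_right t)"
      unfolding eventually_at_filter by (rule always_eventually) (use that h in simp)
    ultimately have "(h \<longlongrightarrow> h t) (at_right t)"
      using h[OF that] by (simp add: filterlim_cong)
    then show ?thesis by (simp add: continuous_within)
  qed
  have Ioc: "emeasure (stieltjes_measure h) {a<..b} = ennreal (U a powr e - U b powr e)" if "0 < a" "a \<le> b" for a b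
    using emeasure_stieltjes_measure_Ioc[OF mono rc that] that by (simp add: h)
  have space: "space (stieltjes_measure h) = {0<..}"
    unfolding stieltjes_measure_def by (subst space_extend_measure) auto
  have Ioc_sets: "{a<..b} \<in> sets (stieltjes_measure h)" if "0 < a" "a \<le> b" for a b
  proof -
    have "sets (stieltjes_measure h) = sigma_sets {0<..} ((\<lambda>(a, b). {a<..b}) ` {(a, b). 0 < a \<and> a \<le> b})"
      unfolding stieltjes_measure_def by (subst sets_extend_measure) auto
    then show ?thesis using that by (auto intro!: sigma_sets.Basic)
  qed
  have Ioi_Un: "{x<..} = (\<Union>n. {x<..x + real n})" for x :: real
  proof (intro set_eqI iffI)
    fix y assume y: "y \<in> {x<..}"
    obtain n where "y - x < real n" using reals_Archimedean2 by blast
    then have "y \<in> {x<..x + real n}" using y by simp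
    then show "y \<in> (\<Union>n. {x<..x + real n})" by blast
  qed auto
  have Ioi_sets: "{x<..} \<in> sets (stieltjes_measure h)" if "0 < x" for x
    unfolding Ioi_Un[of x] using that by (intro sets.countable_UN) (auto intro!: Ioc_sets)
  have tail: "emeasure (stieltjes_measure h) {x<..} = ennreal (U x powr e)" if x: "0 < x" for x
  proof -
    have "(\<lambda>n. emeasure (stieltjes_measure h) {x<..x + real n}) \<longlonglongrightarrow> emeasure (stieltjes_measure h) {x<..}"
      unfolding Ioi_Un[of x] using x by (intro Lim_emeasure_incseq) (auto simp: incseq_def intro!: Ioc_sets)
    moreover have "(\<lambda>n. emeasure (stieltjes_measure h) {x<..x + real n}) \<longlonglongrightarrow> ennreal (U x powr e - 0)"
    proof -
      have "(\<lambda>n. emeasure \<beta> {x + real n<..}) \<longlonglongrightarrow> 0"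
        by (rule be.tendsto_emeasure_Ioi_at_top[OF x]) (simp add: be.tail)
      then have "(\<lambda>n. enn2real (emeasure \<beta> {x + real n<..})) \<longlonglongrightarrow> 0"
        by (intro tendsto_enn2real) auto
      then have "(\<lambda>n. U (x + real n)) \<longlonglongrightarrow> 0"
        using x U by (simp add: add_pos_nonneg)
      then have "(\<lambda>n. U (x + real n) powr e) \<longlonglongrightarrow> 0"
        using e x be.U_pos[of "x + real n" for n]
        by (intro tendsto_zero_powrI[where b = e] always_eventually allI less_imp_le be.U_pos) auto
      then have "(\<lambda>n. ennreal (U x powr e - U (x + real n) powr e)) \<longlonglongrightarrow> ennreal (U x powr e - 0)"
        by (intro tendsto_ennrealI tendsto_diff tendsto_const)
      then show ?thesis using x by (simp add: Ioc)
    qed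
    ultimately show ?thesis by (simp add: LIMSEQ_unique)
  qed
  have null: "emeasure (stieltjes_measure h) {a} = 0" if a: "0 < a" for a
  proof -
    obtain X :: "nat \<Rightarrow> real" where X: "\<forall>n. 0 < X n \<and> X n < a" "incseq X" "X \<longlonglongrightarrow> a"
      using incseq_approx_below[OF a] by blast
    have "(\<lambda>n. U (X n)) \<longlonglongrightarrow> U a"
      using a X by (intro U_lim be.tendsto_emeasure_Ioi_below) (auto simp: be.tail)
    then have "(\<lambda>n. ennreal (U (X n) powr e - U a powr e)) \<longlonglongrightarrow> ennreal (U a powr e - U a powr e)"
      using be.U_pos[OF a] by (intro tendsto_ennrealI tendsto_diff tendsto_powr tendsto_const) auto
    moreover have "emeasure (stieltjes_measure h) {a} \<le> ennreal (U (X n) powr e - U a powr e)" for n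
    proof -
      have Xn: "0 < X n" "X n < a" using X(1) by auto
      then have "emeasure (stieltjes_measure h) {a} \<le> emeasure (stieltjes_measure h) {X n<..a}"
        by (intro emeasure_mono Ioc_sets) auto
      then show ?thesis using Ioc[of "X n" a] Xn by simp
    qed
    ultimately have "emeasure (stieltjes_measure h) {a} \<le> ennreal (U a powr e - U a powr e)"
      by (intro LIMSEQ_le_const[where X = "\<lambda>n. ennreal (U (X n) powr e - U a powr e)"]) auto
    then show ?thesis by simp
  qed
  show ?thesis
  proof
    fix x :: real assume "0 \<le> x"
    then show "{x<..} \<in> sets (stieltjes_measure h)"
      using Ioi_sets[of x] sets.top[of "stieltjes_measure h"] space by (cases "x = 0") auto
  qed (use e be.U_pos space tail null in auto)
qed

section \<open>The embedding of Copson into Cesaro spaces\<close>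

lemma Lnorm_eq:
  assumes "0 < p" "A \<in> sets lebesgue" "A \<subseteq> {0<..}"
  shows "Lnorm (ennreal p) A f = (\<integral>\<^sup>+x. f x powe p * indicator A x \<partial>lebesgue_on {0<..}) powe (1 / p)"
proof -
  have "(\<integral>\<^sup>+x. f x powe p \<partial>lebesgue_on A) = (\<integral>\<^sup>+x. f x powe p * indicator A x \<partial>lebesgue)"
    using assms by (intro nn_integral_restrict_space) auto
  also have "\<dots> = (\<integral>\<^sup>+x. (f x powe p * indicator A x) * indicator {0<..} x \<partial>lebesgue)"
    using assms by (intro nn_integral_cong) (auto split: split_indicator)
  also have "\<dots> = (\<integral>\<^sup>+x. f x powe p * indicator A x \<partial>lebesgue_on {0<..})"
    by (intro nn_integral_restrict_space[symmetric]) auto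
  finally show ?thesis
    using assms by (simp add: Lnorm_def powe_def[symmetric] inverse_ennreal inverse_eq_divide)
qed

text \<open>An interval is not a null set. This turns the almost-everywhere bound of an essential
  supremum into a bound at some point near a prescribed one.\<close>

lemma AE_lebesgue_on_interval:
  fixes a b :: real
  assumes "AE x in lebesgue_on {0<..}. P x" "0 \<le> a" "a < b"
  shows "\<exists>x. a < x \<and> x < b \<and> P x"
proof (rule ccontr)
  assume neg: "\<not> ?thesis"
  have S: "{a<..<b} \<in> sets (lebesgue_on {0<..})"
    by (subst sets_restrict_space_iff) (use assms in auto)
  have "AE x in lebesgue_on {0<..}. x \<notin> {a<..<b}"
    using assms(1) by eventually_elim (use neg in auto)
  then have "{a<..<b} \<in> null_sets (lebesgue_on {0<..})"
    using S by (simp add: AE_iff_null_sets)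
  moreover have "emeasure (lebesgue_on {0<..}) {a<..<b} = ennreal (b - a)"
    using assms by (subst emeasure_restrict_space) auto
  ultimately show False using assms by auto
qed

definition arrow_real :: "real \<Rightarrow> real \<Rightarrow> real" where
  "arrow_real p q = 1 / (1 / q - 1 / p)"

lemma arrow_exp_eq:
  assumes "0 < q" "q < p" shows "ennreal p \<leadsto> ennreal q = ennreal (arrow_real p q)"
proof -
  have "1 / p < 1 / q" using assms by (simp add: field_simps)
  then show ?thesis
    using assms by (simp add: arrow_exp_def arrow_real_def ennreal_less_iff inverse_ennreal ennreal_minus inverse_eq_divide)
qed

lemma arrow_real_pos: "0 < q \<Longrightarrow> q < p \<Longrightarrow> 0 < arrow_real p q"
  by (simp add: arrow_real_def field_simps)

lemma inverse_arrow_real: "1 / arrow_real p q = 1 / q - 1 / p"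
  by (simp add: arrow_real_def)

lemma approx_constI:
  assumes "two_pow (- a) * B \<le> A" "A \<le> K * B" "K < top"
  shows "approx_const (max (2 powr a) (enn2real K)) A B"
proof -
  let ?c = "max (2 powr a) (enn2real K)"
  have pos: "0 < 2 powr a" "2 powr a \<le> ?c" by auto
  have "inverse ?c \<le> inverse (2 powr a)" by (rule le_imp_inverse_le[OF pos(2,1)])
  then have "ennreal (inverse ?c) \<le> two_pow (- a)"
    by (simp add: two_pow_def powr_minus ennreal_leI)
  then have 1: "ennreal (inverse ?c) * B \<le> A"
    using assms(1) by (meson mult_right_mono order_trans zero_le)
  have "K = ennreal (enn2real K)" using assms(3) by simp
  also have "\<dots> \<le> ennreal ?c" by (intro ennreal_leI) simp
  finally have "A \<le> ennreal ?c * B"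
    using assms(2) by (meson mult_right_mono order_trans zero_le)
  with 1 show ?thesis by (simp add: approx_const_def)
qed

section \<open>Change of variables to the Hardy inequality\<close>

locale cop_ces =
  fixes P1 P2 Q1 Q2 :: real and v1 v2 u1 u2 :: "real \<Rightarrow> ennreal"
  assumes P2: "0 < P2" "P2 < P1" and Q1: "0 < Q1" "Q1 \<le> P2" and Q2: "P2 < Q2"
    and v1: "v1 \<in> weights" and v2: "v2 \<in> weights"
    and u1: "u1 \<in> cOmega (ennreal Q1)" and u2: "u2 \<in> Omega (ennreal Q2)"
    and V_admissible: "admissible (ext_zero (\<lambda>x. Lnorm (ennreal (arrow_real P1 P2)) {0<..<x} (\<lambda>x. inverse (v1 x) * v2 x)))"
begin

abbreviation M :: "real measure" where "M \<equiv> lebesgue_on {0<..}"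

definition v :: "real \<Rightarrow> ennreal" where "v x = inverse (v1 x) * v2 x"

definition R :: real where "R = arrow_real P1 P2"

definition V :: "real \<Rightarrow> ennreal" where "V x = Lnorm (ennreal R) {0<..<x} v"

definition N1 :: "real \<Rightarrow> ennreal" where "N1 t = Lnorm (ennreal Q1) {0<..<t} u1"

definition N2 :: "real \<Rightarrow> ennreal" where "N2 t = Lnorm (ennreal Q2) {t<..} u2"

definition \<omega> :: "real measure" where "\<omega> = density M (\<lambda>x. v x powe R)"

definition \<alpha> :: "real measure" where "\<alpha> = density M (\<lambda>x. u1 x powe Q1)"

definition \<beta> :: "real measure" where "\<beta> = density M (\<lambda>x. u2 x powe Q2)"

definition U :: "real \<Rightarrow> real" where "U x = enn2real (emeasure \<beta> {x<..})"

lemma P1: "0 < P1" and Q2_pos: "0 < Q2"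
  using P2 Q2 by auto

text \<open>P2/R is the reciprocal of the exponent conjugate to P1/P2. The last identity amounts to
  (R - P2) * P1/P2 = R, which lets a single \<open>g\<close> satisfy both relations of the
  substitution.\<close>

lemma R: "0 < R" "P2 < R" "P2 / R = 1 - P2 / P1" "R / P2 - 1 = R / P1"
proof -
  show R0: "0 < R" unfolding R_def using P2 by (rule arrow_real_pos)
  have inv: "1 / R = 1 / P2 - 1 / P1" unfolding R_def by (rule inverse_arrow_real)
  have "1 / R < 1 / P2" unfolding inv using P1 by simp
  then show "P2 < R" using R0 P2 by (simp add: field_simps)
  have "P2 / R = P2 * (1 / R)" by simp
  then show "P2 / R = 1 - P2 / P1" unfolding inv using P2 by (simp add: right_diff_distrib)
  have "R / P1 = R * (1 / P2 - 1 / R)" unfolding inv by simp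
  then show "R / P2 - 1 = R / P1" using R0 by (simp add: right_diff_distrib)
qed

lemma meas [measurable]:
  "v1 \<in> borel_measurable M" "v2 \<in> borel_measurable M" "u1 \<in> borel_measurable M" "u2 \<in> borel_measurable M"
  "v \<in> borel_measurable M"
proof -
  show [measurable]: "v1 \<in> borel_measurable M" "v2 \<in> borel_measurable M"
    and "u1 \<in> borel_measurable M" "u2 \<in> borel_measurable M"
    using v1 v2 u1 u2 by (auto simp: weights_def cOmega_def Omega_def Mplus_def)
  show "v \<in> borel_measurable M" unfolding v_def by measurable
qed

sublocale lebesgue: half_line_measure M
  by (rule half_line_measure_lebesgue)

lemma Ioo_sets: "{0<..<x} \<in> sets lebesgue" "{0<..<x} \<subseteq> {0<..}" for x :: real
  by auto

lemma V_eq: "V x = emeasure \<omega> {0<..<x} powe (1 / R)"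
  unfolding V_def \<omega>_def Lnorm_eq[OF R(1) Ioo_sets]
  using lebesgue.sets_Ioo by (subst emeasure_density) auto

lemma N1_eq: "N1 t = emeasure \<alpha> {0<..<t} powe (1 / Q1)"
  unfolding N1_def \<alpha>_def Lnorm_eq[OF Q1(1) Ioo_sets]
  using lebesgue.sets_Ioo by (subst emeasure_density) auto

lemma N2_eq: "0 < t \<Longrightarrow> N2 t = emeasure \<beta> {t<..} powe (1 / Q2)"
  unfolding N2_def \<beta>_def using lebesgue.sets_Ioi[of t] Q2_pos
  by (subst Lnorm_eq) (auto simp: emeasure_density)

text \<open>Strict monotonicity places V(x) strictly between the values of \<open>V\<close> at x/2
  and x + 1.\<close>

lemma V_pos: "0 < x \<Longrightarrow> 0 < V x" and V_fin: "0 < x \<Longrightarrow> V x < top"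
proof -
  assume x: "0 < x"
  have V': "ext_zero (\<lambda>x. Lnorm (ennreal (arrow_real P1 P2)) {0<..<x} (\<lambda>x. inverse (v1 x) * v2 x)) y = V y" if "0 < y" for y
    using that by (simp add: ext_zero_def V_def R_def v_def[abs_def])
  have sm: "strict_mono_on {0..} (ext_zero (\<lambda>x. Lnorm (ennreal (arrow_real P1 P2)) {0<..<x} (\<lambda>x. inverse (v1 x) * v2 x)))"
    using V_admissible unfolding admissible_def by blast
  have strict: "V y < V z" if "0 < y" "y < z" for y z
    using strict_mono_onD[OF sm, of y z] that V'[of y] V'[of z] by auto
  have "V (x / 2) < V x" using x by (intro strict) auto
  then show "0 < V x" by (rule le_less_trans[OF zero_le])
  have "V x < V (x + 1)" using x by (intro strict) auto
  then show "V x < top" by (rule less_le_trans) simp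
qed

lemma V_mono: "0 < x \<Longrightarrow> x \<le> y \<Longrightarrow> V x \<le> V y"
  unfolding V_eq using R lebesgue.sets_Ioo
  by (intro powe_mono emeasure_mono) (auto simp: \<omega>_def)

lemma N1: "0 < t \<Longrightarrow> 0 < N1 t" "0 < t \<Longrightarrow> N1 t < top"
  using u1 by (auto simp: cOmega_def N1_def)

lemma N2: "0 < t \<Longrightarrow> 0 < N2 t" "0 < t \<Longrightarrow> N2 t < top"
  using u2 by (auto simp: Omega_def N2_def)

lemma N1_mono: "0 < x \<Longrightarrow> x \<le> y \<Longrightarrow> N1 x \<le> N1 y"
  unfolding N1_eq using Q1 lebesgue.sets_Ioo
  by (intro powe_mono emeasure_mono) (auto simp: \<alpha>_def)

lemma beta_tail: "0 < t \<Longrightarrow> 0 < emeasure \<beta> {t<..} \<and> emeasure \<beta> {t<..} < top"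
  using N2[of t] Q2_pos by (simp add: N2_eq)

sublocale hardy_discretization \<omega> \<alpha> \<beta> U "P1 / P2" "Q2 / P2" "Q1 / P2"
proof -
  interpret om: half_line_measure \<omega>
    unfolding \<omega>_def by (rule lebesgue.half_line_measure_density) measurable
  interpret al: half_line_measure \<alpha>
    unfolding \<alpha>_def by (rule lebesgue.half_line_measure_density) measurable
  interpret be: half_line_measure \<beta>
    unfolding \<beta>_def by (rule lebesgue.half_line_measure_density) measurable
  show "hardy_discretization \<omega> \<alpha> \<beta> U (P1 / P2) (Q2 / P2) (Q1 / P2)"
  proof
    show "0 < U x" if "0 < x" for x
      using beta_tail[OF that] by (simp add: U_def enn2real_positive_iff)
    then show "emeasure \<beta> {x<..} = ennreal (U x powr 1)" if "0 < x" for x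
      using beta_tail[OF that] that by (simp add: U_def)
    show "emeasure \<omega> {0<..<x} < top" if "0 < x" for x
      using V_fin[OF that] R by (simp add: V_eq)
    show "0 < emeasure \<alpha> {0<..<t}" if "0 < t" for t
      using N1(1)[OF that] Q1 by (simp add: N1_eq)
  qed (use P2 Q1 Q2 in \<open>auto simp: field_simps\<close>)
qed

lemma N2_U: "0 < t \<Longrightarrow> N2 t = ennreal (U t powr (1 / Q2))"
  using beta_tail[of t] Q2_pos by (simp add: N2_eq U_def powe_ennreal[symmetric])

lemma v_AE: "AE x in M. 0 < v1 x \<and> v1 x < top \<and> 0 < v x \<and> v x < top \<and> v1 x * v x = v2 x"
proof -
  have "AE x in M. 0 < v1 x \<and> v1 x < \<infinity>" "AE x in M. 0 < v2 x \<and> v2 x < \<infinity>"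
    using v1 v2 by (auto simp: weights_def)
  then show ?thesis
  proof eventually_elim
    case (elim x)
    have "v1 x * inverse (v1 x) = 1"
      using elim by (auto simp: divide_ennreal_def[symmetric] intro!: ennreal_divide_self)
    then have "v1 x * v x = v2 x" unfolding v_def by (metis mult.assoc mult.left_neutral)
    moreover have "0 < v x \<and> v x < top"
    proof -
      obtain a where a: "v1 x = ennreal a" "0 < a" using elim by (cases "v1 x") auto
      obtain b where b: "v2 x = ennreal b" "0 < b" using elim by (cases "v2 x") auto
      have "v x = ennreal (inverse a * b)"
        using a b by (simp add: v_def inverse_ennreal ennreal_mult)
      then show ?thesis using a b by simp
    qed
    ultimately show ?case using elim by simp
  qed
qed

lemma nn_integral_om:
  assumes [measurable]: "h \<in> borel_measurable M"
  shows "(\<integral>\<^sup>+x. h x \<partial>\<omega>) = (\<integral>\<^sup>+x. v x powe R * h x \<partial>M)"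
  unfolding \<omega>_def by (rule nn_integral_density) measurable

text \<open>Relation \<open>fg\<close> is stated almost everywhere because the weights are positive
  and finite only almost everywhere. The outer power 1/P2 undoes the passage to P2-th
  powers.\<close>

lemma Ces_norm_eq:
  assumes [measurable]: "f \<in> borel_measurable M" "g \<in> borel_measurable M"
    and fg: "AE x in M. (f x * v2 x) powe P2 = v x powe R * g x"
  shows "Ces_norm (ennreal P2) (ennreal Q2) u2 v2 f
    = lnorm \<beta> (Q2 / P2) (\<lambda>x. \<integral>\<^sup>+y. g y * indicator {0<..<x} y \<partial>\<omega>) powe (1 / P2)"
proof -
  define F where "F x = (\<integral>\<^sup>+y. g y * indicator {0<..<x} y \<partial>\<omega>)" for x
  have [measurable]: "{0<..<x} \<in> sets M" for x by (rule lebesgue.sets_Ioo)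
  have inner: "Lnorm (ennreal P2) {0<..<t} (\<lambda>x. f x * v2 x) = F t powe (1 / P2)" for t
  proof -
    have "(\<integral>\<^sup>+x. (f x * v2 x) powe P2 * indicator {0<..<t} x \<partial>M)
        = (\<integral>\<^sup>+x. v x powe R * (g x * indicator {0<..<t} x) \<partial>M)"
      using fg by (intro nn_integral_cong_AE) (auto simp: mult.assoc)
    also have "\<dots> = F t" unfolding F_def by (rule nn_integral_om[symmetric]) measurable
    finally show ?thesis unfolding Lnorm_eq[OF P2(1) Ioo_sets] by simp
  qed
  have [measurable]: "F \<in> borel_measurable M"
    unfolding F_def
    by (rule lebesgue.borel_measurable_mono, rule nn_integral_mono) (auto split: split_indicator)
  have "Ces_norm (ennreal P2) (ennreal Q2) u2 v2 f
      = (\<integral>\<^sup>+t. (F t powe (1 / P2) * u2 t) powe Q2 * indicator {0<..} t \<partial>M) powe (1 / Q2)"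
    unfolding Ces_norm_def wLnorm_def inner using Q2_pos by (intro Lnorm_eq) auto
  also have "(\<integral>\<^sup>+t. (F t powe (1 / P2) * u2 t) powe Q2 * indicator {0<..} t \<partial>M)
      = (\<integral>\<^sup>+t. u2 t powe Q2 * F t powe (Q2 / P2) \<partial>M)"
    using Q2_pos P2 by (intro nn_integral_cong) (auto simp: powe_mult powe_powe mult.commute)
  also have "\<dots> = (\<integral>\<^sup>+t. F t powe (Q2 / P2) \<partial>\<beta>)"
    unfolding \<beta>_def by (rule nn_integral_density[symmetric]) measurable
  also have "\<dots> powe (1 / Q2) = lnorm \<beta> (Q2 / P2) F powe (1 / P2)"
    using Q2_pos P2 by (simp add: lnorm_def powe_powe)
  finally show ?thesis by (simp add: F_def[abs_def])
qed

lemma Cop_norm_eq: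
  assumes [measurable]: "f \<in> borel_measurable M" "g \<in> borel_measurable M"
    and fg: "AE x in M. (f x * v1 x) powe P1 = v x powe R * g x powe (P1 / P2)"
  shows "Cop_norm (ennreal P1) (ennreal Q1) u1 v1 f
    = ((\<integral>\<^sup>+x. (\<integral>\<^sup>+y. g y powe (P1 / P2) * indicator {x<..} y \<partial>\<omega>) powe (Q1 / P2 / (P1 / P2)) \<partial>\<alpha>) powe (1 / (Q1 / P2))) powe (1 / P2)"
proof -
  define F where "F x = (\<integral>\<^sup>+y. g y powe (P1 / P2) * indicator {x<..} y \<partial>\<omega>)" for x
  have inner: "Lnorm (ennreal P1) {t<..} (\<lambda>x. f x * v1 x) = F t powe (1 / P1)" if t: "0 < t" for t
  proof -
    have [measurable]: "{t<..} \<in> sets M" using t by (intro lebesgue.sets_Ioi) simp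
    have "(\<integral>\<^sup>+x. (f x * v1 x) powe P1 * indicator {t<..} x \<partial>M)
        = (\<integral>\<^sup>+x. v x powe R * (g x powe (P1 / P2) * indicator {t<..} x) \<partial>M)"
      using fg by (intro nn_integral_cong_AE) (auto simp: mult.assoc)
    also have "\<dots> = F t" unfolding F_def by (rule nn_integral_om[symmetric]) measurable
    finally show ?thesis using t P1 by (subst Lnorm_eq) auto
  qed
  have [measurable]: "F \<in> borel_measurable M"
    unfolding F_def
    by (rule lebesgue.borel_measurable_antimono, rule nn_integral_mono) (auto split: split_indicator)
  have "Cop_norm (ennreal P1) (ennreal Q1) u1 v1 f
      = (\<integral>\<^sup>+t. (Lnorm (ennreal P1) {t<..} (\<lambda>x. f x * v1 x) * u1 t) powe Q1 * indicator {0<..} t \<partial>M) powe (1 / Q1)"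
    unfolding Cop_norm_def wLnorm_def using Q1 by (intro Lnorm_eq) auto
  also have "(\<integral>\<^sup>+t. (Lnorm (ennreal P1) {t<..} (\<lambda>x. f x * v1 x) * u1 t) powe Q1 * indicator {0<..} t \<partial>M)
      = (\<integral>\<^sup>+t. u1 t powe Q1 * F t powe (Q1 / P1) \<partial>M)"
    using Q1 P1 inner by (intro nn_integral_cong) (auto simp: powe_mult powe_powe mult.commute)
  also have "\<dots> = (\<integral>\<^sup>+t. F t powe (Q1 / P1) \<partial>\<alpha>)"
    unfolding \<alpha>_def by (rule nn_integral_density[symmetric]) measurable
  also have "\<dots> powe (1 / Q1) = ((\<integral>\<^sup>+t. F t powe (Q1 / P2 / (P1 / P2)) \<partial>\<alpha>) powe (1 / (Q1 / P2))) powe (1 / P2)"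
    using Q1 P1 P2 by (simp add: powe_powe)
  finally show ?thesis by (simp add: F_def[abs_def])
qed

lemma substitution_forward:
  assumes [measurable]: "f \<in> borel_measurable M"
  obtains g where "g \<in> borel_measurable M"
    "AE x in M. (f x * v2 x) powe P2 = v x powe R * g x"
    "AE x in M. (f x * v1 x) powe P1 = v x powe R * g x powe (P1 / P2)"
proof
  \<comment> \<open>Forced by the first relation, as (f v2)^P2 = (f v1)^P2 * v^P2; the second then
    holds by the exponent identity for \<open>R\<close>.\<close>
  define g where "g x = (f x * v1 x) powe P2 * inverse (v x powe (R - P2))" for x
  show "g \<in> borel_measurable M" unfolding g_def by measurable
  have *: "v x powe R = v x powe P2 * v x powe (R - P2)" "v x powe R = v x powe ((R - P2) * (P1 / P2))" for x
  proof -
    show "v x powe R = v x powe P2 * v x powe (R - P2)"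
      using powe_add[of P2 "R - P2" "v x"] P2 R by simp
    have "(R - P2) * (P1 / P2) = (R / P2 - 1) * P1" using P2 by (simp add: field_simps)
    also have "\<dots> = R" unfolding R(4) using P1 by simp
    finally show "v x powe R = v x powe ((R - P2) * (P1 / P2))" by simp
  qed
  have canc: "z * inverse z = 1" if "0 < z" "z < top" for z :: ennreal
    using that by (auto simp: divide_ennreal_def[symmetric] intro!: ennreal_divide_self)
  show "AE x in M. (f x * v2 x) powe P2 = v x powe R * g x"
    using v_AE
  proof eventually_elim
    case (elim x)
    have "v x powe R * g x = v x powe P2 * (f x * v1 x) powe P2 * (v x powe (R - P2) * inverse (v x powe (R - P2)))"
      unfolding *(1) g_def by (simp only: mult_ac)
    also have "v x powe (R - P2) * inverse (v x powe (R - P2)) = 1"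
      using elim R by (intro canc) auto
    also have "v x powe P2 * (f x * v1 x) powe P2 * 1 = (f x * (v1 x * v x)) powe P2"
      using P2 by (simp add: powe_mult mult_ac)
    finally show ?case using elim by simp
  qed
  show "AE x in M. (f x * v1 x) powe P1 = v x powe R * g x powe (P1 / P2)"
    using v_AE
  proof eventually_elim
    case (elim x)
    have "v x powe R * g x powe (P1 / P2)
        = (f x * v1 x) powe P1 * (v x powe ((R - P2) * (P1 / P2)) * inverse (v x powe ((R - P2) * (P1 / P2))))"
      unfolding *(2) g_def using P1 P2 R by (simp add: powe_mult powe_powe inverse_powe[symmetric] mult_ac)
    also have "v x powe ((R - P2) * (P1 / P2)) * inverse (v x powe ((R - P2) * (P1 / P2))) = 1"
      using elim R P1 P2 by (intro canc) auto
    finally show ?case by simp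
  qed
qed

lemma substitution_backward:
  assumes [measurable]: "g \<in> borel_measurable M"
  obtains f where "f \<in> borel_measurable M"
    "AE x in M. (f x * v2 x) powe P2 = v x powe R * g x"
    "AE x in M. (f x * v1 x) powe P1 = v x powe R * g x powe (P1 / P2)"
proof
  \<comment> \<open>The same relations solved for \<open>f\<close>, so that every competitor in the
    Hardy inequality comes from a function in the Copson space.\<close>
  define f where "f x = inverse (v1 x) * (g x * v x powe (R - P2)) powe (1 / P2)" for x
  show "f \<in> borel_measurable M" unfolding f_def by measurable
  have exp: "(R - P2) * (P1 / P2) = R"
  proof -
    have "(R - P2) * (P1 / P2) = (R / P2 - 1) * P1" using P2 by (simp add: field_simps)
    also have "\<dots> = R" unfolding R(4) using P1 by simp
    finally show ?thesis .
  qed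
  have fv1: "AE x in M. f x * v1 x = (g x * v x powe (R - P2)) powe (1 / P2) \<and> v1 x * v x = v2 x"
    using v_AE
  proof eventually_elim
    case (elim x)
    have "v1 x * inverse (v1 x) = 1"
      using elim by (auto simp: divide_ennreal_def[symmetric] intro!: ennreal_divide_self)
    then show ?case using elim unfolding f_def by (metis mult.assoc mult.commute mult.left_neutral)
  qed
  then show "AE x in M. (f x * v2 x) powe P2 = v x powe R * g x"
  proof eventually_elim
    case (elim x)
    have "f x * v2 x = (g x * v x powe (R - P2)) powe (1 / P2) * v x"
      using elim by (metis mult.assoc)
    then have "(f x * v2 x) powe P2 = g x * (v x powe (R - P2) * v x powe P2)"
      using P2 by (simp add: powe_mult powe_cancel mult_ac)
    also have "v x powe (R - P2) * v x powe P2 = v x powe R"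
      using powe_add[of "R - P2" P2 "v x"] P2 R by simp
    finally show ?case by (simp add: mult.commute)
  qed
  show "AE x in M. (f x * v1 x) powe P1 = v x powe R * g x powe (P1 / P2)"
    using fv1
  proof eventually_elim
    case (elim x)
    then have "(f x * v1 x) powe P1 = g x powe (P1 / P2) * v x powe ((R - P2) * (P1 / P2))"
      using P1 P2 R by (simp add: powe_mult powe_powe)
    then show ?case unfolding exp by (simp add: mult.commute)
  qed
qed

section \<open>The function \<open>\<phi>1\<close> and its pointwise bounds\<close>

definition \<phi>1 :: "real \<Rightarrow> ennreal" where
  "\<phi>1 x = esssup M (\<lambda>t. V t * (V x / (V x + V t)) * inverse (N1 t))"

definition CI :: ennreal where
  "CI = embedding_const (Cop_norm (ennreal P1) (ennreal Q1) u1 v1) (Ces_norm (ennreal P2) (ennreal Q2) u2 v2)"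

lemma V_min: "0 < x \<Longrightarrow> 0 < y \<Longrightarrow> V (min x y) = min (V x) (V y)"
  by (rule min_of_mono_pos) (rule V_mono)

text \<open>Replaces continuity when the essential supremum in \<open>\<phi>1\<close> is bounded from below at a point.\<close>

lemma V_left_half:
  assumes t: "0 < t"
  shows "\<exists>a. 0 \<le> a \<and> a < t \<and> (\<forall>s. a < s \<longrightarrow> s < t \<longrightarrow> V t \<le> 2 * V s)"
proof -
  have eq: "ext_zero (\<lambda>x. Lnorm (ennreal (arrow_real P1 P2)) {0<..<x} (\<lambda>x. inverse (v1 x) * v2 x)) y = V y" if "0 < y" for y
    using that by (simp add: ext_zero_def V_def R_def v_def[abs_def])
  have "continuous_on {0..} (ext_zero (\<lambda>x. Lnorm (ennreal (arrow_real P1 P2)) {0<..<x} (\<lambda>x. inverse (v1 x) * v2 x)))"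
    using V_admissible unfolding admissible_def by blast
  then have "continuous_on {0<..} (ext_zero (\<lambda>x. Lnorm (ennreal (arrow_real P1 P2)) {0<..<x} (\<lambda>x. inverse (v1 x) * v2 x)))"
    by (rule continuous_on_subset) auto
  then have "continuous_on {0<..} V"
    by (rule continuous_on_eq) (simp add: eq)
  then have "isCont V t"
    using t by (simp add: continuous_on_eq_continuous_at)
  then have "(V \<longlongrightarrow> V t) (at t)" by (simp add: isCont_def)
  then have lim: "(V \<longlongrightarrow> V t) (at_left t)" by (rule tendsto_within_subset) simp
  obtain r where r: "V t = ennreal r" "0 < r" using V_pos[OF t] V_fin[OF t] by (cases "V t") auto
  have "eventually (\<lambda>s. ennreal (r / 2) < V s) (at_left t)"
    using r by (intro order_tendstoD(1)[OF lim]) (simp add: ennreal_less_iff)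
  then obtain b where b: "b < t" "\<And>s. b < s \<Longrightarrow> s < t \<Longrightarrow> ennreal (r / 2) < V s"
    unfolding eventually_at_left[OF t] by auto
  have "V t \<le> 2 * V s" if "b < s" "s < t" for s
  proof -
    have "V t = 2 * ennreal (r / 2)"
      using r by (simp add: ennreal_mult''[symmetric] ennreal_numeral[symmetric] del: ennreal_numeral)
    also have "\<dots> \<le> 2 * V s" using b(2)[OF that] by (intro mult_left_mono less_imp_le) auto
    finally show ?thesis .
  qed
  then show ?thesis using b(1) t by (intro exI[of _ "max 0 b"]) auto
qed

lemma phi1_le:
  assumes x: "0 < x" shows "\<phi>1 x \<le> (SUP t\<in>{0<..}. V (min x t) * inverse (N1 t))"
  unfolding \<phi>1_def
proof (rule esssup_I)
  have [measurable]: "V \<in> borel_measurable M" "N1 \<in> borel_measurable M"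
    using V_mono N1_mono by (auto intro: lebesgue.borel_measurable_mono)
  show "(\<lambda>t. V t * (V x / (V x + V t)) * inverse (N1 t)) \<in> borel_measurable M"
    by measurable
  show "AE t in M. V t * (V x / (V x + V t)) * inverse (N1 t) \<le> (SUP t\<in>{0<..}. V (min x t) * inverse (N1 t))"
  proof (rule AE_I2)
    fix t assume "t \<in> space M"
    then have t: "0 < t" by simp
    have "V t * (V x / (V x + V t)) \<le> V (min x t)"
      unfolding V_min[OF x t] by (rule ennreal_parallel_sum(1)[OF V_pos[OF x] V_fin[OF x] V_pos[OF t] V_fin[OF t]])
    then show "V t * (V x / (V x + V t)) * inverse (N1 t) \<le> (SUP t\<in>{0<..}. V (min x t) * inverse (N1 t))"
      using t by (intro SUP_upper2[of t] mult_right_mono) auto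
  qed
qed

text \<open>The bound by the essential supremum is used at a point \<open>s\<close> slightly left of
  \<open>t\<close>: there V(t) <= 2 V(s), and 1/N1 is at least as large as at \<open>t\<close>
  because \<open>N1\<close> increases. The constant 4 is this 2 times the 2 from the comparison with
  the minimum.\<close>

lemma phi1_ge:
  assumes x: "0 < x" and t: "0 < t" shows "V (min x t) * inverse (N1 t) \<le> 4 * \<phi>1 x"
proof -
  obtain a where a: "0 \<le> a" "a < t" "\<And>s. a < s \<Longrightarrow> s < t \<Longrightarrow> V t \<le> 2 * V s"
    using V_left_half[OF t] by blast
  have "AE s in M. V s * (V x / (V x + V s)) * inverse (N1 s) \<le> \<phi>1 x"
    unfolding \<phi>1_def by (rule esssup_AE)
  then obtain s where s: "a < s" "s < t" and le: "V s * (V x / (V x + V s)) * inverse (N1 s) \<le> \<phi>1 x"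
    using AE_lebesgue_on_interval[of _ a t] a by blast
  have s0: "0 < s" using a s by simp
  have "V (min x t) \<le> 2 * V (min x s)"
  proof (cases "x \<le> s")
    case True
    then have eq: "V (min x t) = V (min x s)" using s by (simp add: min_def)
    show ?thesis unfolding eq using mult_right_mono[of 1 2 "V (min x s)"] by simp
  next
    case False
    have "V (min x t) \<le> V t" using x t by (intro V_mono) auto
    also have "\<dots> \<le> 2 * V s" using a(3)[OF s] .
    finally show ?thesis using False by (simp add: min_def)
  qed
  also have "V (min x s) \<le> 2 * (V s * (V x / (V x + V s)))"
    unfolding V_min[OF x s0] by (rule ennreal_parallel_sum(2)[OF V_pos[OF x] V_fin[OF x] V_pos[OF s0] V_fin[OF s0]])
  finally have 1: "V (min x t) \<le> 2 * (2 * (V s * (V x / (V x + V s))))"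
    by (simp add: mult_left_mono)
  have "inverse (N1 t) \<le> inverse (N1 s)"
    using N1_mono[OF s0, of t] s N1[OF t] N1[OF s0]
    by (cases "N1 t"; cases "N1 s") (auto simp: inverse_ennreal le_imp_inverse_le intro!: ennreal_leI)
  then have "V (min x t) * inverse (N1 t) \<le> 2 * (2 * (V s * (V x / (V x + V s)))) * inverse (N1 s)"
    by (intro mult_mono 1) auto
  also have "\<dots> = (2 * 2) * (V s * (V x / (V x + V s)) * inverse (N1 s))"
    by (simp only: mult_ac)
  also have "\<dots> \<le> (2 * 2) * \<phi>1 x" by (intro mult_left_mono le) simp
  finally show ?thesis by simp
qed

lemma fundamental_functionI:
  assumes "\<And>f g. (\<And>y. 0 < y \<Longrightarrow> f y \<le> g y) \<Longrightarrow> \<N> f \<le> \<N> g"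
    and "\<And>f c. (\<And>x y. 0 < x \<Longrightarrow> x \<le> y \<Longrightarrow> f x \<le> f y) \<Longrightarrow> \<N> (\<lambda>y. c * f y) = c * \<N> f"
  shows "fundamental_function V N1 \<phi>1 \<N>"
  by unfold_locales (use assms V_pos V_fin V_mono N1 phi1_le phi1_ge in auto)

section \<open>Two-sided bounds for the embedding constant\<close>

lemma N1_powe: "0 < t \<Longrightarrow> N1 t powe P2 = emeasure \<alpha> {0<..<t} powe (1 / (Q1 / P2))"
  unfolding N1_eq using Q1 P2 by (simp add: powe_powe)

text \<open>Stated for an abstract \<N> so that both parts of the theorem use it. The norm appears
  to the power P2 because the Hardy inequality compares P2-th powers.\<close>

lemma embedding_upper:
  assumes "fundamental_function V N1 \<phi>1 \<N>"
    and mult: "\<And>t a. 0 < t \<Longrightarrow> sqnorm (Q2 / P2) (\<lambda>k. mult_seq t k * a k)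
        \<le> c1 * \<N> (\<lambda>y. V (min y t)) powe P2 * sqnorm (P1 / P2) a"
  shows "CI \<le> (upper_const * c1) powe (1 / P2) * 8 * fundamental_function.best V \<phi>1 \<N>"
proof -
  interpret ff: fundamental_function V N1 \<phi>1 \<N> by fact
  \<comment> \<open>\<open>norm_le_best\<close> raised to the power P2; the remaining factor
    N1(t)^P2 equals \<alpha>(0,t)^(1/s), as \<open>hardy_upper\<close> requires.\<close>
  let ?K = "c1 * (8 * ff.best) powe P2"
  have K: "sqnorm (Q2 / P2) (\<lambda>k. mult_seq t k * a k)
      \<le> ?K * emeasure \<alpha> {0<..<t} powe (1 / (Q1 / P2)) * sqnorm (P1 / P2) a" if t: "0 < t" for t a
  proof -
    have "\<N> (\<lambda>y. V (min y t)) powe P2 \<le> (8 * ff.best * N1 t) powe P2"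
      using P2 by (intro powe_mono ff.norm_le_best t) auto
    also have "\<dots> = (8 * ff.best) powe P2 * emeasure \<alpha> {0<..<t} powe (1 / (Q1 / P2))"
      unfolding N1_powe[OF t, symmetric] using P2 by (intro powe_mult) auto
    finally have "c1 * \<N> (\<lambda>y. V (min y t)) powe P2 * sqnorm (P1 / P2) a
        \<le> c1 * ((8 * ff.best) powe P2 * emeasure \<alpha> {0<..<t} powe (1 / (Q1 / P2))) * sqnorm (P1 / P2) a"
      by (intro mult_right_mono mult_left_mono) auto
    with mult[OF t, of a] show ?thesis by (simp add: mult.assoc)
  qed
  show ?thesis
    unfolding CI_def embedding_const_def
  proof (rule Inf_lower, rule CollectI, rule ballI)
    fix f assume "f \<in> Cop (ennreal P1) (ennreal Q1) u1 v1"
    then have f [measurable]: "f \<in> borel_measurable M"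
      and fin: "Cop_norm (ennreal P1) (ennreal Q1) u1 v1 f < top"
      by (auto simp: space_of_def Mplus_def)
    obtain g where g [measurable]: "g \<in> borel_measurable M"
      and g2: "AE x in M. (f x * v2 x) powe P2 = v x powe R * g x"
      and g1: "AE x in M. (f x * v1 x) powe P1 = v x powe R * g x powe (P1 / P2)"
      using substitution_forward[OF f] by blast
    have g_om: "g \<in> borel_measurable \<omega>" unfolding \<omega>_def by simp
    note cop = Cop_norm_eq[OF f g g1] and ces = Ces_norm_eq[OF f g g2]
    let ?Z = "\<integral>\<^sup>+x. (\<integral>\<^sup>+y. g y powe (P1 / P2) * indicator {x<..} y \<partial>\<omega>) powe (Q1 / P2 / (P1 / P2)) \<partial>\<alpha>"
    have "?Z < top" using fin Q1 P2 unfolding cop by simp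
    from hardy_upper[OF g_om K this]
    have "Ces_norm (ennreal P2) (ennreal Q2) u2 v2 f \<le> (upper_const * ?K * ?Z powe (1 / (Q1 / P2))) powe (1 / P2)"
      unfolding ces using P2 by (intro powe_mono) auto
    also have "\<dots> = (upper_const * c1) powe (1 / P2) * 8 * ff.best * Cop_norm (ennreal P1) (ennreal Q1) u1 v1 f"
      unfolding cop using P2 by (simp add: powe_mult powe_cancel mult.assoc)
    finally show "Ces_norm (ennreal P2) (ennreal Q2) u2 v2 f
        \<le> (upper_const * c1) powe (1 / P2) * 8 * ff.best * Cop_norm (ennreal P1) (ennreal Q1) u1 v1 f" .
  qed
qed

text \<open>Any admissible \<open>c\<close> yields the Hardy inequality with c^P2, hence a
  multiplier bound with 2^(2 P2/Q2) * c^P2 * N1(t)^P2. Its P2-th root is the hypothesis of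
  \<open>best_le\<close> and explains the factor 2^(2/Q2).\<close>

lemma embedding_lower:
  assumes "fundamental_function V N1 \<phi>1 \<N>"
    and mult: "\<And>t C. 0 < t \<Longrightarrow> (\<And>a. sqnorm (P1 / P2) a < top \<Longrightarrow>
          sqnorm (Q2 / P2) (\<lambda>k. mult_seq t k * a k) \<le> C * sqnorm (P1 / P2) a)
        \<Longrightarrow> \<N> (\<lambda>y. V (min y t)) powe P2 \<le> C"
  shows "two_pow (- 2 / Q2) * fundamental_function.best V \<phi>1 \<N> \<le> CI"
proof -
  interpret ff: fundamental_function V N1 \<phi>1 \<N> by fact
  show ?thesis
    unfolding CI_def embedding_const_def
  proof (rule Inf_greatest, drule CollectD)
    fix c
    assume c: "\<forall>f\<in>Cop (ennreal P1) (ennreal Q1) u1 v1.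
      Ces_norm (ennreal P2) (ennreal Q2) u2 v2 f \<le> c * Cop_norm (ennreal P1) (ennreal Q1) u1 v1 f"
    have C: "lnorm \<beta> (Q2 / P2) (\<lambda>x. \<integral>\<^sup>+y. g y * indicator {0<..<x} y \<partial>\<omega>)
        \<le> c powe P2 * (\<integral>\<^sup>+x. (\<integral>\<^sup>+y. g y powe (P1 / P2) * indicator {x<..} y \<partial>\<omega>) powe (Q1 / P2 / (P1 / P2)) \<partial>\<alpha>) powe (1 / (Q1 / P2))"
      (is "?L \<le> _ * ?Z powe _")
      if "g \<in> borel_measurable \<omega>"
        and Z: "(\<integral>\<^sup>+x. (\<integral>\<^sup>+y. g y powe (P1 / P2) * indicator {x<..} y \<partial>\<omega>) powe (Q1 / P2 / (P1 / P2)) \<partial>\<alpha>) < top" for g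
    proof -
      have g [measurable]: "g \<in> borel_measurable M" using that(1) by (simp add: \<omega>_def)
      obtain f where f [measurable]: "f \<in> borel_measurable M"
        and f2: "AE x in M. (f x * v2 x) powe P2 = v x powe R * g x"
        and f1: "AE x in M. (f x * v1 x) powe P1 = v x powe R * g x powe (P1 / P2)"
        using substitution_backward[OF g] by blast
      note cop = Cop_norm_eq[OF f g f1] and ces = Ces_norm_eq[OF f g f2]
      have "Cop_norm (ennreal P1) (ennreal Q1) u1 v1 f < top"
        unfolding cop using Z Q1 P2 by simp
      then have "f \<in> Cop (ennreal P1) (ennreal Q1) u1 v1"
        using f by (simp add: space_of_def Mplus_def)
      with c have "?L powe (1 / P2) \<le> c * (?Z powe (1 / (Q1 / P2))) powe (1 / P2)"
        unfolding cop[symmetric] ces[symmetric] by blast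
      then have "(?L powe (1 / P2)) powe P2 \<le> (c * (?Z powe (1 / (Q1 / P2))) powe (1 / P2)) powe P2"
        using P2 by (intro powe_mono) auto
      then show ?thesis using P2 by (simp add: powe_cancel powe_mult)
    qed
    have "ff.best \<le> two_pow (2 / Q2) * c"
    proof (rule ff.best_le)
      fix t :: real assume t: "0 < t"
      have "emeasure \<alpha> {0<..<t} < top"
        using N1(2)[OF t] Q1 by (simp add: N1_eq)
      then have "\<N> (\<lambda>y. V (min y t)) powe P2 \<le> two_pow (2 / (Q2 / P2)) * c powe P2 * emeasure \<alpha> {0<..<t} powe (1 / (Q1 / P2))"
        by (intro mult t hardy_lower_multiplier C)
      also have "\<dots> = (two_pow (2 / Q2) * c * N1 t) powe P2"
        using P2 N1_powe[OF t] by (simp add: powe_mult two_pow_powe)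
      finally show "\<N> (\<lambda>y. V (min y t)) \<le> two_pow (2 / Q2) * c * N1 t"
        using P2 by (simp add: powe_le_iff)
    qed
    then have "two_pow (- 2 / Q2) * ff.best \<le> two_pow (- 2 / Q2) * (two_pow (2 / Q2) * c)"
      by (rule mult_left_mono) simp
    also have "\<dots> = c"
      unfolding mult.assoc[symmetric] two_pow_add[symmetric] by (simp add: two_pow_def)
    finally show "two_pow (- 2 / Q2) * ff.best \<le> c" .
  qed
qed

lemma W_V: "emeasure \<omega> {0<..<x} powe (1 - 1 / (P1 / P2)) = V x powe P2"
proof -
  have "V x powe P2 = emeasure \<omega> {0<..<x} powe (P2 / R)"
    unfolding V_eq using P2 R(1) by (simp add: powe_powe)
  then show ?thesis unfolding R(3) by simp
qed

lemma sup_profile_eq: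
  assumes t: "0 < t"
  shows "(SUP y\<in>{0<..}. V (min y t) * N2 y) powe P2 = sup_profile t"
proof -
  have "(V (min y t) * N2 y) powe P2
      = emeasure \<omega> {0<..<min y t} powe (1 - 1 / (P1 / P2)) * ennreal (U y) powe (1 / (Q2 / P2))" if "0 < y" for y
  proof -
    have "N2 y powe P2 = ennreal (U y) powe (1 / (Q2 / P2))"
      using N2_U[OF that] be.U_pos[OF that] P2 Q2_pos by (simp add: powe_ennreal powr_powr)
    then show ?thesis unfolding W_V using P2 by (simp add: powe_mult)
  qed
  then show ?thesis
    unfolding sup_profile_def using P2 by (simp add: SUP_powe cong: SUP_cong_simp)
qed

lemma embedding_i:
  assumes "P1 \<le> Q2"
  shows "CI \<le> (upper_const * two_pow (1 / (Q2 / P2))) powe (1 / P2) * 8 *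
      (SUP x\<in>{0<..}. \<phi>1 x * (SUP t\<in>{0<..}. V t / (V t + V x) * N2 t))"
    and "two_pow (- 2 / Q2) * (SUP x\<in>{0<..}. \<phi>1 x * (SUP t\<in>{0<..}. V t / (V t + V x) * N2 t)) \<le> CI"
proof -
  define \<N> where "\<N> f = (SUP y\<in>{0<..}. f y * N2 y)" for f :: "real \<Rightarrow> ennreal"
  have ff: "fundamental_function V N1 \<phi>1 \<N>"
  proof (rule fundamental_functionI)
    show "\<N> f \<le> \<N> g" if "\<And>y. 0 < y \<Longrightarrow> f y \<le> g y" for f g
      unfolding \<N>_def
    proof (rule SUP_mono)
      fix y :: real assume "y \<in> {0<..}"
      then show "\<exists>z\<in>{0<..}. f y * N2 y \<le> g z * N2 z"
        using that[of y] by (intro bexI[of _ y] mult_right_mono) auto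
    qed
    show "\<N> (\<lambda>y. c * f y) = c * \<N> f" for f c
      unfolding \<N>_def by (simp add: SUP_mult_left_ennreal mult.assoc)
  qed
  interpret fundamental_function V N1 \<phi>1 \<N> by (rule ff)
  have best: "best = (SUP x\<in>{0<..}. \<phi>1 x * (SUP t\<in>{0<..}. V t / (V t + V x) * N2 t))"
    unfolding best_def quot_def \<N>_def ..
  have prof: "\<N> (\<lambda>y. V (min y t)) powe P2 = sup_profile t" if "0 < t" for t
    unfolding \<N>_def by (rule sup_profile_eq[OF that])
  have pq: "1 < P1 / P2" "P1 / P2 \<le> Q2 / P2" "0 < P1 / P2" "0 < Q2 / P2"
    using P2 Q2_pos P1 assms by (auto simp: divide_right_mono)
  show "CI \<le> (upper_const * two_pow (1 / (Q2 / P2))) powe (1 / P2) * 8 *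
      (SUP x\<in>{0<..}. \<phi>1 x * (SUP t\<in>{0<..}. V t / (V t + V x) * N2 t))"
    unfolding best[symmetric]
  proof (rule embedding_upper[OF ff])
    fix t a assume t: "(0::real) < t"
    have "sqnorm (Q2 / P2) (\<lambda>k. mult_seq t k * a k) \<le> (SUP k. mult_seq t k) * sqnorm (P1 / P2) a"
      by (rule multiplier_le_sup[OF pq(1,2)])
    also have "\<dots> \<le> two_pow (1 / (Q2 / P2)) * sup_profile t * sqnorm (P1 / P2) a"
      by (intro mult_right_mono mult_seq_le_sup_profile t) simp
    finally show "sqnorm (Q2 / P2) (\<lambda>k. mult_seq t k * a k)
        \<le> two_pow (1 / (Q2 / P2)) * \<N> (\<lambda>y. V (min y t)) powe P2 * sqnorm (P1 / P2) a"
      unfolding prof[OF t] .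
  qed
  show "two_pow (- 2 / Q2) * (SUP x\<in>{0<..}. \<phi>1 x * (SUP t\<in>{0<..}. V t / (V t + V x) * N2 t)) \<le> CI"
    unfolding best[symmetric]
  proof (rule embedding_lower[OF ff])
    fix t C assume t: "(0::real) < t"
      and C: "\<And>a. sqnorm (P1 / P2) a < top \<Longrightarrow> sqnorm (Q2 / P2) (\<lambda>k. mult_seq t k * a k) \<le> C * sqnorm (P1 / P2) a"
    have "sup_profile t \<le> (SUP k. mult_seq t k)" by (rule sup_profile_le_mult_seq)
    also have "\<dots> \<le> C" by (rule sup_le_multiplier[OF pq(3,4) C])
    finally show "\<N> (\<lambda>y. V (min y t)) powe P2 \<le> C" unfolding prof[OF t] .
  qed
qed

lemma embedding_ii:
  assumes "Q2 < P1"
  defines "R2 \<equiv> arrow_real P1 Q2"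
  defines "\<nu> \<equiv> stieltjes_measure (\<lambda>t. - enn2real (N2 t powe R2))"
  shows "CI \<le> (upper_const * ennreal (int_const (R2 / P2) powr (- (1 / (R2 / P2))))) powe (1 / P2) * 8 *
      (SUP x\<in>{0<..}. \<phi>1 x * lnorm \<nu> R2 (\<lambda>t. V t / (V t + V x)))"
    and "two_pow (- 2 / Q2) * (SUP x\<in>{0<..}. \<phi>1 x * lnorm \<nu> R2 (\<lambda>t. V t / (V t + V x))) \<le> CI"
proof -
  have R2: "0 < R2" "1 / R2 = 1 / Q2 - 1 / P1"
    unfolding R2_def using arrow_real_pos[OF Q2_pos assms(1)] inverse_arrow_real by auto
  \<comment> \<open>The exponent of the sequence problem, in which all exponents are divided by
    P2.\<close>
  define r where "r = R2 / P2"
  have r: "0 < r" "1 / r = 1 / (Q2 / P2) - 1 / (P1 / P2)"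
  proof -
    show "0 < r" using R2 P2 by (simp add: r_def)
    have "1 / r = P2 * (1 / R2)" by (simp add: r_def)
    then show "1 / r = 1 / (Q2 / P2) - 1 / (P1 / P2)" unfolding R2(2) by (simp add: right_diff_distrib)
  qed
  \<comment> \<open>As N2 = U^(1/Q2), the function N2^R2 is U^(R2/Q2), so its Stieltjes measure has
    the tail exponent r/q required by the discretization.\<close>
  have rq: "r / (Q2 / P2) = R2 / Q2" using P2 by (simp add: r_def)
  have nu: "dyadic_tail \<nu> U (r / (Q2 / P2))"
    unfolding \<nu>_def
  proof (rule dyadic_tail_stieltjes)
    show "dyadic_tail \<beta> U 1" by unfold_locales
    show "0 < r / (Q2 / P2)" using r P2 Q2_pos by simp
    show "- enn2real (N2 t powe R2) = - (U t powr (r / (Q2 / P2)))" if "0 < t" for t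
      unfolding rq using N2_U[OF that] R2 Q2_pos by (simp add: powe_ennreal powr_powr)
  qed
  interpret nu: dyadic_tail \<nu> U "r / (Q2 / P2)" by (rule nu)
  have ff: "fundamental_function V N1 \<phi>1 (lnorm \<nu> R2)"
  proof (rule fundamental_functionI)
    show "lnorm \<nu> R2 f \<le> lnorm \<nu> R2 g" if "\<And>y. 0 < y \<Longrightarrow> f y \<le> g y" for f g
      using that R2 by (intro lnorm_mono) auto
    show "lnorm \<nu> R2 (\<lambda>y. c * f y) = c * lnorm \<nu> R2 f" if "\<And>x y. 0 < x \<Longrightarrow> x \<le> y \<Longrightarrow> f x \<le> f y" for f c
      using R2 that by (intro lnorm_cmult nu.borel_measurable_mono) auto
  qed
  interpret fundamental_function V N1 \<phi>1 "lnorm \<nu> R2" by (rule ff)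
  have best: "best = (SUP x\<in>{0<..}. \<phi>1 x * lnorm \<nu> R2 (\<lambda>t. V t / (V t + V x)))"
    unfolding best_def quot_def ..
  have prof: "lnorm \<nu> R2 (\<lambda>y. V (min y t)) powe P2 = int_profile \<nu> r t" for t
  proof -
    have "r * (1 - 1 / (P1 / P2)) = (R2 / P2) * (P2 / R)" unfolding r_def R(3) by simp
    also have "\<dots> = (1 / R) * R2" using P2 by simp
    finally have exp: "emeasure \<omega> {0<..<min y t} powe (r * (1 - 1 / (P1 / P2))) = V (min y t) powe R2" for y
      unfolding V_eq using R(1) R2 by (simp add: powe_powe)
    show ?thesis
      unfolding lnorm_def int_profile_def exp using P2 R2(1) by (simp add: powe_powe r_def)
  qed
  have pq: "1 < Q2 / P2" "Q2 / P2 < P1 / P2"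
    using P2 Q2 assms by (auto simp: divide_strict_right_mono)
  show "CI \<le> (upper_const * ennreal (int_const (R2 / P2) powr (- (1 / (R2 / P2))))) powe (1 / P2) * 8 *
      (SUP x\<in>{0<..}. \<phi>1 x * lnorm \<nu> R2 (\<lambda>t. V t / (V t + V x)))"
    unfolding best[symmetric] r_def[symmetric]
  proof (rule embedding_upper[OF ff])
    fix t a assume t: "(0::real) < t"
    have "sqnorm (Q2 / P2) (\<lambda>k. mult_seq t k * a k) \<le> sqnorm r (mult_seq t) * sqnorm (P1 / P2) a"
      by (rule multiplier_le_lnorm[OF pq r(2)])
    also have "\<dots> \<le> ennreal (int_const r powr (- (1 / r))) * int_profile \<nu> r t * sqnorm (P1 / P2) a"
      by (intro mult_right_mono mult_seq_le_int_profile nu r) simp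
    finally show "sqnorm (Q2 / P2) (\<lambda>k. mult_seq t k * a k)
        \<le> ennreal (int_const r powr (- (1 / r))) * lnorm \<nu> R2 (\<lambda>y. V (min y t)) powe P2 * sqnorm (P1 / P2) a"
      unfolding prof .
  qed
  show "two_pow (- 2 / Q2) * (SUP x\<in>{0<..}. \<phi>1 x * lnorm \<nu> R2 (\<lambda>t. V t / (V t + V x))) \<le> CI"
    unfolding best[symmetric]
  proof (rule embedding_lower[OF ff])
    fix t C assume t: "(0::real) < t"
      and C: "\<And>a. sqnorm (P1 / P2) a < top \<Longrightarrow> sqnorm (Q2 / P2) (\<lambda>k. mult_seq t k * a k) \<le> C * sqnorm (P1 / P2) a"
    have "int_profile \<nu> r t \<le> sqnorm r (mult_seq t)" by (rule int_profile_le_mult_seq[OF nu r(1)])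
    also have "\<dots> \<le> C" by (rule lnorm_le_multiplier[OF pq r(2) C mult_seq_finite[OF t]])
    finally show "lnorm \<nu> R2 (\<lambda>y. V (min y t)) powe P2 \<le> C" unfolding prof .
  qed
qed

text \<open>This constant and the next involve the exponents only, so they can be fixed before the
  weights are given.\<close>

definition upper_i :: ennreal where
  "upper_i = (upper_const * two_pow (1 / (Q2 / P2))) powe (1 / P2) * 8"

definition upper_ii :: ennreal where
  "upper_ii = (upper_const * ennreal (int_const (arrow_real P1 Q2 / P2) powr
      (- (1 / (arrow_real P1 Q2 / P2))))) powe (1 / P2) * 8"

lemma approx_i:
  assumes "P1 \<le> Q2"
  shows "approx_const (max (2 powr (2 / Q2)) (enn2real upper_i)) CI
    (SUP x\<in>{0<..}. \<phi>1 x * (SUP t\<in>{0<..}. V t / (V t + V x) * N2 t))"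
proof (rule approx_constI)
  show "upper_i < top"
    using P2 upper_const_finite by (simp add: upper_i_def ennreal_mult_less_top)
  show "two_pow (- (2 / Q2)) * (SUP x\<in>{0<..}. \<phi>1 x * (SUP t\<in>{0<..}. V t / (V t + V x) * N2 t)) \<le> CI"
    using embedding_i(2)[OF assms] by simp
qed (use embedding_i(1)[OF assms] in \<open>simp add: upper_i_def\<close>)

lemma approx_ii:
  assumes "Q2 < P1"
  shows "approx_const (max (2 powr (2 / Q2)) (enn2real upper_ii)) CI
    (SUP x\<in>{0<..}. \<phi>1 x * lnorm (stieltjes_measure (\<lambda>t. - enn2real (N2 t powe arrow_real P1 Q2)))
      (arrow_real P1 Q2) (\<lambda>t. V t / (V t + V x)))"
proof (rule approx_constI)
  show "upper_ii < top"
    using P2 upper_const_finite by (simp add: upper_ii_def ennreal_mult_less_top)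
  show "two_pow (- (2 / Q2)) * (SUP x\<in>{0<..}. \<phi>1 x *
      lnorm (stieltjes_measure (\<lambda>t. - enn2real (N2 t powe arrow_real P1 Q2)))
        (arrow_real P1 Q2) (\<lambda>t. V t / (V t + V x))) \<le> CI"
    using embedding_ii(2)[OF assms] by simp
qed (use embedding_ii(1)[OF assms] in \<open>simp add: upper_ii_def\<close>)

end

theorem theorem7p6:
  fixes p1 p2 q1 q2 :: ennreal
  assumes "0 < p1" "p1 < \<infinity>" "0 < p2" "p2 < \<infinity>" "0 < q1" "q1 < \<infinity>" "0 < q2" "q2 < \<infinity>"
    and "p2 < p1" "q1 \<le> p2" "p2 < q2"
  shows "\<exists>c>0. \<forall>v1\<in>weights. \<forall>v2\<in>weights. \<forall>u1\<in>cOmega q1. \<forall>u2\<in>Omega q2.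
    (let v = (\<lambda>x. inverse (v1 x) * v2 x);
         V = (\<lambda>x. Lnorm (p1 \<leadsto> p2) {0<..<x} v);
         VV = (\<lambda>t x. V t / (V t + V x));
         \<phi>1 = (\<lambda>x. esssup (lebesgue_on {0<..})
                 (\<lambda>t. V t * VV x t * inverse (Lnorm q1 {0<..<t} u1)));
         CI = embedding_const (Cop_norm p1 q1 u1 v1) (Ces_norm p2 q2 u2 v2)
     in admissible (ext_zero V) \<longrightarrow>
        \<phi>1 \<in> Q (\<lambda>x. epow (V x) (inverse (p1 \<leadsto> p2))) \<longrightarrow>
        (p1 \<le> q2 \<longrightarrow>
          approx_const c CI
            (SUP x\<in>{0<..}. \<phi>1 x * (SUP t\<in>{0<..}. VV t x * Lnorm q2 {t<..} u2))) \<and>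
        (q2 < p1 \<longrightarrow>
          approx_const c CI
            (SUP x\<in>{0<..}. \<phi>1 x *
              epow (\<integral>\<^sup>+ t. epow (VV t x) (p1 \<leadsto> q2)
                      \<partial>stieltjes_measure
                        (\<lambda>t. - enn2real (epow (Lnorm q2 {t<..} u2) (p1 \<leadsto> q2))))
                (inverse (p1 \<leadsto> q2)))))"
proof -
  obtain P1 where p1: "p1 = ennreal P1" "0 < P1" using assms by (cases p1) auto
  obtain P2 where p2: "p2 = ennreal P2" "0 < P2" using assms by (cases p2) auto
  obtain Q1 where q1: "q1 = ennreal Q1" "0 < Q1" using assms by (cases q1) auto
  obtain Q2 where q2: "q2 = ennreal Q2" "0 < Q2" using assms by (cases q2) auto
  have ord: "P2 < P1" "Q1 \<le> P2" "P2 < Q2"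
    using assms p1 p2 q1 q2 by (auto simp: ennreal_less_iff)
  \<comment> \<open>Chosen outside the quantifiers over weights. The two cases exclude each other,
    so each needs only its own constant.\<close>
  define c where "c = max (2 powr (2 / Q2)) (enn2real
    (if P1 \<le> Q2 then cop_ces.upper_i P1 P2 Q1 Q2 else cop_ces.upper_ii P1 P2 Q1 Q2))"
  have arrow: "ennreal P1 \<leadsto> ennreal P2 = ennreal (arrow_real P1 P2)"
    using p2 ord by (intro arrow_exp_eq)
  show ?thesis
    unfolding p1(1) p2(1) q1(1) q2(1) arrow Let_def
  proof (intro exI[of _ c] conjI ballI impI, goal_cases)
    case 1
    show ?case by (simp add: c_def less_max_iff_disj)
  next
    case (2 v1 v2 u1 u2)
    interpret cop_ces P1 P2 Q1 Q2 v1 v2 u1 u2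
      by unfold_locales (use 2 p2 q1 ord in auto)
    have le: "P1 \<le> Q2" using 2 q2 by simp
    then have c: "c = max (2 powr (2 / Q2)) (enn2real upper_i)" by (simp add: c_def)
    show ?case
      using approx_i[OF le]
      unfolding c CI_def \<phi>1_def V_def N1_def N2_def R_def v_def[abs_def] .
  next
    case (3 v1 v2 u1 u2)
    interpret cop_ces P1 P2 Q1 Q2 v1 v2 u1 u2
      by unfold_locales (use 3 p2 q1 ord in auto)
    have less: "Q2 < P1" using 3 q2 by (simp add: ennreal_less_iff)
    then have c: "c = max (2 powr (2 / Q2)) (enn2real upper_ii)" by (simp add: c_def)
    have arrow2: "ennreal P1 \<leadsto> ennreal Q2 = ennreal (arrow_real P1 Q2)"
      using q2(2) less by (rule arrow_exp_eq)
    have inv: "inverse (ennreal (arrow_real P1 Q2)) = ennreal (1 / arrow_real P1 Q2)"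
      using arrow_real_pos[OF q2(2) less] by (simp add: inverse_ennreal inverse_eq_divide)
    show ?case
      using approx_ii[OF less]
      unfolding c CI_def \<phi>1_def V_def N1_def N2_def R_def v_def[abs_def] lnorm_def powe_def arrow2 inv .
  qed
qed

end
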